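(* Let $\kappa$ be a regular uncountable cardinal, $\chi<\kappa$ an infinite regular cardinal such that $\kappa$ is $({<}\chi)$-closed, $\varsigma<\kappa$ an ordinal, and $\lambda<\kappa$ an infinite cardinal. Put $\mathcal S:=\{E^\kappa_{\ge\chi}\cap E^\kappa_{>\Lambda}\mid\Lambda<\lambda\}$. If $\mathrm P^\bullet(\kappa,\kappa,{}_\chi{\sqsubseteq^*},1,\mathcal S,2)$ holds, then there exists a normal, prolific, $\varsigma$-splitting, $\chi$-complete streamlined $\kappa$-Souslin tree $T$ such that, for every cardinal $\Lambda<\lambda$, there is no ascending path of width $\Lambda$ through $T$.
   Context: $\kappa$ is $({<}\chi)$-closed if $\lambda'^{<\chi}<\kappa$ for all $\lambda'<\kappa$. $E^\kappa_{\ge\chi}:=\{\alpha<\kappa\mid\mathrm{cf}(\alpha)\ge\chi\}$, $E^\kappa_{>\Lambda}:=\{\alpha<\kappa\mid\mathrm{cf}(\alpha)>\Lambda\}$. $H_\kappa$: sets of hereditary cardinality $<\kappa$. A streamlined tree is a set $T\subseteq{}^{<\kappa}H_\kappa$ closed under restrictions, ordered by $\subsetneq$; $T_\alpha:=T\cap{}^\alpha H_\kappa$. It is a streamlined $\kappa$-Souslin tree if $(T,\subsetneq)$ has height $\kappa$, levels of size $<\kappa$, and no branch or antichain of size $\kappa$. $T$ is normal if for $\alpha<\beta$ with $T_\beta\neq\emptyset$ every $s\in T_\alpha$ extends to some element of $T_\beta$; prolific if for all $\alpha<\kappa$, $t\in T_\alpha$, $\{t^\frown\langle i\rangle\mid i<\max\{\omega,\alpha\}\}\subseteq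 T_{\alpha+1}$; $\varsigma$-splitting if every node has at least $\varsigma$ immediate successors; $\chi$-complete if unions of $\subsetneq$-increasing sequences from $T$ of length $<\chi$ lie in $T$. An ascending path of width $\Lambda$ through $T$ is $\langle f_\alpha\mid\alpha<\kappa\rangle$ with $f_\alpha:\Lambda\to T_\alpha$ such that for all $\alpha<\beta<\kappa$ there are $i,j<\Lambda$ with $f_\alpha(i)\subsetneq f_\beta(j)$. Notation: $\mathrm{acc}(C):=\{\alpha\in C\mid\sup(C\cap\alpha)=\alpha>0\}$; $C(j)$ is the $j$-th element of $C$; $\mathrm{succ}_n(C):=\{C(j+1)\mid j<n,\ j+1<\mathrm{otp}(C)\}$; $\mathrm{acc}(\kappa)$: nonzero limit ordinals below $\kappa$. $\mathcal F(\kappa)$: functions $C$ whose domain $\partial C$ is a nonempty club subset of $\sup(\partial C)$ not containing its supremum, with values in $H_\kappa$; $\alpha_C:=\sup(\partial C)$. $C\sqsubseteq^*D$ iff $\exists\gamma<\alpha_C$ with $C\restriction(\partial C\setminus\gamma)=D\restriction(\partial D\cap[\gamma,\alpha_C))$; $C\,{}_\chi{\sqsubseteq^*}\,D$ iff ($C\sqsubseteq^*D$ or $\mathrm{cf}(\alpha_C)<\chi$). For $B\subseteq\kappa$, $\Omega\subseteq H_\kappa$, $p\in H_{\kappa^+}$, $C\in\mathcal F(\kappa)$: $B(\Omega,p,C)$ is the set of $\beta\in B\cap\partial C$ for which some $\mathcal M\prec H_{\kappa^+}$ has $p\in\mathcal M$, $\mathcal M\cap\kappa=\beta$, $\mathcal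 M\cap\Omega=C(\beta)$. $\mathrm P^\bullet(\kappa,\mu,\mathcal R,\theta,\mathcal S,\nu)$ asserts the existence of $\langle\mathcal C_\alpha\mid\alpha<\kappa\rangle$ and a partition $\langle B_\iota\mid\iota<\kappa\rangle$ of $\kappa$ such that for every $\alpha\in\mathrm{acc}(\kappa)$: $\mathcal C_\alpha\subseteq\{C\in\mathcal F(\kappa)\mid\alpha_C=\alpha\}$, $0<|\mathcal C_\alpha|<\mu$, and for all $C\in\mathcal C_\alpha$, $\bar\alpha\in\mathrm{acc}(\partial C)$ there is $D\in\mathcal C_{\bar\alpha}$ with $D\,\mathcal R\,C$; and for every $\langle(\Omega_i,p_i,\iota_i)\mid i<\theta\rangle$ of elements of $\mathcal P(H_\kappa)\times H_{\kappa^+}\times\kappa$, every $S\in\mathcal S$ and every $n<\omega$, there are stationarily many $\alpha\in S$ with $|\mathcal C_\alpha|<\nu$ such that for all $C\in\mathcal C_\alpha$, $i<\min\{\alpha,\theta\}$: $\sup\{\gamma\in\partial C\mid\mathrm{succ}_n(\partial C\setminus\gamma)\subseteq B_{\iota_i}(\Omega_i,p_i,C)\}=\alpha$. *)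

theory Defs
  imports Main "HOL-Library.Equipollence" "HOL-Library.Countable_Set"
    "HOL-Library.Disjoint_Sets"
begin

text \<open>
  The ambient set theory is a type whose elements are sets, with \<^term>\<open>elts x\<close> the collection of
  members of \<^term>\<open>x\<close>. The axioms are Extensionality, Foundation and second-order Replacement
  (every collection that is not larger than some set is a set; this includes Separation).
  Choice is that of HOL. Every model of second-order ZFC is such a universe, and so is every
  $H_{\kappa^+}$. If \<^term>\<open>\<kappa>\<close> is an infinite set of the universe, then all collections
  of cardinality at most that of \<^term>\<open>\<kappa>\<close> are sets; hence the universe contains all
  of $H_{\kappa^+}$, which is where all the objects considered below live (as elements or as
  subcollections). Arbitrary subsets of $H_\kappa$, trees, and families indexed by ordinals are
  represented as collections \<^typ>\<open>'v set\<close> and HOL functions.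
\<close>

class set_universe =
  fixes elts :: "'a \<Rightarrow> 'a set"
  assumes extensionality: "elts x = elts y \<Longrightarrow> x = y"
    and foundation: "wf {(x, y). x \<in> elts y}"
    and replacement: "X \<lesssim> elts x \<Longrightarrow> \<exists>y. elts y = X"

text \<open>
  For every infinite type \<^typ>\<open>'a\<close> the sets of hereditary cardinality at most that of
  \<^typ>\<open>'a\<close> form a universe: well-founded trees with branching bounded by
  \<^typ>\<open>'a\<close>, up to bisimilarity.
\<close>

datatype 'a htree = HNode "'a \<Rightarrow> 'a htree option"

fun children :: "'a htree \<Rightarrow> 'a htree set" where
  "children (HNode f) = ran f"

inductive bisim :: "'a htree \<Rightarrow> 'a htree \<Rightarrow> bool" where
  bisimI: "\<lbrakk>\<forall>x\<in>children s. \<exists>y\<in>children t. bisim x y; \<forall>y\<in>children t. \<exists>x\<in>children s. bisim x y\<rbrakk>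
    \<Longrightarrow> bisim s t"

lemma htree_induct_children:
  assumes "\<And>t. (\<And>s. s \<in> children t \<Longrightarrow> P s) \<Longrightarrow> P t"
  shows "P t"
proof (induction t)
  case (HNode f)
  show ?case
  proof (rule assms)
    fix s assume "s \<in> children (HNode f)"
    then obtain i where "f i = Some s" by (auto simp: ran_def)
    then show "P s" by (intro HNode[of "f i"]) (auto intro: rangeI dest: sym)
  qed
qed

lemma bisim_refl: "bisim t t"
  by (induction t rule: htree_induct_children) (blast intro: bisimI)

lemma bisim_sym: "bisim s t \<Longrightarrow> bisim t s"
  by (induction rule: bisim.induct) (blast intro: bisimI)

lemma bisim_trans: "bisim s t \<Longrightarrow> bisim t u \<Longrightarrow> bisim s u"
proof (induction arbitrary: u rule: bisim.induct)
  case (bisimI s t)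
  from bisimI.prems
  have "\<forall>y\<in>children t. \<exists>z\<in>children u. bisim y z" "\<forall>z\<in>children u. \<exists>y\<in>children t. bisim y z"
    by (auto elim: bisim.cases)
  with bisimI.IH show ?case by (intro bisim.bisimI) meson+
qed

quotient_type 'a hset = "'a htree" / bisim
  by (rule equivpI) (auto simp: reflp_def symp_def transp_def
      intro: bisim_refl bisim_sym bisim_trans)

lemma bisim_rep_abs: "bisim (rep_hset (abs_hset t)) t"
  by (rule Quotient3_rep_abs[OF Quotient3_hset]) (rule bisim_refl)

lemma abs_hset_eq_iff: "abs_hset s = abs_hset t \<longleftrightarrow> bisim s t"
  using Quotient3_rel[OF Quotient3_hset] bisim_refl by blast

lemma abs_rep_hset: "abs_hset (rep_hset x) = x"
  by (rule Quotient3_abs_rep[OF Quotient3_hset])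

lemma bisim_iff_children: "bisim s t \<longleftrightarrow> abs_hset ` children s = abs_hset ` children t"
proof
  assume "bisim s t"
  then show "abs_hset ` children s = abs_hset ` children t"
    by cases (auto simp: image_iff abs_hset_eq_iff; meson bisim_sym)
next
  assume eq: "abs_hset ` children s = abs_hset ` children t"
  show "bisim s t"
  proof (rule bisimI)
    show "\<forall>x\<in>children s. \<exists>y\<in>children t. bisim x y"
      using eq by (metis (no_types, lifting) abs_hset_eq_iff image_iff)
    show "\<forall>y\<in>children t. \<exists>x\<in>children s. bisim x y"
      using eq by (metis (no_types, lifting) abs_hset_eq_iff image_iff)
  qed
qed

definition hset_elts :: "'a hset \<Rightarrow> 'a hset set" where
  "hset_elts x = abs_hset ` children (rep_hset x)"

lemma hset_elts_abs: "hset_elts (abs_hset t) = abs_hset ` children t"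
  unfolding hset_elts_def by (rule bisim_iff_children[THEN iffD1, OF bisim_rep_abs])

lemma children_lepoll: "children (t :: 'a htree) \<lesssim> (UNIV :: 'a set)"
proof (cases t)
  case (HNode f)
  have "children t \<subseteq> (\<lambda>i. the (f i)) ` UNIV"
    by (auto simp: HNode ran_def image_iff) (metis option.sel)
  then show ?thesis
    by (rule lepoll_trans[OF subset_imp_lepoll image_lepoll])
qed

lemma hset_elts_lepoll: "hset_elts (x :: 'a hset) \<lesssim> (UNIV :: 'a set)"
  unfolding hset_elts_def by (rule lepoll_trans[OF image_lepoll children_lepoll])

lemma hset_comprehension:
  fixes X :: "'a hset set"
  assumes "X \<lesssim> (UNIV :: 'a set)"
  shows "\<exists>x. hset_elts x = X"
proof -
  obtain g :: "'a hset \<Rightarrow> 'a" where g: "inj_on g X"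
    using assms by (auto simp: lepoll_def)
  define f where "f i = (if i \<in> g ` X then Some (rep_hset (inv_into X g i)) else None)" for i
  have "ran f = rep_hset ` X"
    using g by (auto simp: f_def ran_def image_iff split: if_splits) (metis inv_into_f_f)
  then have "hset_elts (abs_hset (HNode f)) = X"
    by (simp add: hset_elts_abs image_image abs_rep_hset)
  then show ?thesis by blast
qed

instantiation hset :: (type) set_universe
begin

definition elts_hset :: "'a hset \<Rightarrow> 'a hset set" where
  "elts_hset = hset_elts"

instance
proof
  fix x y :: "'a hset"
  assume "elts x = elts y"
  then have "bisim (rep_hset x) (rep_hset y)"
    by (simp add: elts_hset_def hset_elts_def bisim_iff_children)
  then show "x = y"
    by (metis abs_hset_eq_iff abs_rep_hset)
next
  show "wf {(x :: 'a hset, y). x \<in> elts y}"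
  proof (rule wfUNIVI)
    fix P :: "'a hset \<Rightarrow> bool" and x :: "'a hset"
    assume *: "\<forall>x. (\<forall>y. (y, x) \<in> {(x, y). x \<in> elts y} \<longrightarrow> P y) \<longrightarrow> P x"
    have "P (abs_hset t)" for t
    proof (induction t rule: htree_induct_children)
      case (1 t)
      then have "\<forall>y. y \<in> hset_elts (abs_hset t) \<longrightarrow> P y" by (auto simp: hset_elts_abs)
      then show ?case using *[rule_format, of "abs_hset t"] by (simp add: elts_hset_def)
    qed
    from this[of "rep_hset x"] show "P x" by (simp add: abs_rep_hset)
  qed
next
  fix X :: "'a hset set" and x :: "'a hset"
  assume "X \<lesssim> elts x"
  then have "X \<lesssim> hset_elts x" by (simp add: elts_hset_def)
  from lepoll_trans[OF this hset_elts_lepoll] show "\<exists>y. elts y = X"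
    unfolding elts_hset_def by (rule hset_comprehension)
qed

end

definition vset :: "'v::set_universe set \<Rightarrow> 'v" where
  "vset X = (THE x. elts x = X)"

definition vpair :: "'v::set_universe \<Rightarrow> 'v \<Rightarrow> 'v" where
  "vpair a b = vset {vset {a}, vset {a, b}}"

definition vfun :: "'v::set_universe \<Rightarrow> bool" where
  "vfun f \<longleftrightarrow> (\<forall>q\<in>elts f. \<exists>a b. q = vpair a b) \<and>
    (\<forall>a b c. vpair a b \<in> elts f \<and> vpair a c \<in> elts f \<longrightarrow> b = c)"

definition vdom :: "'v::set_universe \<Rightarrow> 'v set" where
  "vdom f = {a. \<exists>b. vpair a b \<in> elts f}"

definition vran :: "'v::set_universe \<Rightarrow> 'v set" where
  "vran f = {b. \<exists>a. vpair a b \<in> elts f}"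

definition vapp :: "'v::set_universe \<Rightarrow> 'v \<Rightarrow> 'v" where
  "vapp f a = (THE b. vpair a b \<in> elts f)"

definition vrestrict :: "'v::set_universe \<Rightarrow> 'v set \<Rightarrow> 'v" where
  "vrestrict f X = vset {q \<in> elts f. \<exists>a\<in>X. \<exists>b. q = vpair a b}"

text \<open>Von Neumann ordinals; \<open>\<alpha> < \<beta>\<close> is \<open>\<alpha> \<in> elts \<beta>\<close>.\<close>

definition Ord :: "'v::set_universe \<Rightarrow> bool" where
  "Ord \<alpha> \<longleftrightarrow> (\<forall>x\<in>elts \<alpha>. elts x \<subseteq> elts \<alpha>) \<and> (\<forall>x\<in>elts \<alpha>. \<forall>y\<in>elts x. elts y \<subseteq> elts x)"

definition ole :: "'v::set_universe \<Rightarrow> 'v \<Rightarrow> bool" where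
  "ole \<alpha> \<beta> \<longleftrightarrow> \<alpha> \<in> elts \<beta> \<or> \<alpha> = \<beta>"

definition least_ord :: "('v::set_universe \<Rightarrow> bool) \<Rightarrow> 'v" where
  "least_ord P = (THE \<alpha>. Ord \<alpha> \<and> P \<alpha> \<and> (\<forall>\<beta>\<in>elts \<alpha>. \<not> P \<beta>))"

definition ozero :: "'v::set_universe" where
  "ozero = vset {}"

definition osucc :: "'v::set_universe \<Rightarrow> 'v" where
  "osucc \<alpha> = vset (insert \<alpha> (elts \<alpha>))"

definition osup :: "'v::set_universe set \<Rightarrow> 'v" where
  "osup X = least_ord (\<lambda>\<alpha>. \<forall>\<xi>\<in>X. ole \<xi> \<alpha>)"

definition omega :: "'v::set_universe" where
  "omega = least_ord (\<lambda>\<alpha>. infinite (elts \<alpha>))"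

definition Card :: "'v::set_universe \<Rightarrow> bool" where
  "Card \<kappa> \<longleftrightarrow> Ord \<kappa> \<and> (\<forall>\<alpha>\<in>elts \<kappa>. elts \<alpha> \<prec> elts \<kappa>)"

definition cf :: "'v::set_universe \<Rightarrow> 'v" where
  "cf \<alpha> = least_ord (\<lambda>\<delta>. \<exists>f. f ` elts \<delta> \<subseteq> elts \<alpha> \<and> (\<forall>\<beta>\<in>elts \<alpha>. \<exists>i\<in>elts \<delta>. ole \<beta> (f i)))"

definition regular_card :: "'v::set_universe \<Rightarrow> bool" where
  "regular_card \<kappa> \<longleftrightarrow> Card \<kappa> \<and> infinite (elts \<kappa>) \<and> cf \<kappa> = \<kappa>"

definition seqs :: "'v::set_universe \<Rightarrow> 'v set \<Rightarrow> 'v set" where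
  "seqs \<delta> X = {f. vfun f \<and> vdom f = elts \<delta> \<and> vran f \<subseteq> X}"

text \<open>$\lambda'^{<\chi}$ is read as the cardinality of ${}^{<\chi}\lambda'$, the set of all sequences
  of length less than $\chi$ in $\lambda'$.\<close>

definition lt_closed :: "'v::set_universe \<Rightarrow> 'v \<Rightarrow> bool" where
  "lt_closed \<chi> \<kappa> \<longleftrightarrow> (\<forall>\<xi>\<in>elts \<kappa>. (\<Union>\<delta>\<in>elts \<chi>. seqs \<delta> (elts \<xi>)) \<prec> elts \<kappa>)"

definition E_ge :: "'v::set_universe \<Rightarrow> 'v \<Rightarrow> 'v set" where
  "E_ge \<kappa> \<chi> = {\<alpha> \<in> elts \<kappa>. ole \<chi> (cf \<alpha>)}"

definition E_gt :: "'v::set_universe \<Rightarrow> 'v \<Rightarrow> 'v set" where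
  "E_gt \<kappa> \<Lambda> = {\<alpha> \<in> elts \<kappa>. \<Lambda> \<in> elts (cf \<alpha>)}"

definition trcl :: "'v::set_universe \<Rightarrow> 'v set" where
  "trcl x = {y. (y, x) \<in> {(a, b). a \<in> elts b}\<^sup>+}"

definition Hset :: "'v::set_universe \<Rightarrow> 'v set" where
  "Hset \<kappa> = {x. trcl x \<prec> elts \<kappa>}"

text \<open>$H_{\kappa^+}$, without reference to the ordinal $\kappa^+$, which need not be an element of
  the universe.\<close>

definition Hset_plus :: "'v::set_universe \<Rightarrow> 'v set" where
  "Hset_plus \<kappa> = {x. trcl x \<lesssim> elts \<kappa>}"

definition acc_pts :: "'v::set_universe set \<Rightarrow> 'v set" where
  "acc_pts C = {\<alpha> \<in> C. osup (C \<inter> elts \<alpha>) = \<alpha> \<and> \<alpha> \<noteq> ozero}"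

definition club_in :: "'v::set_universe \<Rightarrow> 'v set \<Rightarrow> bool" where
  "club_in \<alpha> D \<longleftrightarrow> D \<subseteq> elts \<alpha> \<and> osup D = \<alpha> \<and>
    (\<forall>\<beta>\<in>elts \<alpha>. \<beta> \<noteq> ozero \<and> osup (D \<inter> elts \<beta>) = \<beta> \<longrightarrow> \<beta> \<in> D)"

definition stationary_in :: "'v::set_universe \<Rightarrow> 'v set \<Rightarrow> bool" where
  "stationary_in \<kappa> S \<longleftrightarrow> S \<subseteq> elts \<kappa> \<and> (\<forall>D. club_in \<kappa> D \<longrightarrow> S \<inter> D \<noteq> {})"

definition otp :: "'v::set_universe set \<Rightarrow> 'v" where
  "otp C = (THE \<delta>. Ord \<delta> \<and>
    (\<exists>f. bij_betw f (elts \<delta>) C \<and> (\<forall>i\<in>elts \<delta>. \<forall>j\<in>elts i. f j \<in> elts (f i))))"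

definition nth_elt :: "'v::set_universe set \<Rightarrow> 'v \<Rightarrow> 'v" where
  "nth_elt C j = (THE \<gamma>. \<gamma> \<in> C \<and> otp (C \<inter> elts \<gamma>) = j)"

definition succ_n :: "'v::set_universe \<Rightarrow> 'v set \<Rightarrow> 'v set" where
  "succ_n n C = {nth_elt C (osucc j) | j. j \<in> elts n \<and> osucc j \<in> elts (otp C)}"

datatype fm = Mem nat nat | Equal nat nat | Neg fm | Conj fm fm | Forall nat fm

fun sat :: "'v::set_universe set \<Rightarrow> (nat \<Rightarrow> 'v) \<Rightarrow> fm \<Rightarrow> bool" where
  "sat A e (Mem i j) \<longleftrightarrow> e i \<in> elts (e j)"
| "sat A e (Equal i j) \<longleftrightarrow> e i = e j"
| "sat A e (Neg \<phi>) \<longleftrightarrow> \<not> sat A e \<phi>"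
| "sat A e (Conj \<phi> \<psi>) \<longleftrightarrow> sat A e \<phi> \<and> sat A e \<psi>"
| "sat A e (Forall i \<phi>) \<longleftrightarrow> (\<forall>a\<in>A. sat A (e(i := a)) \<phi>)"

definition elementary_submodel :: "'v::set_universe set \<Rightarrow> 'v set \<Rightarrow> bool" where
  "elementary_submodel M N \<longleftrightarrow> M \<noteq> {} \<and> M \<subseteq> N \<and>
    (\<forall>\<phi> e. range e \<subseteq> M \<longrightarrow> (sat M e \<phi> \<longleftrightarrow> sat N e \<phi>))"

definition FF :: "'v::set_universe \<Rightarrow> 'v set" where
  "FF \<kappa> = {C. vfun C \<and> vdom C \<subseteq> elts \<kappa> \<and> vdom C \<noteq> {} \<and> club_in (osup (vdom C)) (vdom C) \<and>
    osup (vdom C) \<notin> vdom C \<and> vran C \<subseteq> Hset \<kappa>}"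

definition sup_dom :: "'v::set_universe \<Rightarrow> 'v" where
  "sup_dom C = osup (vdom C)"

definition sq_star :: "'v::set_universe \<Rightarrow> 'v \<Rightarrow> bool" where
  "sq_star C D \<longleftrightarrow> (\<exists>\<gamma>\<in>elts (sup_dom C).
    vrestrict C (vdom C - elts \<gamma>) = vrestrict D (vdom D \<inter> (elts (sup_dom C) - elts \<gamma>)))"

definition sq_star_chi :: "'v::set_universe \<Rightarrow> 'v \<Rightarrow> 'v \<Rightarrow> bool" where
  "sq_star_chi \<chi> C D \<longleftrightarrow> sq_star C D \<or> cf (sup_dom C) \<in> elts \<chi>"

definition guess_set :: "'v::set_universe \<Rightarrow> 'v set \<Rightarrow> 'v set \<Rightarrow> 'v \<Rightarrow> 'v \<Rightarrow> 'v set" where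
  "guess_set \<kappa> B \<Omega> p C = {\<beta> \<in> B \<inter> vdom C. \<exists>M. elementary_submodel M (Hset_plus \<kappa>) \<and> p \<in> M \<and>
    M \<inter> elts \<kappa> = elts \<beta> \<and> M \<inter> \<Omega> = elts (vapp C \<beta>)}"

text \<open>The cells of the partition are not required to be nonempty; that follows from the last clause
  whenever \<open>\<S>\<close> is nonempty and \<open>\<theta> \<ge> 1\<close>. \<open>\<theta>\<close> is an ordinal and \<open>\<mu>\<close>, \<open>\<nu>\<close> are cardinals.\<close>

definition P_bullet ::
  "'v::set_universe \<Rightarrow> 'v \<Rightarrow> ('v \<Rightarrow> 'v \<Rightarrow> bool) \<Rightarrow> 'v \<Rightarrow> 'v set set \<Rightarrow> 'v \<Rightarrow> bool" where
  "P_bullet \<kappa> \<mu> R \<theta> \<S> \<nu> \<longleftrightarrow> (\<exists>(\<C> :: 'v \<Rightarrow> 'v set) (B :: 'v \<Rightarrow> 'v set).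
    (\<Union>\<iota>\<in>elts \<kappa>. B \<iota>) = elts \<kappa> \<and> disjoint_family_on B (elts \<kappa>) \<and>
    (\<forall>\<alpha>\<in>acc_pts (elts \<kappa>).
      \<C> \<alpha> \<subseteq> {C \<in> FF \<kappa>. sup_dom C = \<alpha>} \<and> \<C> \<alpha> \<noteq> {} \<and> \<C> \<alpha> \<prec> elts \<mu> \<and>
      (\<forall>C\<in>\<C> \<alpha>. \<forall>\<alpha>'\<in>acc_pts (vdom C). \<exists>D\<in>\<C> \<alpha>'. R D C)) \<and>
    (\<forall>(\<Omega> :: 'v \<Rightarrow> 'v set) (p :: 'v \<Rightarrow> 'v) (\<iota> :: 'v \<Rightarrow> 'v).
      (\<forall>i\<in>elts \<theta>. \<Omega> i \<subseteq> Hset \<kappa> \<and> p i \<in> Hset_plus \<kappa> \<and> \<iota> i \<in> elts \<kappa>) \<longrightarrow>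
      (\<forall>S\<in>\<S>. \<forall>n\<in>elts omega.
        stationary_in \<kappa> {\<alpha> \<in> S. \<C> \<alpha> \<prec> elts \<nu> \<and>
          (\<forall>C\<in>\<C> \<alpha>. \<forall>i\<in>elts \<alpha> \<inter> elts \<theta>.
            osup {\<gamma> \<in> vdom C. succ_n n (vdom C - elts \<gamma>) \<subseteq> guess_set \<kappa> (B (\<iota> i)) (\<Omega> i) (p i) C}
              = \<alpha>)})))"

definition streamlined_tree :: "'v::set_universe \<Rightarrow> 'v set \<Rightarrow> bool" where
  "streamlined_tree \<kappa> T \<longleftrightarrow> T \<subseteq> (\<Union>\<alpha>\<in>elts \<kappa>. seqs \<alpha> (Hset \<kappa>)) \<and>
    (\<forall>t\<in>T. \<forall>\<beta>\<in>vdom t. vrestrict t (elts \<beta>) \<in> T)"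

definition tless :: "'v::set_universe \<Rightarrow> 'v \<Rightarrow> bool" where
  "tless s t \<longleftrightarrow> elts s \<subset> elts t"

definition level :: "'v::set_universe set \<Rightarrow> 'v \<Rightarrow> 'v set" where
  "level T \<alpha> = {t \<in> T. vdom t = elts \<alpha>}"

text \<open>For streamlined trees, \<open>level T \<alpha>\<close> is the set of nodes whose predecessors have order type \<open>\<alpha>\<close>.\<close>

definition height :: "'v::set_universe set \<Rightarrow> 'v" where
  "height T = least_ord (\<lambda>\<alpha>. level T \<alpha> = {})"

definition tchain :: "'v::set_universe set \<Rightarrow> 'v set \<Rightarrow> bool" where
  "tchain T A \<longleftrightarrow> A \<subseteq> T \<and> (\<forall>s\<in>A. \<forall>t\<in>A. s = t \<or> tless s t \<or> tless t s)"

definition tbranch :: "'v::set_universe set \<Rightarrow> 'v set \<Rightarrow> bool" where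
  "tbranch T A \<longleftrightarrow> tchain T A \<and> (\<forall>A'. tchain T A' \<and> A \<subseteq> A' \<longrightarrow> A' = A)"

definition tantichain :: "'v::set_universe set \<Rightarrow> 'v set \<Rightarrow> bool" where
  "tantichain T A \<longleftrightarrow> A \<subseteq> T \<and> (\<forall>s\<in>A. \<forall>t\<in>A. \<not> tless s t)"

definition streamlined_Souslin_tree :: "'v::set_universe \<Rightarrow> 'v set \<Rightarrow> bool" where
  "streamlined_Souslin_tree \<kappa> T \<longleftrightarrow> streamlined_tree \<kappa> T \<and> height T = \<kappa> \<and>
    (\<forall>\<alpha>\<in>elts \<kappa>. level T \<alpha> \<prec> elts \<kappa>) \<and>
    \<not> (\<exists>A. tbranch T A \<and> A \<approx> elts \<kappa>) \<and> \<not> (\<exists>A. tantichain T A \<and> A \<approx> elts \<kappa>)"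

definition normal_tree :: "'v::set_universe \<Rightarrow> 'v set \<Rightarrow> bool" where
  "normal_tree \<kappa> T \<longleftrightarrow> (\<forall>\<beta>\<in>elts \<kappa>. \<forall>\<alpha>\<in>elts \<beta>. level T \<beta> \<noteq> {} \<longrightarrow>
    (\<forall>s\<in>level T \<alpha>. \<exists>t\<in>level T \<beta>. tless s t))"

definition prolific_tree :: "'v::set_universe \<Rightarrow> 'v set \<Rightarrow> bool" where
  "prolific_tree \<kappa> T \<longleftrightarrow> (\<forall>\<alpha>\<in>elts \<kappa>. \<forall>t\<in>level T \<alpha>. \<forall>i\<in>elts omega \<union> elts \<alpha>.
    vset (insert (vpair \<alpha> i) (elts t)) \<in> level T (osucc \<alpha>))"

definition imm_succs :: "'v::set_universe set \<Rightarrow> 'v \<Rightarrow> 'v set" where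
  "imm_succs T t = {s \<in> T. tless t s \<and> \<not> (\<exists>u\<in>T. tless t u \<and> tless u s)}"

definition splitting_tree :: "'v::set_universe \<Rightarrow> 'v set \<Rightarrow> bool" where
  "splitting_tree \<sigma> T \<longleftrightarrow> (\<forall>t\<in>T. elts \<sigma> \<lesssim> imm_succs T t)"

definition complete_tree :: "'v::set_universe \<Rightarrow> 'v set \<Rightarrow> bool" where
  "complete_tree \<chi> T \<longleftrightarrow> (\<forall>\<delta>\<in>elts \<chi>. \<forall>t :: 'v \<Rightarrow> 'v.
    (\<forall>i\<in>elts \<delta>. t i \<in> T) \<and> (\<forall>j\<in>elts \<delta>. \<forall>i\<in>elts j. tless (t i) (t j)) \<longrightarrow>
    vset (\<Union>i\<in>elts \<delta>. elts (t i)) \<in> T)"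

definition ascending_path ::
  "'v::set_universe \<Rightarrow> 'v \<Rightarrow> 'v set \<Rightarrow> ('v \<Rightarrow> 'v \<Rightarrow> 'v) \<Rightarrow> bool" where
  "ascending_path \<kappa> \<Lambda> T f \<longleftrightarrow> (\<forall>\<alpha>\<in>elts \<kappa>. \<forall>i\<in>elts \<Lambda>. f \<alpha> i \<in> level T \<alpha>) \<and>
    (\<forall>\<beta>\<in>elts \<kappa>. \<forall>\<alpha>\<in>elts \<beta>. \<exists>i\<in>elts \<Lambda>. \<exists>j\<in>elts \<Lambda>. tless (f \<alpha> i) (f \<beta> j))"

end

theory Submission
  imports Defs
begin

text \<open>
  The levels $T_\alpha$ are built by recursion, every node of $T_\alpha$ having at least
  $\max\{|\alpha|,|\varsigma|,|\lambda|\}$ immediate successors. At limits of cofinality below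
  $\chi$ all branches are extended. At the other limits a node $x$ below $\alpha$ and a
  $C\in\mathcal C_\alpha$ determine a branch through $x$ that climbs along $\partial C$, and exactly
  these branches are extended; the coherence of the $C$'s keeps the climbing inside the tree at the
  accumulation points of $\partial C$. Climbing from $\gamma$ to the next point $\beta$ of
  $\partial C$, the branch picks a node extending some element of $C(\beta)$ if $\beta\in B_0$, and
  otherwise a node avoiding the elements of $C(\beta)$ on level $\gamma+1$, each time if possible.

  If $C(\beta)$ guesses a dense set, every node of $T_\alpha$ is above an element of that set, hence
  antichains are small. If $C(\beta)$ guesses the nodes of an ascending path of width $\Lambda$ and
  $\mathrm{cf}(\alpha)>\Lambda$, the $\Lambda$ many branches forming the path at $\alpha$ all climb
  from some common $\gamma$ on and avoid the path on level $\gamma+1$, since each node has more than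
  $\Lambda$ immediate successors. A large branch would be an ascending path of width $1$.
\<close>

section \<open>Ordinals\<close>

text \<open>One ladder has to serve two purposes, since C(\<beta>) may guess a dense set or a path.
  The cells decide: for \<beta> in \<open>B ozero\<close> the value is read as a dense set to be
  met, while the path argument guesses in the disjoint cell \<open>B (osucc ozero)\<close>. A
  position of the walk depends only on the starting node, the levels and the ladder up to that
  point, never on \<alpha>. Hence a walk can be restarted from one of its own positions on another
  ladder that agrees from there on; this is what puts the walk into the tree at accumulation points.
  Coherence may fail at cofinality below \<chi>, exactly where all branches are extended;
  \<open>lt_closed\<close> keeps those levels small. Guessing happens at cofinality at least \<chi>,
  so the level there consists of selected branches only, and the bound 2 on the number of ladders
  makes all of them climb the same ladder: the path argument needs one pair \<gamma> < \<beta> for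
  \<Lambda> many branches. Level \<gamma>+1 is the first on which extensions of a fixed node of
  level \<gamma> can differ.\<close>

lemma eps_induct: "(\<And>x::'v::set_universe. (\<And>y. y \<in> elts x \<Longrightarrow> P y) \<Longrightarrow> P x) \<Longrightarrow> P a"
  using wf_induct_rule[OF foundation, of P a] by blast

lemma mem_irrefl [simp]: "(x::'v::set_universe) \<notin> elts x"
  using wf_irrefl[OF foundation] by blast

lemma mem_asym: "(x::'v::set_universe) \<in> elts y \<Longrightarrow> y \<notin> elts x"
  using wf_not_sym[OF foundation] by blast

lemma vset_elts [simp]: "vset (elts x) = (x::'v::set_universe)"
  unfolding vset_def by (rule the_equality) (auto intro: extensionality)

text \<open>\<open>vset\<close> is a definite description, so a set-builder term can be unfolded
  only after its size has been bounded by that of some set.\<close>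

lemma elts_vset_lepoll: "(X :: 'v set) \<lesssim> elts (y::'v::set_universe) \<Longrightarrow> elts (vset X) = X"
  using replacement[of X y] by auto

lemma elts_vset_subset: "X \<subseteq> elts (y::'v::set_universe) \<Longrightarrow> elts (vset X) = X"
  by (rule elts_vset_lepoll[OF subset_imp_lepoll])

lemma elts_ozero [simp]: "elts (ozero::'v::set_universe) = {}"
  unfolding ozero_def by (rule elts_vset_subset[of _ undefined]) simp

lemma Ord_in_Ord: "Ord \<alpha> \<Longrightarrow> \<beta> \<in> elts \<alpha> \<Longrightarrow> Ord \<beta>"
  unfolding Ord_def by blast

lemma Ord_trans: "Ord \<alpha> \<Longrightarrow> \<beta> \<in> elts \<alpha> \<Longrightarrow> \<gamma> \<in> elts \<beta> \<Longrightarrow> \<gamma> \<in> elts \<alpha>"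
  unfolding Ord_def by blast

lemma Ord_mem_subset: "Ord \<alpha> \<Longrightarrow> \<beta> \<in> elts \<alpha> \<Longrightarrow> elts \<beta> \<subseteq> elts \<alpha>"
  unfolding Ord_def by blast

lemma Ord_ozero [simp]: "Ord ozero"
  unfolding Ord_def by simp

lemma Ord_linear: "Ord \<alpha> \<Longrightarrow> Ord \<beta> \<Longrightarrow> \<alpha> \<in> elts \<beta> \<or> \<alpha> = \<beta> \<or> \<beta> \<in> elts \<alpha>"
proof (induction \<alpha> arbitrary: \<beta> rule: eps_induct)
  case outer: (1 \<alpha>)
  from outer.prems(2) show ?case
  proof (induction \<beta> rule: eps_induct)
    case inner: (1 \<beta>)
    show ?case
    proof (rule ccontr)
      assume neg: "\<not> ?thesis"
      have "x \<in> elts \<beta>" if "x \<in> elts \<alpha>" for x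
        using outer.IH[OF that Ord_in_Ord[OF outer.prems(1) that] inner.prems] neg that
          Ord_trans[OF outer.prems(1) that] by blast
      moreover have "x \<in> elts \<alpha>" if "x \<in> elts \<beta>" for x
        using inner.IH[OF that Ord_in_Ord[OF inner.prems that]] neg that
          Ord_trans[OF inner.prems that] by blast
      ultimately show False using neg extensionality by blast
    qed
  qed
qed

lemma ole_iff_subset: "Ord \<alpha> \<Longrightarrow> Ord \<beta> \<Longrightarrow> ole \<alpha> \<beta> \<longleftrightarrow> elts \<alpha> \<subseteq> elts \<beta>"
  unfolding ole_def using Ord_linear[of \<alpha> \<beta>] Ord_mem_subset mem_irrefl by blast

lemma not_ole_iff: "Ord \<alpha> \<Longrightarrow> Ord \<beta> \<Longrightarrow> \<not> ole \<alpha> \<beta> \<longleftrightarrow> \<beta> \<in> elts \<alpha>"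
  unfolding ole_def using Ord_linear[of \<alpha> \<beta>] mem_asym mem_irrefl by blast

lemma not_mem_iff_subset: "Ord \<alpha> \<Longrightarrow> Ord \<beta> \<Longrightarrow> \<beta> \<notin> elts \<alpha> \<longleftrightarrow> elts \<alpha> \<subseteq> elts \<beta>"
  using not_ole_iff ole_iff_subset by blast

lemma subset_mem_trans: "Ord \<alpha> \<Longrightarrow> Ord \<gamma> \<Longrightarrow> elts \<alpha> \<subseteq> elts \<beta> \<Longrightarrow> \<beta> \<in> elts \<gamma> \<Longrightarrow> \<alpha> \<in> elts \<gamma>"
  by (metis Ord_in_Ord Ord_trans ole_def ole_iff_subset)

lemma least_ord_props:
  assumes "Ord \<alpha>" "P \<alpha>"
  shows "Ord (least_ord P)" "P (least_ord P)" "\<And>\<beta>. \<beta> \<in> elts (least_ord P) \<Longrightarrow> \<not> P \<beta>"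
proof -
  have "\<exists>\<gamma>. Ord \<gamma> \<and> P \<gamma> \<and> (\<forall>\<beta>\<in>elts \<gamma>. \<not> P \<beta>)"
    using assms
  proof (induction \<alpha> rule: eps_induct)
    case (1 x)
    then show ?case by (meson Ord_in_Ord)
  qed
  then have "\<exists>!\<gamma>. Ord \<gamma> \<and> P \<gamma> \<and> (\<forall>\<beta>\<in>elts \<gamma>. \<not> P \<beta>)"
    using Ord_linear by blast
  from theI'[OF this]
  show "Ord (least_ord P)" "P (least_ord P)" "\<And>\<beta>. \<beta> \<in> elts (least_ord P) \<Longrightarrow> \<not> P \<beta>"
    unfolding least_ord_def by blast+
qed

lemma least_ord_eqI:
  assumes "Ord \<alpha>" "P \<alpha>" "\<And>\<beta>. \<beta> \<in> elts \<alpha> \<Longrightarrow> \<not> P \<beta>"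
  shows "least_ord P = \<alpha>"
  using least_ord_props[of \<alpha> P] assms Ord_linear by blast

lemma least_ord_subset: "Ord \<alpha> \<Longrightarrow> P \<alpha> \<Longrightarrow> elts (least_ord P) \<subseteq> elts \<alpha>"
  using least_ord_props[of \<alpha> P] not_mem_iff_subset by blast

section \<open>Suprema, limit ordinals and cofinality\<close>

text \<open>No \<delta> below \<alpha> bounds \<open>X\<close>, and for ordinals failing to be at
  most \<delta> means lying above \<delta>. Clubs and accumulation points are used in this strict
  form.\<close>

lemma osup_eq_iff:
  assumes "Ord \<alpha>" "X \<subseteq> elts \<alpha>"
  shows "osup X = \<alpha> \<longleftrightarrow> (\<forall>\<delta>\<in>elts \<alpha>. \<exists>\<xi>\<in>X. \<delta> \<in> elts \<xi>)"
proof -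
  have ub: "\<forall>\<xi>\<in>X. ole \<xi> \<alpha>" using assms(2) by (auto simp: ole_def)
  have "(\<forall>\<xi>\<in>X. ole \<xi> \<delta>) \<longleftrightarrow> \<not> (\<exists>\<xi>\<in>X. \<delta> \<in> elts \<xi>)" if "\<delta> \<in> elts \<alpha>" for \<delta>
    using not_ole_iff Ord_in_Ord[OF assms(1)] that assms(2) by blast
  moreover have "osup X = \<alpha> \<longleftrightarrow> (\<forall>\<delta>\<in>elts \<alpha>. \<not> (\<forall>\<xi>\<in>X. ole \<xi> \<delta>))"
  proof
    assume eq: "osup X = \<alpha>"
    show "\<forall>\<delta>\<in>elts \<alpha>. \<not> (\<forall>\<xi>\<in>X. ole \<xi> \<delta>)"
      using least_ord_props(3)[of \<alpha> "\<lambda>\<alpha>. \<forall>\<xi>\<in>X. ole \<xi> \<alpha>", OF assms(1) ub]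
      unfolding osup_def[symmetric] eq by blast
  next
    assume "\<forall>\<delta>\<in>elts \<alpha>. \<not> (\<forall>\<xi>\<in>X. ole \<xi> \<delta>)"
    with assms(1) ub show "osup X = \<alpha>"
      unfolding osup_def by (intro least_ord_eqI) blast+
  qed
  ultimately show ?thesis by blast
qed

definition limit_ord :: "'v::set_universe \<Rightarrow> bool" where
  "limit_ord \<alpha> \<longleftrightarrow> Ord \<alpha> \<and> \<alpha> \<noteq> ozero \<and> (\<forall>\<delta>\<in>elts \<alpha>. \<exists>\<xi>\<in>elts \<alpha>. \<delta> \<in> elts \<xi>)"

lemma acc_pts_elts: "Ord \<kappa> \<Longrightarrow> \<alpha> \<in> acc_pts (elts \<kappa>) \<longleftrightarrow> \<alpha> \<in> elts \<kappa> \<and> limit_ord \<alpha>"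
  unfolding acc_pts_def limit_ord_def
  using osup_eq_iff[of \<alpha> "elts \<alpha>"] Ord_mem_subset[of \<kappa> \<alpha>] Ord_in_Ord[of \<kappa> \<alpha>]
  by (auto simp: Int_absorb1)

definition is_cofinal :: "'v::set_universe \<Rightarrow> 'v \<Rightarrow> bool" where
  "is_cofinal \<alpha> \<delta> \<longleftrightarrow> (\<exists>f. f ` elts \<delta> \<subseteq> elts \<alpha> \<and> (\<forall>\<beta>\<in>elts \<alpha>. \<exists>i\<in>elts \<delta>. ole \<beta> (f i)))"

lemma is_cofinal_self: "is_cofinal \<alpha> \<alpha>"
  unfolding is_cofinal_def by (rule exI[of _ id]) (auto simp: ole_def)

lemma cf_props:
  assumes "Ord \<alpha>"
  shows "Ord (cf \<alpha>)" "is_cofinal \<alpha> (cf \<alpha>)" "\<And>\<beta>. \<beta> \<in> elts (cf \<alpha>) \<Longrightarrow> \<not> is_cofinal \<alpha> \<beta>"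
  using least_ord_props[of \<alpha> "is_cofinal \<alpha>", OF assms is_cofinal_self]
  unfolding cf_def is_cofinal_def[symmetric] by blast+

lemma cf_subset: "Ord \<alpha> \<Longrightarrow> Ord \<delta> \<Longrightarrow> is_cofinal \<alpha> \<delta> \<Longrightarrow> elts (cf \<alpha>) \<subseteq> elts \<delta>"
  using cf_props not_mem_iff_subset by blast

lemma below_cf_bounded:
  assumes "Ord \<alpha>" "\<delta> \<in> elts (cf \<alpha>)" "f ` elts \<delta> \<subseteq> elts \<alpha>"
  shows "\<exists>\<beta>\<in>elts \<alpha>. \<forall>i\<in>elts \<delta>. f i \<in> elts \<beta>"
proof -
  obtain \<beta> where "\<beta> \<in> elts \<alpha>" "\<forall>i\<in>elts \<delta>. \<not> ole \<beta> (f i)"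
    using cf_props(3)[OF assms(1,2)] assms(3) unfolding is_cofinal_def by blast
  then show ?thesis
    using not_ole_iff Ord_in_Ord[OF assms(1)] assms(3) by blast
qed

section \<open>Order types\<close>

text \<open>The Mostowski collapse of \<open>E\<close> with its membership relation; on a set of
  ordinals it is the isomorphism onto the order type.\<close>

function collapse :: "'v::set_universe set \<Rightarrow> 'v \<Rightarrow> 'v" where
  "collapse E x = vset (collapse E ` (E \<inter> elts x))"
  by pat_completeness auto
termination
  by (relation "inv_image {(x, y). x \<in> elts y} snd") (auto intro: foundation)

declare collapse.simps [simp del]

lemma elts_collapse: "elts (collapse E x) = collapse E ` (E \<inter> elts x)"
  by (subst collapse.simps, rule elts_vset_lepoll[of _ x])
    (rule lepoll_trans[OF image_lepoll subset_imp_lepoll[OF Int_lower2]])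

lemma collapse_mem_iff:
  assumes "Ord \<alpha>" "E \<subseteq> elts \<alpha>" "x \<in> E" "y \<in> E"
  shows "collapse E x \<in> elts (collapse E y) \<longleftrightarrow> x \<in> elts y"
proof -
  have mono: "collapse E x \<in> elts (collapse E y)" if "x \<in> E" "x \<in> elts y" for x y
    using that by (auto simp: elts_collapse)
  show ?thesis
    using mono[of x y] mono[of y x] assms Ord_linear[of x y] Ord_in_Ord[OF assms(1)]
      mem_asym mem_irrefl by (metis subsetD)
qed

definition is_otp :: "'v::set_universe set \<Rightarrow> 'v \<Rightarrow> bool" where
  "is_otp E \<delta> \<longleftrightarrow> Ord \<delta> \<and>
    (\<exists>f. bij_betw f (elts \<delta>) E \<and> (\<forall>i\<in>elts \<delta>. \<forall>j\<in>elts i. f j \<in> elts (f i)))"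

text \<open>The collapse inverts every increasing enumeration of \<open>E\<close>, by induction on
  the index; this makes order types unique.\<close>

lemma is_otp_collapse:
  assumes \<alpha>: "Ord \<alpha>" and E: "E \<subseteq> elts \<alpha>" and \<delta>: "is_otp E \<delta>"
  shows "elts \<delta> = collapse E ` E"
proof -
  obtain f where od: "Ord \<delta>" and bij: "bij_betw f (elts \<delta>) E"
    and incr: "\<And>i j. i \<in> elts \<delta> \<Longrightarrow> j \<in> elts i \<Longrightarrow> f j \<in> elts (f i)"
    using \<delta> unfolding is_otp_def by blast
  have iff: "f j \<in> elts (f i) \<longleftrightarrow> j \<in> elts i" if "i \<in> elts \<delta>" "j \<in> elts \<delta>" for i j
    using incr[OF that(1), of j] incr[OF that(2), of i] Ord_linear[of i j] Ord_in_Ord[OF od] that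
      mem_asym mem_irrefl by metis
  have "i \<in> elts \<delta> \<Longrightarrow> collapse E (f i) = i" for i
  proof (induction i rule: eps_induct)
    case (1 i)
    have "E \<inter> elts (f i) = f ` elts i"
      using bij iff[OF 1(2)] Ord_trans[OF od 1(2)] unfolding bij_betw_def by auto
    then have "elts (collapse E (f i)) = (\<lambda>j. collapse E (f j)) ` elts i"
      by (simp add: elts_collapse image_image)
    also have "\<dots> = elts i"
      using 1(1) Ord_trans[OF od 1(2)] by auto
    finally show ?case by (rule extensionality)
  qed
  then show ?thesis using bij unfolding bij_betw_def by force
qed

lemma is_otp_exists:
  assumes \<alpha>: "Ord \<alpha>" and E: "E \<subseteq> elts \<alpha>"
  shows "\<exists>\<delta>. is_otp E \<delta>"
proof -
  define \<delta> where "\<delta> = vset (collapse E ` E)"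
  have e\<delta>: "elts \<delta> = collapse E ` E"
    unfolding \<delta>_def by (rule elts_vset_lepoll[of _ \<alpha>])
      (rule lepoll_trans[OF image_lepoll subset_imp_lepoll[OF E]])
  have inj: "inj_on (collapse E) E"
    by (rule inj_onI) (metis \<alpha> E Ord_in_Ord Ord_linear collapse_mem_iff mem_irrefl subsetD)
  have tr: "elts (collapse E x) \<subseteq> elts \<delta>" for x
    by (auto simp: e\<delta> elts_collapse)
  have tr2: "elts y \<subseteq> elts (collapse E x)" if xE: "x \<in> E" and yx: "y \<in> elts (collapse E x)" for x y
  proof -
    obtain z where z: "z \<in> E" "z \<in> elts x" "y = collapse E z"
      using yx by (auto simp: elts_collapse)
    have "elts z \<subseteq> elts x" using Ord_in_Ord[OF \<alpha>] Ord_mem_subset E xE z by blast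
    then show ?thesis unfolding z(3) elts_collapse by blast
  qed
  have "Ord \<delta>" unfolding Ord_def using tr tr2 by (auto simp: e\<delta>)
  moreover have "bij_betw (inv_into E (collapse E)) (elts \<delta>) E"
    unfolding e\<delta> using inj by (simp add: bij_betw_inv_into inj_on_imp_bij_betw)
  moreover have "inv_into E (collapse E) j \<in> elts (inv_into E (collapse E) i)"
    if i: "i \<in> elts \<delta>" and j: "j \<in> elts i" for i j
  proof -
    obtain x where x: "x \<in> E" "i = collapse E x" using i e\<delta> by blast
    obtain y where y: "y \<in> E" "y \<in> elts x" "j = collapse E y"
      using j x by (auto simp: elts_collapse)
    show ?thesis using x y inj by simp
  qed
  ultimately show ?thesis unfolding is_otp_def by blast
qed

lemma otp_props:
  assumes \<alpha>: "Ord \<alpha>" and E: "E \<subseteq> elts \<alpha>"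
  shows "is_otp E (otp E)" "is_otp E \<delta> \<Longrightarrow> otp E = \<delta>"
proof -
  have "\<exists>!\<delta>. is_otp E \<delta>"
    using is_otp_exists[OF assms] is_otp_collapse[OF assms] extensionality by metis
  moreover have "otp E = (THE \<delta>. is_otp E \<delta>)" unfolding otp_def is_otp_def ..
  ultimately show "is_otp E (otp E)" "is_otp E \<delta> \<Longrightarrow> otp E = \<delta>"
    using theI'[of "is_otp E"] by (metis, metis)
qed

lemma otp_eqpoll:
  assumes \<alpha>: "Ord \<alpha>" and E: "E \<subseteq> elts \<alpha>"
  shows "elts (otp E) \<approx> E"
  using otp_props(1)[OF assms] unfolding is_otp_def eqpoll_def by blast

section \<open>Bounds for unions and transitive closures\<close>

lemma UN_lepoll_infinite:
  assumes "infinite B" "I \<lesssim> B" "\<And>i. i \<in> I \<Longrightarrow> X i \<lesssim> B"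
  shows "(\<Union>i\<in>I. X i) \<lesssim> B"
  using card_of_UNION_ordLeq_infinite[of B I X] assms
  unfolding lepoll_def card_of_ordLeq by blast

lemma Un_lepoll_infinite: "infinite B \<Longrightarrow> X \<lesssim> B \<Longrightarrow> Y \<lesssim> B \<Longrightarrow> X \<union> Y \<lesssim> B"
  using UN_lepoll_infinite[of B "UNIV :: bool set" "\<lambda>b. if b then X else Y"]
    finite_lepoll_infinite[of B "UNIV :: bool set"] by (simp add: UNIV_bool Un_commute)

lemma trcl_subset:
  assumes "elts x \<subseteq> X" "\<And>y. y \<in> X \<Longrightarrow> elts y \<subseteq> X"
  shows "trcl (x::'v::set_universe) \<subseteq> X"
proof
  fix y assume "y \<in> trcl x"
  then have "(y, x) \<in> {(a, b). a \<in> elts b}\<^sup>+" by (simp add: trcl_def)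
  then show "y \<in> X"
    by (induction rule: converse_trancl_induct) (use assms in auto)
qed

lemma trcl_Ord_subset: "Ord \<alpha> \<Longrightarrow> trcl \<alpha> \<subseteq> elts \<alpha>"
  by (rule trcl_subset) (auto dest: Ord_trans)

lemma elts_subset_trcl: "elts x \<subseteq> trcl (x::'v::set_universe)"
  by (auto simp: trcl_def)

lemma trcl_trans: "y \<in> trcl x \<Longrightarrow> elts y \<subseteq> trcl (x::'v::set_universe)"
  by (auto simp: trcl_def intro: trancl_into_trancl2)

lemma trcl_mem_subset: "y \<in> elts x \<Longrightarrow> trcl y \<subseteq> trcl (x::'v::set_universe)"
  using elts_subset_trcl trcl_trans by (intro trcl_subset) blast+

section \<open>Sizes and sequences below a regular cardinal\<close>

locale regular_cardinal =
  fixes \<kappa> :: "'v::set_universe"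
  assumes regular: "regular_card \<kappa>"
begin

lemma Ord_kappa: "Ord \<kappa>" and infinite_kappa: "infinite (elts \<kappa>)"
  and cf_kappa: "cf \<kappa> = \<kappa>"
  using regular unfolding regular_card_def Card_def by auto

lemma below_kappa_lesspoll: "\<alpha> \<in> elts \<kappa> \<Longrightarrow> elts \<alpha> \<prec> elts \<kappa>"
  using regular unfolding regular_card_def Card_def by blast

lemma Ord_below: "\<alpha> \<in> elts \<kappa> \<Longrightarrow> Ord \<alpha>"
  using Ord_in_Ord Ord_kappa by blast

lemma elts_vset: "(X::'v set) \<lesssim> elts \<kappa> \<Longrightarrow> elts (vset X) = X"
  by (rule elts_vset_lepoll)

text \<open>No pairing axiom is assumed: finite collections are sets because they embed into the
  infinite \<kappa>.\<close>

lemma elts_vset_finite: "finite X \<Longrightarrow> elts (vset X) = (X::'v set)"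
  by (rule elts_vset[OF finite_lepoll_infinite[OF infinite_kappa]])

lemma elts_osucc [simp]: "elts (osucc (\<alpha>::'v)) = insert \<alpha> (elts \<alpha>)"
proof (cases "finite (elts \<alpha>)")
  case True
  then show ?thesis unfolding osucc_def by (intro elts_vset_finite) simp
next
  case False
  then show ?thesis unfolding osucc_def by (intro elts_vset_lepoll[OF infinite_insert_lepoll])
qed

lemma Ord_osucc [simp]: "Ord (\<alpha>::'v) \<Longrightarrow> Ord (osucc \<alpha>)"
  unfolding Ord_def by auto

lemma osucc_inject: "osucc (\<alpha>::'v) = osucc \<beta> \<Longrightarrow> \<alpha> = \<beta>"
  by (metis elts_osucc insertE insertI1 mem_asym)

lemma not_limit_osucc: "\<not> limit_ord (osucc (\<alpha>::'v))"
  unfolding limit_ord_def using Ord_trans by (auto dest: mem_asym)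

lemma Ord_cases:
  assumes "Ord (\<alpha>::'v)"
  obtains "\<alpha> = ozero" | \<delta> where "Ord \<delta>" "\<delta> \<in> elts \<alpha>" "\<alpha> = osucc \<delta>" | "limit_ord \<alpha>"
proof -
  have "\<exists>\<delta>\<in>elts \<alpha>. Ord \<delta> \<and> \<alpha> = osucc \<delta>" if nl: "\<alpha> \<noteq> ozero" "\<not> limit_ord \<alpha>"
  proof -
    obtain \<delta> where \<delta>: "\<delta> \<in> elts \<alpha>" "\<forall>\<xi>\<in>elts \<alpha>. \<delta> \<notin> elts \<xi>"
      using nl assms unfolding limit_ord_def by blast
    have "elts \<alpha> = insert \<delta> (elts \<delta>)"
      using \<delta> Ord_linear[of \<delta>] Ord_in_Ord[OF assms] Ord_trans[OF assms \<delta>(1)] by blast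
    then show ?thesis
      using \<delta>(1) Ord_in_Ord[OF assms] by (intro bexI[of _ \<delta>]) (auto intro: extensionality)
  qed
  then show thesis using that by blast
qed

lemma ozero_mem_Ord: "Ord (\<alpha>::'v) \<Longrightarrow> \<alpha> \<noteq> ozero \<Longrightarrow> ozero \<in> elts \<alpha>"
  using Ord_linear[of ozero \<alpha>] by auto

lemma ozero_below [simp]: "ozero \<in> elts \<kappa>"
  using infinite_kappa by (intro ozero_mem_Ord Ord_kappa) auto

lemma osucc_below: "\<alpha> \<in> elts \<kappa> \<Longrightarrow> osucc \<alpha> \<in> elts \<kappa>"
proof (rule ccontr)
  assume \<alpha>: "\<alpha> \<in> elts \<kappa>" and neg: "osucc \<alpha> \<notin> elts \<kappa>"
  have "\<kappa> \<notin> elts (osucc \<alpha>)" using \<alpha> mem_asym by auto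
  then have \<kappa>: "elts \<kappa> = insert \<alpha> (elts \<alpha>)"
    using Ord_linear[of \<kappa> "osucc \<alpha>"] neg Ord_kappa Ord_below[OF \<alpha>] by auto
  then have "infinite (elts \<alpha>)" using infinite_kappa by simp
  then have "elts \<kappa> \<approx> elts \<alpha>" unfolding \<kappa> by (rule infinite_insert_eqpoll)
  then show False
    using below_kappa_lesspoll[OF \<alpha>] eq_lesspoll_trans lesspoll_not_refl by blast
qed

lemma limit_kappa: "limit_ord \<kappa>"
proof -
  have "\<kappa> \<noteq> ozero" using ozero_below by force
  then show ?thesis unfolding limit_ord_def using Ord_kappa osucc_below elts_osucc by blast
qed

section \<open>Collections smaller than \<kappa>\<close>

text \<open>The ordinal is the order type of a copy of \<open>X\<close> inside \<kappa>; it cannot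
  reach \<kappa>, being equipotent with \<open>X\<close>.\<close>

lemma lesspoll_kappa_below:
  assumes "X \<prec> elts \<kappa>"
  shows "\<exists>\<xi>\<in>elts \<kappa>. X \<lesssim> elts \<xi>"
proof -
  obtain g where g: "inj_on g X" "g ` X \<subseteq> elts \<kappa>"
    using lesspoll_imp_lepoll[OF assms] unfolding lepoll_def by blast
  define \<xi> where "\<xi> = otp (g ` X)"
  have "elts \<xi> \<approx> g ` X" unfolding \<xi>_def by (rule otp_eqpoll[OF Ord_kappa g(2)])
  also have "g ` X \<approx> X" by (rule inj_on_image_eqpoll_self[OF g(1)])
  finally have \<xi>X: "elts \<xi> \<approx> X" .
  have "Ord \<xi>" using otp_props(1)[OF Ord_kappa g(2)] unfolding \<xi>_def is_otp_def by blast
  moreover have "\<not> elts \<kappa> \<subseteq> elts \<xi>"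
    using \<xi>X assms by (meson eqpoll_imp_lepoll lepoll_trans lesspoll_not_refl lesspoll_trans2 subset_imp_lepoll)
  ultimately have "\<xi> \<in> elts \<kappa>" using not_mem_iff_subset[OF Ord_kappa] by blast
  then show ?thesis using \<xi>X eqpoll_sym eqpoll_imp_lepoll by blast
qed

lemma lesspoll_kappa_bounded:
  assumes "X \<prec> elts \<kappa>" "g ` X \<subseteq> elts \<kappa>"
  shows "\<exists>\<delta>\<in>elts \<kappa>. \<forall>x\<in>X. g x \<in> elts \<delta>"
proof -
  obtain \<xi> where \<xi>: "\<xi> \<in> elts \<kappa>" "X \<lesssim> elts \<xi>"
    using lesspoll_kappa_below[OF assms(1)] by blast
  then obtain h where h: "inj_on h X" "h ` X \<subseteq> elts \<xi>" unfolding lepoll_def by blast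
  \<comment> \<open>The default \<open>ozero\<close> makes \<open>f\<close> total on \<xi>, since
    cofinality speaks of functions on an ordinal.\<close>
  define f where "f i = (if i \<in> h ` X then g (inv_into X h i) else ozero)" for i
  have f: "f ` elts \<xi> \<subseteq> elts \<kappa>"
    using assms(2) by (auto simp: f_def image_subset_iff inv_into_f_f[OF h(1)])
  obtain \<delta> where "\<delta> \<in> elts \<kappa>" "\<forall>i\<in>elts \<xi>. f i \<in> elts \<delta>"
    using below_cf_bounded[OF Ord_kappa _ f] \<xi>(1) by (auto simp: cf_kappa)
  moreover have "g x = f (h x)" if "x \<in> X" for x
    using that by (simp add: f_def inv_into_f_f[OF h(1)])
  ultimately show ?thesis using h(2) by (metis image_subset_iff)
qed

lemma UN_lesspoll_kappa:
  assumes "I \<prec> elts \<kappa>" "\<And>i. i \<in> I \<Longrightarrow> X i \<prec> elts \<kappa>"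
  shows "(\<Union>i\<in>I. X i) \<prec> elts \<kappa>"
proof -
  obtain \<eta> where \<eta>: "\<And>i. i \<in> I \<Longrightarrow> \<eta> i \<in> elts \<kappa> \<and> X i \<lesssim> elts (\<eta> i)"
    using lesspoll_kappa_below[OF assms(2)] by metis
  obtain \<delta> where \<delta>: "\<delta> \<in> elts \<kappa>" "\<And>i. i \<in> I \<Longrightarrow> \<eta> i \<in> elts \<delta>"
    using lesspoll_kappa_bounded[OF assms(1), of \<eta>] \<eta> by blast
  obtain \<xi> where \<xi>: "\<xi> \<in> elts \<kappa>" "I \<lesssim> elts \<xi>"
    using lesspoll_kappa_below[OF assms(1)] by blast
  obtain \<zeta> where \<zeta>: "\<zeta> \<in> elts \<kappa>" "elts \<delta> \<subseteq> elts \<zeta>" "elts \<xi> \<subseteq> elts \<zeta>"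
    using not_mem_iff_subset[of \<delta> \<xi>] Ord_mem_subset Ord_below \<delta>(1) \<xi>(1) by blast
  have I: "I \<lesssim> elts \<zeta>" using \<xi>(2) \<zeta>(3) lepoll_trans subset_imp_lepoll by blast
  have X: "X i \<lesssim> elts \<zeta>" if "i \<in> I" for i
    using \<eta>[OF that] \<delta>(2)[OF that] \<zeta>(2) Ord_mem_subset[OF Ord_below[OF \<delta>(1)]]
    by (meson lepoll_trans subset_imp_lepoll)
  show ?thesis
  \<comment> \<open>\<open>UN_lepoll_infinite\<close> needs an infinite bound, but \<zeta> may be
    finite.\<close>
  proof (cases "finite (elts \<zeta>)")
    case True
    have "finite Y" if "Y \<lesssim> elts \<zeta>" for Y :: "'c set"
      using that True unfolding lepoll_def by (meson finite_imageD finite_subset)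
    moreover have "finite I" using I True unfolding lepoll_def by (meson finite_imageD finite_subset)
    ultimately have "finite (\<Union>i\<in>I. X i)" using X by blast
    then show ?thesis by (rule finite_lesspoll_infinite[OF infinite_kappa])
  next
    case False
    show ?thesis
      by (rule lesspoll_trans1[OF UN_lepoll_infinite[OF False I X] below_kappa_lesspoll[OF \<zeta>(1)]])
  qed
qed

lemma finite_lesspoll_kappa: "finite X \<Longrightarrow> X \<prec> elts \<kappa>"
  by (rule finite_lesspoll_infinite[OF infinite_kappa])

lemma Un_lesspoll_kappa:
  assumes "X \<prec> elts \<kappa>" "Y \<prec> elts \<kappa>"
  shows "X \<union> Y \<prec> elts \<kappa>"
  using UN_lesspoll_kappa[of "UNIV :: bool set" "\<lambda>b. if b then X else Y"] assms
    finite_lesspoll_kappa[of "UNIV :: bool set"] by (simp add: UNIV_bool Un_commute)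

lemma image_lesspoll_kappa: "X \<prec> elts \<kappa> \<Longrightarrow> f ` X \<prec> elts \<kappa>"
  using image_lepoll lesspoll_trans1 by blast

lemma subset_lesspoll_kappa: "X \<prec> elts \<kappa> \<Longrightarrow> Y \<subseteq> X \<Longrightarrow> Y \<prec> elts \<kappa>"
  using subset_imp_lepoll lesspoll_trans1 by blast

section \<open>Ordered pairs and set-theoretic sequences\<close>

lemma vpair_eq_iff [simp]: "vpair (a::'v) b = vpair c d \<longleftrightarrow> a = c \<and> b = d"
proof
  assume "vpair a b = vpair c d"
  then have "{vset {a}, vset {a, b}} = {vset {c}, vset {c, d}}"
    unfolding vpair_def by (metis elts_vset_finite finite.emptyI finite.insertI)
  moreover have "elts (vset {a}) = {a}" "elts (vset {c}) = {c}"
    "elts (vset {a, b}) = {a, b}" "elts (vset {c, d}) = {c, d}"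
    by (auto simp: elts_vset_finite)
  ultimately show "a = c \<and> b = d"
    by (metis (no_types, lifting) doubleton_eq_iff singleton_insert_inj_eq)
qed simp

lemma elts_vpair: "elts (vpair (a::'v) b) = {vset {a}, vset {a, b}}"
  unfolding vpair_def by (simp add: elts_vset_finite)

lemma vpair_neq_ozero: "vpair (a::'v) b \<noteq> ozero"
  by (metis elts_ozero elts_vpair insert_not_empty)

lemma elts_singleton [simp]: "elts (vset {a::'v}) = {a}"
  and elts_doubleton [simp]: "elts (vset {a, b::'v}) = {a, b}"
  and elts_tripleton [simp]: "elts (vset {a, b, c::'v}) = {a, b, c}"
  by (auto simp: elts_vset_finite)

text \<open>Presenting a sequence as the graph of an HOL function frees the later arguments from the
  definite description \<open>vapp\<close>.\<close>

lemma seqs_iff: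
  "t \<in> seqs \<alpha> X \<longleftrightarrow> (\<exists>f. f ` elts \<alpha> \<subseteq> X \<and> elts t = (\<lambda>\<xi>. vpair \<xi> (f \<xi>)) ` elts (\<alpha>::'v))"
proof
  assume t: "t \<in> seqs \<alpha> X"
  have "elts t = (\<lambda>\<xi>. vpair \<xi> (vapp t \<xi>)) ` elts \<alpha>"
  proof -
    have app: "vapp t \<xi> = b" if "vpair \<xi> b \<in> elts t" for \<xi> b
      using that t unfolding vapp_def seqs_def vfun_def by blast
    show ?thesis
    proof (intro equalityI subsetI)
      fix q assume q: "q \<in> elts t"
      then obtain a b where ab: "q = vpair a b" using t unfolding seqs_def vfun_def by blast
      then have "a \<in> elts \<alpha>" using q t unfolding seqs_def vdom_def by blast
      then show "q \<in> (\<lambda>\<xi>. vpair \<xi> (vapp t \<xi>)) ` elts \<alpha>" using app ab q by blast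
    next
      fix q assume "q \<in> (\<lambda>\<xi>. vpair \<xi> (vapp t \<xi>)) ` elts \<alpha>"
      then obtain \<xi> where \<xi>: "\<xi> \<in> elts \<alpha>" "q = vpair \<xi> (vapp t \<xi>)" by blast
      then obtain b where "vpair \<xi> b \<in> elts t" using t unfolding seqs_def vdom_def by blast
      then show "q \<in> elts t" using app \<xi> by metis
    qed
  qed
  moreover have "vapp t ` elts \<alpha> \<subseteq> X"
    using t calculation unfolding seqs_def vran_def by blast
  ultimately show "\<exists>f. f ` elts \<alpha> \<subseteq> X \<and> elts t = (\<lambda>\<xi>. vpair \<xi> (f \<xi>)) ` elts \<alpha>" by blast
next
  assume "\<exists>f. f ` elts \<alpha> \<subseteq> X \<and> elts t = (\<lambda>\<xi>. vpair \<xi> (f \<xi>)) ` elts \<alpha>"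
  then show "t \<in> seqs \<alpha> X"
    unfolding seqs_def vfun_def vdom_def vran_def by (auto simp: image_subset_iff)
qed

lemma seqs_vdom: "t \<in> seqs \<alpha> X \<Longrightarrow> vdom t = elts \<alpha>"
  unfolding seqs_def by blast

lemma vdom_mono: "elts s \<subseteq> elts t \<Longrightarrow> vdom s \<subseteq> vdom t"
  unfolding vdom_def by blast

lemma elts_vrestrict: "elts (vrestrict t Y) = {q \<in> elts (t::'v). \<exists>a\<in>Y. \<exists>b. q = vpair a b}"
  unfolding vrestrict_def by (rule elts_vset_subset[of _ t]) blast

text \<open>Functions with included graphs agree on the smaller domain. So inclusion of element sets
  is the reflexive tree order, and a predecessor of \<open>t\<close> is determined by its
  length.\<close>

lemma seqs_subset_eq_vrestrict:
  assumes "s \<in> seqs \<beta> X" "t \<in> seqs \<alpha> Y" "elts s \<subseteq> elts (t::'v)"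
  shows "s = vrestrict t (elts \<beta>)"
proof (rule extensionality)
  obtain f where f: "elts t = (\<lambda>\<xi>. vpair \<xi> (f \<xi>)) ` elts \<alpha>" using assms(2) seqs_iff by auto
  obtain g where g: "elts s = (\<lambda>\<xi>. vpair \<xi> (g \<xi>)) ` elts \<beta>" using assms(1) seqs_iff by auto
  have "\<xi> \<in> elts \<alpha> \<and> g \<xi> = f \<xi>" if "\<xi> \<in> elts \<beta>" for \<xi>
    using assms(3) that unfolding f g by force
  then show "elts s = elts (vrestrict t (elts \<beta>))"
    unfolding elts_vrestrict f g by force
qed

lemma vrestrict_mono: "Y \<subseteq> Z \<Longrightarrow> elts (vrestrict (t::'v) Y) \<subseteq> elts (vrestrict t Z)"
  unfolding elts_vrestrict by blast

lemma vrestrict_self: "t \<in> seqs \<alpha> X \<Longrightarrow> vrestrict t (elts (\<alpha>::'v)) = t"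
  using seqs_subset_eq_vrestrict[of t \<alpha> X t] by auto

lemma seqs_comparable:
  assumes "s \<in> seqs \<beta> X" "s' \<in> seqs \<beta>' X" "t \<in> seqs \<alpha> Y"
    "elts s \<subseteq> elts (t::'v)" "elts s' \<subseteq> elts t" "elts \<beta> \<subseteq> elts \<beta>'"
  shows "elts s \<subseteq> elts s'"
  using seqs_subset_eq_vrestrict[OF assms(1,3,4)] seqs_subset_eq_vrestrict[OF assms(2,3,5)]
    vrestrict_mono[OF assms(6)] by simp

lemma vrestrict_vrestrict: "Y \<subseteq> Z \<Longrightarrow> vrestrict (vrestrict (t::'v) Z) Y = vrestrict t Y"
  by (rule extensionality) (auto simp: elts_vrestrict)

lemma vrestrict_of_subset:
  assumes "s \<in> seqs \<beta> X" "t \<in> seqs \<alpha> Y" "elts s \<subseteq> elts (t::'v)" "elts \<gamma> \<subseteq> elts \<beta>"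
  shows "vrestrict t (elts \<gamma>) = vrestrict s (elts \<gamma>)"
  using seqs_subset_eq_vrestrict[OF assms(1-3)] vrestrict_vrestrict[OF assms(4)] by simp

definition vappend :: "'v \<Rightarrow> 'v \<Rightarrow> 'v \<Rightarrow> 'v" where
  "vappend \<alpha> t i = vset (insert (vpair \<alpha> i) (elts t))"

lemma elts_vappend: "elts (vappend \<alpha> t i) = insert (vpair \<alpha> i) (elts t)"
proof (cases "finite (elts t)")
  case True
  then show ?thesis unfolding vappend_def by (intro elts_vset_finite) simp
next
  case False
  then show ?thesis unfolding vappend_def by (intro elts_vset_lepoll[OF infinite_insert_lepoll])
qed

lemma vappend_seqs:
  assumes "t \<in> seqs \<alpha> X" "i \<in> X"
  shows "vappend \<alpha> t i \<in> seqs (osucc \<alpha>) X" "vrestrict (vappend \<alpha> t i) (elts \<alpha>) = t"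
    "vpair \<alpha> j \<notin> elts t"
proof -
  obtain f where f: "f ` elts \<alpha> \<subseteq> X" "elts t = (\<lambda>\<xi>. vpair \<xi> (f \<xi>)) ` elts \<alpha>"
    using assms(1) seqs_iff by auto
  have "elts (vappend \<alpha> t i) = (\<lambda>\<xi>. vpair \<xi> ((f(\<alpha> := i)) \<xi>)) ` elts (osucc \<alpha>)"
    unfolding elts_vappend f(2) by force
  moreover have "(f(\<alpha> := i)) ` elts (osucc \<alpha>) \<subseteq> X" using f(1) assms(2) by auto
  ultimately show A: "vappend \<alpha> t i \<in> seqs (osucc \<alpha>) X" unfolding seqs_iff by blast
  show "vrestrict (vappend \<alpha> t i) (elts \<alpha>) = t"
    using seqs_subset_eq_vrestrict[OF assms(1) A] elts_vappend by (metis subset_insertI)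
  show "vpair \<alpha> j \<notin> elts t" unfolding f(2) by auto
qed

lemma vappend_inject:
  assumes "t \<in> seqs \<alpha> X" "vappend \<alpha> t i = vappend \<alpha> t j"
  shows "i = j"
proof -
  have "vpair \<alpha> i \<in> elts (vappend \<alpha> t j)" using assms(2) by (metis elts_vappend insertI1)
  then show ?thesis using assms(1) unfolding seqs_iff elts_vappend by auto
qed

lemma seqs_Union:
  assumes G: "\<And>\<gamma>. \<gamma> \<in> G \<Longrightarrow> w \<gamma> \<in> seqs (d \<gamma>) X"
    and chain: "\<And>\<gamma> \<gamma>'. \<gamma> \<in> G \<Longrightarrow> \<gamma>' \<in> G \<Longrightarrow> elts (w \<gamma>) \<subseteq> elts (w \<gamma>') \<or> elts (w \<gamma>') \<subseteq> elts (w \<gamma>)"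
    and dom: "(\<Union>\<gamma>\<in>G. elts (d \<gamma>)) = elts (\<alpha>::'v)"
  shows "elts (vset (\<Union>\<gamma>\<in>G. elts (w \<gamma>))) = (\<Union>\<gamma>\<in>G. elts (w \<gamma>))"
    "vset (\<Union>\<gamma>\<in>G. elts (w \<gamma>)) \<in> seqs \<alpha> X"
proof -
  obtain f where f: "\<And>\<gamma>. \<gamma> \<in> G \<Longrightarrow> f \<gamma> ` elts (d \<gamma>) \<subseteq> X"
    "\<And>\<gamma>. \<gamma> \<in> G \<Longrightarrow> elts (w \<gamma>) = (\<lambda>\<xi>. vpair \<xi> (f \<gamma> \<xi>)) ` elts (d \<gamma>)"
    using G unfolding seqs_iff by metis
  have "\<exists>\<gamma>\<in>G. \<xi> \<in> elts (d \<gamma>)" if "\<xi> \<in> elts \<alpha>" for \<xi> using that dom by blast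
  \<comment> \<open>\<open>c \<xi>\<close> is an index whose sequence already reaches \<xi>; by the
    chain condition the value at \<xi> does not depend on this choice.\<close>
  then obtain c where c: "\<And>\<xi>. \<xi> \<in> elts \<alpha> \<Longrightarrow> c \<xi> \<in> G \<and> \<xi> \<in> elts (d (c \<xi>))" by metis
  have agree: "f \<gamma> \<xi> = f (c \<xi>) \<xi>" if "\<gamma> \<in> G" "\<xi> \<in> elts (d \<gamma>)" for \<gamma> \<xi>
  proof -
    have \<xi>: "\<xi> \<in> elts \<alpha>" using that dom by blast
    show ?thesis
      using chain[OF that(1) conjunct1[OF c[OF \<xi>]]] that c[OF \<xi>]
      by (auto simp: f(2) image_subset_iff)
  qed
  have eq: "(\<Union>\<gamma>\<in>G. elts (w \<gamma>)) = (\<lambda>\<xi>. vpair \<xi> (f (c \<xi>) \<xi>)) ` elts \<alpha>"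
  proof (intro equalityI subsetI)
    fix q assume "q \<in> (\<Union>\<gamma>\<in>G. elts (w \<gamma>))"
    then obtain \<gamma> \<xi> where "\<gamma> \<in> G" "\<xi> \<in> elts (d \<gamma>)" "q = vpair \<xi> (f \<gamma> \<xi>)" using f(2) by blast
    then have "\<xi> \<in> elts \<alpha>" "q = vpair \<xi> (f (c \<xi>) \<xi>)" using agree dom by auto
    then show "q \<in> (\<lambda>\<xi>. vpair \<xi> (f (c \<xi>) \<xi>)) ` elts \<alpha>" by blast
  next
    fix q assume "q \<in> (\<lambda>\<xi>. vpair \<xi> (f (c \<xi>) \<xi>)) ` elts \<alpha>"
    then obtain \<xi> where "\<xi> \<in> elts \<alpha>" "q = vpair \<xi> (f (c \<xi>) \<xi>)" by blast
    then show "q \<in> (\<Union>\<gamma>\<in>G. elts (w \<gamma>))" using f(2) c by blast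
  qed
  show el: "elts (vset (\<Union>\<gamma>\<in>G. elts (w \<gamma>))) = (\<Union>\<gamma>\<in>G. elts (w \<gamma>))"
    unfolding eq by (rule elts_vset_lepoll[OF image_lepoll])
  have "(\<lambda>\<xi>. f (c \<xi>) \<xi>) ` elts \<alpha> \<subseteq> X" using f(1) c by blast
  then show "vset (\<Union>\<gamma>\<in>G. elts (w \<gamma>)) \<in> seqs \<alpha> X"
    unfolding seqs_iff el unfolding eq by blast
qed

end

section \<open>Guessing with elementary submodels\<close>

definition Exists :: "nat \<Rightarrow> fm \<Rightarrow> fm" where
  "Exists i \<phi> = Neg (Forall i (Neg \<phi>))"

lemma sat_Exists [simp]: "sat A e (Exists i \<phi>) \<longleftrightarrow> (\<exists>a\<in>A. sat A (e(i := a)) \<phi>)"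
  by (simp add: Exists_def)

context regular_cardinal
begin

lemma below_Hset: "\<alpha> \<in> elts \<kappa> \<Longrightarrow> \<alpha> \<in> Hset \<kappa>"
  unfolding Hset_def
  using subset_lesspoll_kappa[OF below_kappa_lesspoll trcl_Ord_subset[OF Ord_below]] by blast

lemma seqs_below_Hset:
  assumes \<alpha>: "\<alpha> \<in> elts \<kappa>" and t: "t \<in> seqs \<alpha> (elts \<kappa>)"
  shows "t \<in> Hset \<kappa>"
proof -
  obtain f where f: "f ` elts \<alpha> \<subseteq> elts \<kappa>" "elts t = (\<lambda>\<xi>. vpair \<xi> (f \<xi>)) ` elts \<alpha>"
    using t unfolding seqs_iff by blast
  \<comment> \<open>The pair at \<xi> together with its transitive closure; each
    \<open>Y \<xi>\<close> is transitive and smaller than \<kappa>.\<close>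
  define Y where "Y \<xi> = {vpair \<xi> (f \<xi>), vset {\<xi>}, vset {\<xi>, f \<xi>}, \<xi>, f \<xi>} \<union> elts \<xi> \<union> elts (f \<xi>)" for \<xi>
  have below: "\<xi> \<in> elts \<kappa>" "f \<xi> \<in> elts \<kappa>" if "\<xi> \<in> elts \<alpha>" for \<xi>
    using that f(1) Ord_trans[OF Ord_kappa \<alpha>] by auto
  have "trcl t \<subseteq> (\<Union>\<xi>\<in>elts \<alpha>. Y \<xi>)"
  proof (rule trcl_subset)
    show "elts t \<subseteq> (\<Union>\<xi>\<in>elts \<alpha>. Y \<xi>)" unfolding f(2) Y_def by blast
  next
    fix y assume "y \<in> (\<Union>\<xi>\<in>elts \<alpha>. Y \<xi>)"
    then obtain \<xi> where \<xi>: "\<xi> \<in> elts \<alpha>" "y \<in> Y \<xi>" by blast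
    have "elts y \<subseteq> Y \<xi>"
      using \<xi>(2) Ord_trans[OF Ord_below[OF below(1)[OF \<xi>(1)]]] Ord_trans[OF Ord_below[OF below(2)[OF \<xi>(1)]]]
      unfolding Y_def by (auto simp: elts_vpair)
    then show "elts y \<subseteq> (\<Union>\<xi>\<in>elts \<alpha>. Y \<xi>)" using \<xi>(1) by blast
  qed
  moreover have "(\<Union>\<xi>\<in>elts \<alpha>. Y \<xi>) \<prec> elts \<kappa>"
    using below unfolding Y_def
    by (intro UN_lesspoll_kappa Un_lesspoll_kappa finite_lesspoll_kappa below_kappa_lesspoll \<alpha>) auto
  ultimately show ?thesis unfolding Hset_def using subset_lesspoll_kappa by blast
qed

text \<open>A nonzero ordinal contains the empty set, but both members of a pair are nonempty. With
  the next two lemmas this tells nodes from ordinals, as the decoding of \<open>triples\<close>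
  requires.\<close>

lemma vpair_not_Ord: "\<not> Ord (vpair (a::'v) b)"
proof
  assume "Ord (vpair a b)"
  then have "ozero \<in> {vset {a}, vset {a, b}}"
    using ozero_mem_Ord[OF _ vpair_neq_ozero] unfolding elts_vpair by blast
  then have "elts (vset {a}) = {} \<or> elts (vset {a, b}) = {}" by (metis elts_ozero insertE singletonD)
  then show False by simp
qed

lemma seqs_elts_not_Ord: "t \<in> seqs \<alpha> X \<Longrightarrow> x \<in> elts t \<Longrightarrow> \<not> Ord (x::'v)"
  unfolding seqs_iff using vpair_not_Ord by auto

lemma seqs_not_Ord:
  assumes "t \<in> seqs \<alpha> X" "t \<noteq> (ozero::'v)"
  shows "\<not> Ord t"
  using ozero_mem_Ord[OF _ assms(2)] seqs_elts_not_Ord[OF assms(1), of ozero] by auto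

text \<open>Zero and successors have cofinality at most 1. Points of
  \<open>E_ge \<kappa> \<chi>\<close> are therefore limits.\<close>

lemma limit_ord_if_infinite_cf:
  assumes \<alpha>: "Ord (\<alpha>::'v)" and inf: "infinite (elts (cf \<alpha>))"
  shows "limit_ord \<alpha>"
  using \<alpha>
proof (cases \<alpha> rule: Ord_cases)
  case 1
  then show ?thesis using cf_subset[OF \<alpha> \<alpha> is_cofinal_self] inf by auto
next
  case (2 \<delta>)
  have "is_cofinal \<alpha> (osucc ozero)"
    unfolding is_cofinal_def using 2 by (intro exI[of _ "\<lambda>_. \<delta>"]) (auto simp: ole_def)
  then show ?thesis using cf_subset[OF \<alpha>, of "osucc ozero"] inf finite_subset by fastforce
qed

lemma omega_props: "Ord (omega::'v)" "infinite (elts (omega::'v))"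
  using least_ord_props[of \<kappa> "\<lambda>\<alpha>. infinite (elts \<alpha>)", OF Ord_kappa infinite_kappa]
  unfolding omega_def by blast+

lemma finite_Ord_mem:
  assumes "Ord (n::'v)" "finite (elts n)" "Ord \<alpha>" "infinite (elts \<alpha>)"
  shows "n \<in> elts \<alpha>"
  using not_mem_iff_subset[OF assms(3,1)] assms finite_subset by blast

lemma club_in_kappa: "club_in \<kappa> (elts \<kappa>)"
  unfolding club_in_def using osup_eq_iff[OF Ord_kappa, of "elts \<kappa>"] limit_kappa
  unfolding limit_ord_def by auto

text \<open>\<open>E\<close> will be the tail of a ladder from \<gamma> on. Then \<beta> is E(1), so
  guessing with n = 1 speaks about the ladder point right after \<gamma>.\<close>

lemma succ_one_mem:
  assumes E: "E \<subseteq> elts (\<alpha>::'v)" and \<alpha>: "Ord \<alpha>" and \<gamma>: "\<gamma> \<in> E" and \<beta>: "\<beta> \<in> E" "\<gamma> \<in> elts \<beta>"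
    and first: "\<And>\<eta>. \<eta> \<in> E \<Longrightarrow> \<eta> \<in> elts \<beta> \<Longrightarrow> \<eta> = \<gamma>"
  shows "\<beta> \<in> succ_n (osucc ozero) E"
proof -
  have otp1: "otp {\<gamma>} = osucc ozero"
  proof (rule otp_props(2)[OF \<alpha>])
    show "{\<gamma>} \<subseteq> elts \<alpha>" using \<gamma> E by blast
    show "is_otp {\<gamma>} (osucc ozero)"
      unfolding is_otp_def by (auto simp: bij_betw_def intro!: exI[of _ "\<lambda>_. \<gamma>"])
  qed
  \<comment> \<open>The definite description in \<open>nth_elt\<close> needs \<beta> to be the only
    point with exactly one predecessor in \<open>E\<close>.\<close>
  have unique: "x = \<beta>" if x: "x \<in> E" "otp (E \<inter> elts x) = osucc ozero" for x
  proof -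
    have "elts (osucc (ozero::'v)) \<approx> E \<inter> elts x"
      using otp_eqpoll[OF \<alpha>, of "E \<inter> elts x"] E unfolding x(2) by blast
    then have "E \<inter> elts x \<approx> {ozero::'v}" using eqpoll_sym by simp
    then obtain u where u: "E \<inter> elts x = {u}" unfolding eqpoll_singleton_iff by blast
    have "x \<notin> elts \<beta>"
    proof
      assume "x \<in> elts \<beta>"
      then have "x = \<gamma>" using first x(1) by blast
      moreover have "u \<in> E" "u \<in> elts x" using u by auto
      moreover have "u \<in> elts \<beta>"
        using Ord_trans[OF Ord_in_Ord[OF \<alpha>] \<open>x \<in> elts \<beta>\<close>] \<beta>(1) E \<open>u \<in> elts x\<close> by blast
      ultimately show False using first mem_irrefl by metis
    qed
    moreover have "\<beta> \<notin> elts x"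
    proof
      assume "\<beta> \<in> elts x"
      then have "\<beta> \<in> {u}" "\<gamma> \<in> {u}"
        using u \<gamma> \<beta> Ord_trans[OF Ord_in_Ord[OF \<alpha>]] E x(1) by blast+
      then show False using \<beta>(2) by auto
    qed
    ultimately show ?thesis using Ord_linear[of x \<beta>] Ord_in_Ord[OF \<alpha>] E \<beta>(1) x(1) by blast
  qed
  have E\<beta>: "E \<inter> elts \<beta> = {\<gamma>}" using first \<gamma> \<beta> by blast
  have nth: "nth_elt E (osucc ozero) = \<beta>"
    unfolding nth_elt_def
  proof (rule the_equality)
    show "\<beta> \<in> E \<and> otp (E \<inter> elts \<beta>) = osucc ozero" unfolding E\<beta> using \<beta>(1) otp1 ..
  qed (use unique in blast)
  have o: "Ord (otp E)" using otp_props(1)[OF \<alpha> E] unfolding is_otp_def by blast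
  have "osucc ozero \<in> elts (otp E)"
  proof (rule ccontr)
    assume "\<not> ?thesis"
    then have "elts (otp E) \<subseteq> {ozero}" using not_mem_iff_subset[OF o, of "osucc ozero"] by simp
    then have "E \<lesssim> {ozero::'v}"
      using lepoll_trans1[OF eqpoll_sym[OF otp_eqpoll[OF \<alpha> E]] subset_imp_lepoll] by blast
    then obtain h :: "'v \<Rightarrow> 'v" where "inj_on h E" "h ` E \<subseteq> {ozero}" unfolding lepoll_def by blast
    then have "\<beta> = \<gamma>" using \<beta>(1) \<gamma> by (auto simp: inj_on_def image_subset_iff)
    then show False using \<beta>(2) by simp
  qed
  then show ?thesis unfolding succ_n_def using nth by (intro CollectI exI[of _ ozero]) simp
qed

lemma Hset_plus_trans: "x \<in> Hset_plus \<kappa> \<Longrightarrow> y \<in> elts x \<Longrightarrow> y \<in> Hset_plus \<kappa>"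
  unfolding Hset_plus_def
  using lepoll_trans[OF subset_imp_lepoll[OF trcl_mem_subset[of y x]]] by blast

text \<open>The unordered triple \<open>{\<xi>, F \<xi>, e \<xi>}\<close> determines its three entries, since \<open>\<xi> \<in> F \<xi>\<close> and
  \<open>e \<xi>\<close> is not an ordinal. A model containing the set of these triples is therefore closed under
  \<open>F\<close>, \<open>e\<close> and the inverse of \<open>e\<close>, and the formulas expressing this do not involve ordered pairs.\<close>

definition triples :: "('v \<Rightarrow> 'v) \<Rightarrow> ('v \<Rightarrow> 'v) \<Rightarrow> 'v" where
  "triples F e = vset ((\<lambda>\<xi>. vset {\<xi>, F \<xi>, e \<xi>}) ` elts \<kappa>)"

lemma elts_triples: "elts (triples F e) = (\<lambda>\<xi>. vset {\<xi>, F \<xi>, e \<xi>}) ` elts \<kappa>"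
  unfolding triples_def by (rule elts_vset[OF image_lepoll])

lemma triples_Hset_plus:
  assumes F: "\<And>\<xi>. \<xi> \<in> elts \<kappa> \<Longrightarrow> F \<xi> \<in> elts \<kappa>" and e: "\<And>\<xi>. \<xi> \<in> elts \<kappa> \<Longrightarrow> e \<xi> \<in> Hset \<kappa>"
  shows "triples F e \<in> Hset_plus \<kappa>"
proof -
  define Y where "Y \<xi> = {vset {\<xi>, F \<xi>, e \<xi>}, e \<xi>} \<union> elts \<kappa> \<union> trcl (e \<xi>)" for \<xi>
  have "trcl (triples F e) \<subseteq> (\<Union>\<xi>\<in>elts \<kappa>. Y \<xi>)"
  proof (rule trcl_subset)
    show "elts (triples F e) \<subseteq> (\<Union>\<xi>\<in>elts \<kappa>. Y \<xi>)" unfolding elts_triples Y_def by blast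
  next
    fix y assume "y \<in> (\<Union>\<xi>\<in>elts \<kappa>. Y \<xi>)"
    then obtain \<xi> where \<xi>: "\<xi> \<in> elts \<kappa>" "y \<in> Y \<xi>" by blast
    have "elts y \<subseteq> Y \<xi>"
      using \<xi>(2) Ord_mem_subset[OF Ord_kappa, of y] elts_subset_trcl[of "e \<xi>"]
        trcl_trans[of y "e \<xi>"] F[OF \<xi>(1)] \<xi>(1)
      unfolding Y_def by auto
    then show "elts y \<subseteq> (\<Union>\<xi>\<in>elts \<kappa>. Y \<xi>)" using \<xi>(1) by blast
  qed
  moreover have "(\<Union>\<xi>\<in>elts \<kappa>. Y \<xi>) \<lesssim> elts \<kappa>"
    unfolding Y_def
    by (intro UN_lepoll_infinite Un_lepoll_infinite infinite_kappa finite_lepoll_infinite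
        lepoll_refl lesspoll_imp_lepoll) (use e in \<open>auto simp: Hset_def\<close>)
  ultimately show ?thesis unfolding Hset_plus_def using subset_imp_lepoll lepoll_trans by blast
qed

lemma elementary_submodel_triples:
  assumes M: "elementary_submodel M (Hset_plus \<kappa>)" "triples F e \<in> M"
    and F: "\<And>\<xi>. \<xi> \<in> elts \<kappa> \<Longrightarrow> F \<xi> \<in> elts \<kappa> \<and> \<xi> \<in> elts (F \<xi>)"
    and e: "\<And>\<xi>. \<xi> \<in> elts \<kappa> \<Longrightarrow> \<not> Ord (e \<xi>)" "\<And>\<xi> x. \<xi> \<in> elts \<kappa> \<Longrightarrow> x \<in> elts (e \<xi>) \<Longrightarrow> \<not> Ord x"
  shows "\<xi> \<in> M \<Longrightarrow> \<xi> \<in> elts \<kappa> \<Longrightarrow> F \<xi> \<in> M \<and> e \<xi> \<in> M"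
    and "t \<in> M \<Longrightarrow> t \<in> e ` elts \<kappa> \<Longrightarrow> \<exists>\<eta>\<in>M \<inter> elts \<kappa>. t = e \<eta>"
proof -
  define p where "p = triples F e"
  have p: "p \<in> M" "p \<in> Hset_plus \<kappa>" and MH: "M \<subseteq> Hset_plus \<kappa>"
    using M unfolding elementary_submodel_def p_def by auto
  have elem: "sat M v \<phi> \<longleftrightarrow> sat (Hset_plus \<kappa>) v \<phi>" if "range v \<subseteq> M" for v \<phi>
    using M(1) that unfolding elementary_submodel_def by blast
  have q_in: "vset {\<xi>, F \<xi>, e \<xi>} \<in> elts p" if "\<xi> \<in> elts \<kappa>" for \<xi>
    using that unfolding p_def elts_triples by blast
  have H: "vset {\<xi>, F \<xi>, e \<xi>} \<in> Hset_plus \<kappa>" "\<xi> \<in> Hset_plus \<kappa>" "F \<xi> \<in> Hset_plus \<kappa>" "e \<xi> \<in> Hset_plus \<kappa>"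
    if "\<xi> \<in> elts \<kappa>" for \<xi>
  proof -
    show q: "vset {\<xi>, F \<xi>, e \<xi>} \<in> Hset_plus \<kappa>" by (rule Hset_plus_trans[OF p(2) q_in[OF that]])
    show "\<xi> \<in> Hset_plus \<kappa>" "F \<xi> \<in> Hset_plus \<kappa>" "e \<xi> \<in> Hset_plus \<kappa>"
      by (rule Hset_plus_trans[OF q], simp)+
  qed
  have neq: "e \<xi> \<noteq> \<eta>" "\<eta> \<notin> elts (e \<xi>)" "e \<xi> \<notin> elts \<eta>" if "\<xi> \<in> elts \<kappa>" "\<eta> \<in> elts \<kappa>" for \<xi> \<eta>
    using e that Ord_below[OF that(2)] Ord_in_Ord by blast+
  {
    assume \<xi>: "\<xi> \<in> M" "\<xi> \<in> elts \<kappa>"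
    \<comment> \<open>Variables 0 and 1 are the parameters \<open>p\<close> and \<xi>. Variable 2 is
      a triple containing \<xi>, 3 its entry above \<xi>, and 4 the remaining entry.\<close>
    define \<phi> where "\<phi> = Exists 2 (Exists 3 (Exists 4 (Conj (Mem 2 0) (Conj (Mem 1 2) (Conj (Mem 3 2)
      (Conj (Mem 1 3) (Conj (Mem 4 2) (Conj (Neg (Equal 4 1)) (Neg (Equal 4 3))))))))))"
    define v where "v = (\<lambda>n::nat. if n = 0 then p else \<xi>)"
    have sat_iff: "sat A v \<phi> \<longleftrightarrow> (\<exists>q\<in>A. \<exists>y\<in>A. \<exists>w\<in>A. q \<in> elts p \<and> \<xi> \<in> elts q \<and> y \<in> elts q \<and> \<xi> \<in> elts y \<and> w \<in> elts q \<and> w \<noteq> \<xi> \<and> w \<noteq> y)" for A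
      by (simp add: \<phi>_def v_def)
    have "sat (Hset_plus \<kappa>) v \<phi>"
      unfolding sat_iff using H[OF \<xi>(2)] q_in[OF \<xi>(2)] F[OF \<xi>(2)] neq(1)[OF \<xi>(2)] \<xi>(2)
      by (intro bexI[of _ "vset {\<xi>, F \<xi>, e \<xi>}"] bexI[of _ "F \<xi>"] bexI[of _ "e \<xi>"] conjI) auto
    then have "sat M v \<phi>" using elem[of v \<phi>] p \<xi> by (auto simp: v_def)
    then obtain q y w where q: "q \<in> elts p" "\<xi> \<in> elts q" "y \<in> elts q" "\<xi> \<in> elts y" "w \<in> elts q"
      "w \<noteq> \<xi>" "w \<noteq> y" and M': "q \<in> M" "y \<in> M" "w \<in> M"
      unfolding sat_iff by blast
    obtain \<eta> where \<eta>: "\<eta> \<in> elts \<kappa>" "q = vset {\<eta>, F \<eta>, e \<eta>}"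
      using q(1) unfolding p_def elts_triples by blast
    \<comment> \<open>As an ordinal, \<xi> differs from \<open>e \<eta>\<close>. It is not
      \<open>F \<eta>\<close> either, because no entry of the triple has \<open>F \<eta>\<close> as
      a member, while \<open>y\<close> has \<xi> as one.\<close>
    have "\<xi> = \<eta> \<or> \<xi> = F \<eta>" using q(2) neq[OF \<eta>(1) \<xi>(2)] unfolding \<eta>(2) by auto
    moreover have "\<xi> \<noteq> F \<eta>"
      using q(3,4) F[OF \<eta>(1)] neq[OF \<eta>(1) \<xi>(2)] mem_asym unfolding \<eta>(2) by auto
    ultimately have "\<xi> = \<eta>" by blast
    moreover have "y = F \<eta>"
      using q(3,4) neq[OF \<eta>(1) \<xi>(2)] calculation unfolding \<eta>(2) by auto
    moreover have "w = e \<eta>" using q(5-7) calculation unfolding \<eta>(2) by auto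
    ultimately show "F \<xi> \<in> M \<and> e \<xi> \<in> M" using M' by blast
  }
  {
    assume t: "t \<in> M" "t \<in> e ` elts \<kappa>"
    then obtain \<xi> where \<xi>: "\<xi> \<in> elts \<kappa>" "t = e \<xi>" by blast
    \<comment> \<open>Now variable 1 is \<open>t\<close>. The only membership between entries of a
      triple is \<eta> in \<open>F \<eta>\<close>, so variable 3 must be the index. As
      \<open>e\<close> may fail to be injective, the index found in \<open>M\<close> can differ from
      \<xi>.\<close>
    define \<phi> where "\<phi> = Exists 2 (Exists 3 (Exists 4 (Conj (Mem 2 0) (Conj (Mem 1 2) (Conj (Mem 3 2)
      (Conj (Mem 4 2) (Mem 3 4)))))))"
    define v where "v = (\<lambda>n::nat. if n = 0 then p else t)"
    have sat_iff: "sat A v \<phi> \<longleftrightarrow> (\<exists>q\<in>A. \<exists>y\<in>A. \<exists>w\<in>A. q \<in> elts p \<and> t \<in> elts q \<and> y \<in> elts q \<and> w \<in> elts q \<and> y \<in> elts w)" for A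
      by (simp add: \<phi>_def v_def)
    have "sat (Hset_plus \<kappa>) v \<phi>"
      unfolding sat_iff unfolding \<xi>(2) using H[OF \<xi>(1)] q_in[OF \<xi>(1)] F[OF \<xi>(1)]
      by (intro bexI[of _ "vset {\<xi>, F \<xi>, e \<xi>}"] bexI[of _ "F \<xi>"] bexI[of _ "\<xi>"] conjI) auto
    then have "sat M v \<phi>" using elem[of v \<phi>] p t by (auto simp: v_def)
    then obtain q y z where q: "q \<in> elts p" "t \<in> elts q" "y \<in> elts q" "z \<in> elts q" "y \<in> elts z"
      and M': "q \<in> M" "y \<in> M"
      unfolding sat_iff by blast
    obtain \<eta> where \<eta>: "\<eta> \<in> elts \<kappa>" "q = vset {\<eta>, F \<eta>, e \<eta>}"
      using q(1) unfolding p_def elts_triples by blast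
    have F\<eta>: "F \<eta> \<in> elts \<kappa>" "\<eta> \<in> elts (F \<eta>)" using F[OF \<eta>(1)] by auto
    have "t = e \<eta>" using q(2) neq[OF \<xi>(1) \<eta>(1)] neq[OF \<xi>(1) F\<eta>(1)] unfolding \<eta>(2) \<xi>(2) by auto
    moreover have "y = \<eta>"
      using q(3-5) neq[OF \<eta>(1) \<eta>(1)] neq[OF \<eta>(1) F\<eta>(1)] F\<eta>(2) mem_asym unfolding \<eta>(2) by auto
    ultimately show "\<exists>\<eta>\<in>M \<inter> elts \<kappa>. t = e \<eta>" using M' \<eta>(1) by blast
  }
qed

end

section \<open>Climbing along a ladder\<close>

text \<open>\<open>insert (vset (vdom u)) (vdom u)\<close> is the successor of the length of \<open>u\<close>.\<close>

definition tstep :: "'v::set_universe set \<Rightarrow> ('v \<Rightarrow> 'v set) \<Rightarrow> 'v \<Rightarrow> 'v \<Rightarrow> 'v \<Rightarrow> 'v" where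
  "tstep B0 L c \<beta> u = (if vdom u = elts \<beta> then u else
    let X = {t \<in> L \<beta>. elts u \<subseteq> elts t};
        Y = {t \<in> X. if \<beta> \<in> B0 then \<exists>s\<in>elts c. elts s \<subseteq> elts t
          else \<forall>s\<in>elts c. vdom s = insert (vset (vdom u)) (vdom u) \<longrightarrow> \<not> elts s \<subseteq> elts t}
    in SOME t. t \<in> (if Y = {} then X else Y))"

function walk :: "'v::set_universe set \<Rightarrow> ('v \<Rightarrow> 'v set) \<Rightarrow> 'v \<Rightarrow> 'v \<Rightarrow> 'v \<Rightarrow> 'v" where
  "walk B0 L C x \<beta> = tstep B0 L (vapp C \<beta>) \<beta>
    (vset (elts x \<union> (\<Union>\<gamma>\<in>{\<gamma> \<in> vdom C \<inter> elts \<beta>. vdom x \<subseteq> elts \<gamma>}. elts (walk B0 L C x \<gamma>))))"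
  by pat_completeness auto
termination
  by (relation "inv_image {(x, y). x \<in> elts y} (\<lambda>(_, _, _, _, \<beta>). \<beta>)") (auto intro: foundation)

declare walk.simps [simp del]

text \<open>If \<open>\<beta>\<close> has an immediate predecessor \<open>\<gamma>\<close> in the domain of \<open>C\<close>, then the trunk is just the walk
  at \<open>\<gamma>\<close>, and at accumulation points it already has length \<open>\<beta>\<close>; so no case distinction is needed.\<close>

definition trunk :: "'v::set_universe set \<Rightarrow> ('v \<Rightarrow> 'v set) \<Rightarrow> 'v \<Rightarrow> 'v \<Rightarrow> 'v \<Rightarrow> 'v" where
  "trunk B0 L C x \<beta> =
    vset (elts x \<union> (\<Union>\<gamma>\<in>{\<gamma> \<in> vdom C \<inter> elts \<beta>. vdom x \<subseteq> elts \<gamma>}. elts (walk B0 L C x \<gamma>)))"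

lemma walk_trunk: "walk B0 L C x \<beta> = tstep B0 L (vapp C \<beta>) \<beta> (trunk B0 L C x \<beta>)"
  by (subst walk.simps) (simp add: trunk_def)

lemma tstep_cong: "L \<beta> = L' \<beta> \<Longrightarrow> tstep B0 L c \<beta> u = tstep B0 L' c \<beta> u"
  unfolding tstep_def by simp

text \<open>The walk at \<beta> consults \<open>L\<close> only up to \<beta>, hence the trunk at
  \<alpha> only below \<alpha>. This allows the walk to occur inside the recursion that defines the
  levels.\<close>

lemma walk_cong:
  assumes "Ord \<alpha>" "\<And>\<beta>. \<beta> \<in> elts \<alpha> \<Longrightarrow> L \<beta> = L' \<beta>"
  shows "\<beta> \<in> elts \<alpha> \<Longrightarrow> walk B0 L C x \<beta> = walk B0 L' C x \<beta>"
proof (induction \<beta> rule: eps_induct)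
  case (1 \<beta>)
  have "trunk B0 L C x \<beta> = trunk B0 L' C x \<beta>"
    unfolding trunk_def using 1(1) Ord_trans[OF assms(1) 1(2)] by simp
  then show ?case
    unfolding walk_trunk[of _ _ _ _ \<beta>] using tstep_cong[of L \<beta> L', OF assms(2)[OF 1(2)]] by simp
qed

lemma trunk_cong:
  assumes "Ord \<alpha>" "\<And>\<beta>. \<beta> \<in> elts \<alpha> \<Longrightarrow> L \<beta> = L' \<beta>"
  shows "trunk B0 L C x \<alpha> = trunk B0 L' C x \<alpha>"
  unfolding trunk_def using walk_cong[OF assms] by simp

text \<open>No point below \<beta> includes \<beta>, so there are no earlier positions to collect. A
  restarted walk begins this way.\<close>

lemma trunk_start:
  assumes "vdom x = elts \<beta>"
  shows "trunk B0 L C x \<beta> = x" "walk B0 L C x \<beta> = x"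
proof -
  have none: "{\<gamma> \<in> vdom C \<inter> elts \<beta>. vdom x \<subseteq> elts \<gamma>} = {}"
    using assms mem_irrefl by blast
  show "trunk B0 L C x \<beta> = x" unfolding trunk_def none by simp
  then show "walk B0 L C x \<beta> = x" unfolding walk_trunk tstep_def using assms by simp
qed

text \<open>Restarting a walk at its position \<open>y\<close> at \<gamma>: from \<gamma> on both
  walks make the same choices, because \<open>tstep\<close> sees only the current ladder value and
  the trunk, and all positions along \<open>C\<close> before \<gamma> are absorbed in
  \<open>y\<close>.\<close>

lemma trunk_coherent:
  assumes \<beta>: "Ord \<beta>" and \<gamma>: "\<gamma> \<in> vdom C" "\<gamma> \<in> elts \<beta>"
    and y: "y = walk B0 L C x \<gamma>" "vdom y = elts \<gamma>" and x: "vdom x \<subseteq> elts \<gamma>" "elts x \<subseteq> elts y"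
    and agree: "\<And>\<eta>. \<eta> \<in> elts \<beta> \<Longrightarrow> \<eta> \<notin> elts \<gamma> \<Longrightarrow> (\<eta> \<in> vdom D \<longleftrightarrow> \<eta> \<in> vdom C) \<and> vapp D \<eta> = vapp C \<eta>"
    and mono: "\<And>\<zeta>. \<zeta> \<in> vdom C \<Longrightarrow> \<zeta> \<in> elts \<gamma> \<Longrightarrow> vdom x \<subseteq> elts \<zeta> \<Longrightarrow> elts (walk B0 L C x \<zeta>) \<subseteq> elts y"
  shows "trunk B0 L D y \<beta> = trunk B0 L C x \<beta>"
proof -
  note Ob = Ord_in_Ord[OF \<beta>]
  have trunk_eq: "trunk B0 L D y \<eta> = trunk B0 L C x \<eta>"
    if \<eta>: "elts \<eta> \<subseteq> elts \<beta>" "\<gamma> \<in> elts \<eta>"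
      and IH: "\<And>\<zeta>. \<zeta> \<in> vdom C \<Longrightarrow> \<zeta> \<in> elts \<eta> \<Longrightarrow> \<zeta> \<notin> elts \<gamma> \<Longrightarrow> walk B0 L D y \<zeta> = walk B0 L C x \<zeta>" for \<eta>
  proof -
    have "elts y \<union> (\<Union>\<zeta>\<in>{\<zeta> \<in> vdom D \<inter> elts \<eta>. vdom y \<subseteq> elts \<zeta>}. elts (walk B0 L D y \<zeta>)) =
      elts x \<union> (\<Union>\<zeta>\<in>{\<zeta> \<in> vdom C \<inter> elts \<eta>. vdom x \<subseteq> elts \<zeta>}. elts (walk B0 L C x \<zeta>))"
    proof (intro equalityI subsetI)
      fix q assume "q \<in> elts y \<union> (\<Union>\<zeta>\<in>{\<zeta> \<in> vdom D \<inter> elts \<eta>. vdom y \<subseteq> elts \<zeta>}. elts (walk B0 L D y \<zeta>))"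
      then consider "q \<in> elts (walk B0 L C x \<gamma>)"
        | \<zeta> where "\<zeta> \<in> vdom D" "\<zeta> \<in> elts \<eta>" "elts \<gamma> \<subseteq> elts \<zeta>" "q \<in> elts (walk B0 L D y \<zeta>)"
        using y by blast
      then show "q \<in> elts x \<union> (\<Union>\<zeta>\<in>{\<zeta> \<in> vdom C \<inter> elts \<eta>. vdom x \<subseteq> elts \<zeta>}. elts (walk B0 L C x \<zeta>))"
      proof cases
        case 1
        then show ?thesis using \<gamma>(1) \<eta>(2) x(1) by blast
      next
        case (2 \<zeta>)
        have "\<zeta> \<notin> elts \<gamma>" using 2(3) mem_irrefl by blast
        then have "\<zeta> \<in> vdom C" "walk B0 L D y \<zeta> = walk B0 L C x \<zeta>"
          using agree[of \<zeta>] IH[of \<zeta>] 2(1,2) \<eta>(1) by blast+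
        then show ?thesis using 2 x(1) by auto
      qed
    next
      fix q assume "q \<in> elts x \<union> (\<Union>\<zeta>\<in>{\<zeta> \<in> vdom C \<inter> elts \<eta>. vdom x \<subseteq> elts \<zeta>}. elts (walk B0 L C x \<zeta>))"
      then consider "q \<in> elts x"
        | \<zeta> where "\<zeta> \<in> vdom C" "\<zeta> \<in> elts \<eta>" "vdom x \<subseteq> elts \<zeta>" "q \<in> elts (walk B0 L C x \<zeta>)"
        by blast
      then show "q \<in> elts y \<union> (\<Union>\<zeta>\<in>{\<zeta> \<in> vdom D \<inter> elts \<eta>. vdom y \<subseteq> elts \<zeta>}. elts (walk B0 L D y \<zeta>))"
      proof cases
        case 1
        then show ?thesis using x(2) by blast
      next
        case (2 \<zeta>)
        show ?thesis
        proof (cases "\<zeta> \<in> elts \<gamma>")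
          case True
          then show ?thesis using mono[OF 2(1) True 2(3)] 2(4) by blast
        next
          case False
          then have "\<zeta> \<in> vdom D" "walk B0 L D y \<zeta> = walk B0 L C x \<zeta>"
            using agree[of \<zeta>] IH[of \<zeta>] 2(1,2) \<eta>(1) by blast+
          moreover have "elts \<gamma> \<subseteq> elts \<zeta>"
            using not_mem_iff_subset[OF Ob[OF \<gamma>(2)] Ob[of \<zeta>]] False 2(2) \<eta>(1) by blast
          ultimately show ?thesis using 2(2,4) y(2) by auto
        qed
      qed
    qed
    then show ?thesis unfolding trunk_def by simp
  qed
  have walk_eq: "\<eta> \<in> vdom C \<Longrightarrow> \<eta> \<in> elts \<beta> \<Longrightarrow> \<eta> \<notin> elts \<gamma> \<Longrightarrow> walk B0 L D y \<eta> = walk B0 L C x \<eta>" for \<eta>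
  proof (induction \<eta> rule: eps_induct)
    case (1 \<eta>)
    show ?case
    proof (cases "\<eta> = \<gamma>")
      case True
      then show ?thesis using trunk_start(2)[OF y(2)] y(1) by simp
    next
      case False
      then have "\<gamma> \<in> elts \<eta>" using Ord_linear[OF Ob[OF 1(3)] Ob[OF \<gamma>(2)]] 1(4) by blast
      then have "trunk B0 L D y \<eta> = trunk B0 L C x \<eta>"
        using Ord_mem_subset[OF \<beta> 1(3)] 1(1) by (intro trunk_eq) blast+
      then show ?thesis unfolding walk_trunk[of _ _ _ _ \<eta>] using agree[OF 1(3,4)] by simp
    qed
  qed
  show ?thesis by (rule trunk_eq) (use \<gamma> walk_eq in auto)
qed

section \<open>The levels of the tree\<close>

text \<open>The last clause of the principle enters for n = 1 and \<theta> = 1, so the families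
  indexed by \<theta> appear as plain arguments.\<close>

locale bullet_sequence = regular_cardinal \<kappa> for \<kappa> :: "'v::set_universe" +
  fixes \<chi> \<sigma> lam :: 'v and \<C> B :: "'v \<Rightarrow> 'v set"
  assumes chi: "regular_card \<chi>" "\<chi> \<in> elts \<kappa>" "lt_closed \<chi> \<kappa>"
    and sigma: "\<sigma> \<in> elts \<kappa>"
    and lam: "Card lam" "infinite (elts lam)" "lam \<in> elts \<kappa>"
    and cells_disjoint: "disjoint_family_on B (elts \<kappa>)"
    and ladder: "\<And>\<alpha>. \<alpha> \<in> acc_pts (elts \<kappa>) \<Longrightarrow>
      \<C> \<alpha> \<subseteq> {C \<in> FF \<kappa>. sup_dom C = \<alpha>} \<and> \<C> \<alpha> \<noteq> {} \<and> \<C> \<alpha> \<prec> elts \<kappa> \<and>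
      (\<forall>C\<in>\<C> \<alpha>. \<forall>\<alpha>'\<in>acc_pts (vdom C). \<exists>D\<in>\<C> \<alpha>'. sq_star_chi \<chi> D C)"
    and guess: "\<And>\<Omega> p \<iota> \<Lambda>. \<lbrakk>\<Omega> \<subseteq> Hset \<kappa>; p \<in> Hset_plus \<kappa>; \<iota> \<in> elts \<kappa>; \<Lambda> \<in> elts lam\<rbrakk> \<Longrightarrow>
      stationary_in \<kappa> {\<alpha> \<in> E_ge \<kappa> \<chi> \<inter> E_gt \<kappa> \<Lambda>. \<C> \<alpha> \<prec> elts (osucc (osucc (ozero::'v))) \<and>
        (\<forall>C\<in>\<C> \<alpha>. \<forall>i\<in>elts \<alpha> \<inter> elts (osucc ozero).
          osup {\<gamma> \<in> vdom C. succ_n (osucc ozero) (vdom C - elts \<gamma>) \<subseteq> guess_set \<kappa> (B \<iota>) \<Omega> p C} = \<alpha>)}"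
begin

lemma Ord_chi: "Ord \<chi>" and infinite_chi: "infinite (elts \<chi>)"
  using chi(1) unfolding regular_card_def Card_def by auto

lemma ladder_props:
  assumes \<alpha>: "\<alpha> \<in> elts \<kappa>" "limit_ord \<alpha>" and C: "C \<in> \<C> \<alpha>"
  shows "vdom C \<subseteq> elts \<alpha>" "\<And>\<delta>. \<delta> \<in> elts \<alpha> \<Longrightarrow> \<exists>\<gamma>\<in>vdom C. \<delta> \<in> elts \<gamma>"
    "\<And>\<beta>. \<beta> \<in> elts \<alpha> \<Longrightarrow> \<beta> \<noteq> ozero \<Longrightarrow> (\<And>\<delta>. \<delta> \<in> elts \<beta> \<Longrightarrow> \<exists>\<gamma>\<in>vdom C \<inter> elts \<beta>. \<delta> \<in> elts \<gamma>) \<Longrightarrow>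
      \<beta> \<in> vdom C"
    "sup_dom C = \<alpha>"
proof -
  have "\<alpha> \<in> acc_pts (elts \<kappa>)" using acc_pts_elts[OF Ord_kappa] \<alpha> by blast
  then have "C \<in> FF \<kappa>" and sup: "osup (vdom C) = \<alpha>"
    using ladder C unfolding sup_dom_def by blast+
  then have club: "club_in \<alpha> (vdom C)" unfolding FF_def by blast
  show 1: "vdom C \<subseteq> elts \<alpha>" using club unfolding club_in_def by blast
  show "\<exists>\<gamma>\<in>vdom C. \<delta> \<in> elts \<gamma>" if "\<delta> \<in> elts \<alpha>" for \<delta>
    using osup_eq_iff[OF Ord_below[OF \<alpha>(1)] 1] sup that by blast
  show "\<beta> \<in> vdom C" if "\<beta> \<in> elts \<alpha>" "\<beta> \<noteq> ozero"
    "\<And>\<delta>. \<delta> \<in> elts \<beta> \<Longrightarrow> \<exists>\<gamma>\<in>vdom C \<inter> elts \<beta>. \<delta> \<in> elts \<gamma>" for \<beta>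
  proof -
    have "osup (vdom C \<inter> elts \<beta>) = \<beta>"
      using osup_eq_iff[OF Ord_in_Ord[OF Ord_below[OF \<alpha>(1)] that(1)], of "vdom C \<inter> elts \<beta>"] that(3)
      by blast
    then show ?thesis using club that(1,2) unfolding club_in_def by blast
  qed
  show "sup_dom C = \<alpha>" using sup unfolding sup_dom_def .
qed

text \<open>At cofinality at least \<chi> the escape clause of \<open>sq_star_chi\<close> fails, and
  equality of the two restrictions means equal domains and values on a final segment of
  \<beta>.\<close>

lemma ladder_coherence:
  assumes \<alpha>: "\<alpha> \<in> elts \<kappa>" "limit_ord \<alpha>" and C: "C \<in> \<C> \<alpha>"
    and \<beta>: "\<beta> \<in> vdom C" "limit_ord \<beta>" "\<And>\<delta>. \<delta> \<in> elts \<beta> \<Longrightarrow> \<exists>\<gamma>\<in>vdom C \<inter> elts \<beta>. \<delta> \<in> elts \<gamma>"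
    and cf: "cf \<beta> \<notin> elts \<chi>"
  shows "\<exists>D\<in>\<C> \<beta>. \<exists>\<gamma>\<in>elts \<beta>. \<forall>\<eta>\<in>elts \<beta>. \<eta> \<notin> elts \<gamma> \<longrightarrow>
    (\<eta> \<in> vdom D \<longleftrightarrow> \<eta> \<in> vdom C) \<and> vapp D \<eta> = vapp C \<eta>"
proof -
  have \<beta>\<alpha>: "\<beta> \<in> elts \<alpha>" using ladder_props(1)[OF assms(1-3)] \<beta>(1) by blast
  then have \<beta>\<kappa>: "\<beta> \<in> elts \<kappa>" by (rule Ord_trans[OF Ord_kappa \<alpha>(1)])
  have "osup (vdom C \<inter> elts \<beta>) = \<beta>"
    using osup_eq_iff[OF Ord_below[OF \<beta>\<kappa>], of "vdom C \<inter> elts \<beta>"] \<beta>(3) by blast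
  then have "\<beta> \<in> acc_pts (vdom C)" using \<beta>(1,2) unfolding acc_pts_def limit_ord_def by blast
  then obtain D where D: "D \<in> \<C> \<beta>" "sq_star_chi \<chi> D C"
    using ladder[of \<alpha>] acc_pts_elts[OF Ord_kappa] \<alpha> C by blast
  have supD: "sup_dom D = \<beta>" and domD: "vdom D \<subseteq> elts \<beta>"
    using ladder_props[OF \<beta>\<kappa> \<beta>(2) D(1)] by auto
  then have "sq_star D C" using D(2) cf unfolding sq_star_chi_def by simp
  then obtain \<gamma> where \<gamma>: "\<gamma> \<in> elts \<beta>"
    and eq: "vrestrict D (vdom D - elts \<gamma>) = vrestrict C (vdom C \<inter> (elts \<beta> - elts \<gamma>))"
    unfolding sq_star_def supD by blast
  have "vpair \<eta> b \<in> elts D \<longleftrightarrow> vpair \<eta> b \<in> elts C" if "\<eta> \<in> elts \<beta>" "\<eta> \<notin> elts \<gamma>" for \<eta> b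
  proof -
    have "vpair \<eta> b \<in> elts D \<longleftrightarrow> vpair \<eta> b \<in> elts (vrestrict D (vdom D - elts \<gamma>))"
      using that unfolding elts_vrestrict vdom_def by auto
    also have "\<dots> \<longleftrightarrow> vpair \<eta> b \<in> elts C"
      unfolding eq elts_vrestrict using that unfolding vdom_def by auto
    finally show ?thesis .
  qed
  then have "\<forall>\<eta>\<in>elts \<beta>. \<eta> \<notin> elts \<gamma> \<longrightarrow> (\<eta> \<in> vdom D \<longleftrightarrow> \<eta> \<in> vdom C) \<and> vapp D \<eta> = vapp C \<eta>"
    unfolding vdom_def vapp_def by simp
  then show ?thesis using D(1) \<gamma> by blast
qed

text \<open>The labels at successors have three sources: \<delta> and the copy of
  \<open>omega\<close> inside \<open>lam\<close> make the tree prolific, \<sigma> gives the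
  splitting, and \<open>lam\<close> supplies more successors than a path of width \<Lambda> has
  nodes on one level. All labels are ordinals below \<kappa>.\<close>

definition lev_step :: "('v \<Rightarrow> 'v set) \<Rightarrow> 'v \<Rightarrow> 'v set" where
  "lev_step L \<alpha> = (if \<alpha> = ozero then {ozero}
    else if \<exists>\<delta>. \<alpha> = osucc \<delta> then
      {vappend \<delta> t i | \<delta> t i. \<delta> \<in> elts \<alpha> \<and> \<alpha> = osucc \<delta> \<and> t \<in> L \<delta> \<and> i \<in> elts \<delta> \<union> elts \<sigma> \<union> elts lam}
    else if cf \<alpha> \<in> elts \<chi> then
      {t \<in> seqs \<alpha> (elts \<kappa>). \<forall>\<beta>\<in>elts \<alpha>. vrestrict t (elts \<beta>) \<in> L \<beta>}
    else {trunk (B ozero) L C x \<alpha> | C x. C \<in> \<C> \<alpha> \<and> x \<in> (\<Union>\<delta>\<in>elts \<alpha>. L \<delta>)})"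

definition Lev :: "'v \<Rightarrow> 'v set" where
  "Lev = wfrec {(x, y). x \<in> elts y} lev_step"

abbreviation wlk :: "'v \<Rightarrow> 'v \<Rightarrow> 'v \<Rightarrow> 'v" where
  "wlk \<equiv> walk (B ozero) Lev"

abbreviation trk :: "'v \<Rightarrow> 'v \<Rightarrow> 'v \<Rightarrow> 'v" where
  "trk \<equiv> trunk (B ozero) Lev"

text \<open>\<open>lev_step\<close> at \<alpha> looks only at levels below \<alpha>; for the trunks
  this is \<open>trunk_cong\<close>.\<close>

lemma Lev_unfold:
  assumes "Ord \<alpha>"
  shows "Lev \<alpha> = lev_step Lev \<alpha>"
proof -
  define L where "L = cut Lev {(x, y). x \<in> elts y} \<alpha>"
  have agree: "L \<beta> = Lev \<beta>" if "\<beta> \<in> elts \<alpha>" for \<beta>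
    using that unfolding L_def by (simp add: cut_apply)
  have "trunk (B ozero) L C x \<alpha> = trk C x \<alpha>" for C x
    using trunk_cong[OF assms, of L Lev] agree by blast
  moreover have "(\<Union>\<delta>\<in>elts \<alpha>. L \<delta>) = (\<Union>\<delta>\<in>elts \<alpha>. Lev \<delta>)" using agree by simp
  moreover have "{vappend \<delta> t i | \<delta> t i. \<delta> \<in> elts \<alpha> \<and> \<alpha> = osucc \<delta> \<and> t \<in> L \<delta> \<and>
      i \<in> elts \<delta> \<union> elts \<sigma> \<union> elts lam} =
    {vappend \<delta> t i | \<delta> t i. \<delta> \<in> elts \<alpha> \<and> \<alpha> = osucc \<delta> \<and> t \<in> Lev \<delta> \<and>
      i \<in> elts \<delta> \<union> elts \<sigma> \<union> elts lam}"
    using agree by (intro Collect_cong) metis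
  ultimately have "lev_step L \<alpha> = lev_step Lev \<alpha>"
    unfolding lev_step_def by (simp only: agree cong: ball_cong)
  moreover have "Lev \<alpha> = lev_step L \<alpha>"
    unfolding L_def by (rule def_wfrec[OF _ foundation]) (simp add: Lev_def)
  ultimately show ?thesis by simp
qed

lemma Lev_ozero: "Lev ozero = {ozero}"
  using Lev_unfold[of ozero] by (simp add: lev_step_def)

lemma Lev_osucc:
  assumes "Ord \<delta>"
  shows "Lev (osucc \<delta>) = {vappend \<delta> t i | t i. t \<in> Lev \<delta> \<and> i \<in> elts \<delta> \<union> elts \<sigma> \<union> elts lam}"
proof -
  have "osucc \<delta> \<noteq> ozero" using elts_osucc[of \<delta>] by (metis elts_ozero insert_not_empty)
  then have "Lev (osucc \<delta>) = {vappend \<delta>' t i | \<delta>' t i. \<delta>' \<in> elts (osucc \<delta>) \<and> osucc \<delta> = osucc \<delta>' \<and>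
      t \<in> Lev \<delta>' \<and> i \<in> elts \<delta>' \<union> elts \<sigma> \<union> elts lam}"
    unfolding Lev_unfold[OF Ord_osucc[OF assms]] lev_step_def by auto
  also have "\<dots> = {vappend \<delta> t i | t i. t \<in> Lev \<delta> \<and> i \<in> elts \<delta> \<union> elts \<sigma> \<union> elts lam}"
    using osucc_inject by (intro Collect_cong) (metis elts_osucc insertI1)
  finally show ?thesis .
qed

lemma Lev_limit:
  assumes "limit_ord \<alpha>"
  shows "Lev \<alpha> = (if cf \<alpha> \<in> elts \<chi> then {t \<in> seqs \<alpha> (elts \<kappa>). \<forall>\<beta>\<in>elts \<alpha>. vrestrict t (elts \<beta>) \<in> Lev \<beta>}
    else {trk C x \<alpha> | C x. C \<in> \<C> \<alpha> \<and> x \<in> (\<Union>\<delta>\<in>elts \<alpha>. Lev \<delta>)})"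
proof -
  have "Ord \<alpha>" "\<alpha> \<noteq> ozero" using assms unfolding limit_ord_def by auto
  moreover have "\<not> (\<exists>\<delta>. \<alpha> = osucc \<delta>)" using assms not_limit_osucc by blast
  ultimately show ?thesis using Lev_unfold[of \<alpha>] by (simp add: lev_step_def)
qed

section \<open>Climbing stays inside the tree\<close>

text \<open>The invariant of the recursion on levels. Its third clause, upward extension, keeps the
  choice in \<open>tstep\<close> nonempty.\<close>

definition good_level :: "'v \<Rightarrow> bool" where
  "good_level \<alpha> \<longleftrightarrow> Lev \<alpha> \<subseteq> seqs \<alpha> (elts \<kappa>) \<and>
    (\<forall>t\<in>Lev \<alpha>. \<forall>\<beta>\<in>elts \<alpha>. vrestrict t (elts \<beta>) \<in> Lev \<beta>) \<and>
    (\<forall>\<beta>\<in>elts \<alpha>. \<forall>s\<in>Lev \<beta>. \<exists>t\<in>Lev \<alpha>. elts s \<subseteq> elts t) \<and> Lev \<alpha> \<prec> elts \<kappa>"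

lemma good_levelD:
  assumes "good_level \<alpha>"
  shows "t \<in> Lev \<alpha> \<Longrightarrow> t \<in> seqs \<alpha> (elts \<kappa>)" "t \<in> Lev \<alpha> \<Longrightarrow> vdom t = elts \<alpha>"
    "t \<in> Lev \<alpha> \<Longrightarrow> \<beta> \<in> elts \<alpha> \<Longrightarrow> vrestrict t (elts \<beta>) \<in> Lev \<beta>"
    "\<beta> \<in> elts \<alpha> \<Longrightarrow> s \<in> Lev \<beta> \<Longrightarrow> \<exists>t\<in>Lev \<alpha>. elts s \<subseteq> elts t"
    "Lev \<alpha> \<prec> elts \<kappa>"
  using assms seqs_vdom unfolding good_level_def by blast+

text \<open>Shared by walks at accumulation points, trunks at \<alpha> and the completeness proof.
  It yields a branch through the levels below \<alpha>; whether this branch belongs to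
  \<open>Lev \<alpha>\<close> has to be decided separately.\<close>

lemma limit_union:
  assumes \<alpha>: "Ord \<alpha>" and good: "\<And>\<beta>. \<beta> \<in> elts \<alpha> \<Longrightarrow> good_level \<beta>"
    and G: "G \<subseteq> elts \<alpha>" "\<And>\<delta>. \<delta> \<in> elts \<alpha> \<Longrightarrow> \<exists>\<gamma>\<in>G. \<delta> \<in> elts \<gamma>"
    and w: "\<And>\<gamma>. \<gamma> \<in> G \<Longrightarrow> w \<gamma> \<in> Lev \<gamma>"
    and mono: "\<And>\<gamma> \<gamma>'. \<gamma> \<in> G \<Longrightarrow> \<gamma>' \<in> G \<Longrightarrow> \<gamma> \<in> elts \<gamma>' \<Longrightarrow> elts (w \<gamma>) \<subseteq> elts (w \<gamma>')"
  shows "elts (vset (\<Union>\<gamma>\<in>G. elts (w \<gamma>))) = (\<Union>\<gamma>\<in>G. elts (w \<gamma>))"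
    "vset (\<Union>\<gamma>\<in>G. elts (w \<gamma>)) \<in> seqs \<alpha> (elts \<kappa>)"
    "\<And>\<beta>. \<beta> \<in> elts \<alpha> \<Longrightarrow> vrestrict (vset (\<Union>\<gamma>\<in>G. elts (w \<gamma>))) (elts \<beta>) \<in> Lev \<beta>"
proof -
  have seq: "w \<gamma> \<in> seqs \<gamma> (elts \<kappa>)" if "\<gamma> \<in> G" for \<gamma>
    using good_levelD(1)[OF good w[OF that]] that G(1) by blast
  have chain: "elts (w \<gamma>) \<subseteq> elts (w \<gamma>') \<or> elts (w \<gamma>') \<subseteq> elts (w \<gamma>)" if "\<gamma> \<in> G" "\<gamma>' \<in> G" for \<gamma> \<gamma>'
    using mono[of \<gamma> \<gamma>'] mono[of \<gamma>' \<gamma>] that Ord_linear[of \<gamma> \<gamma>'] Ord_in_Ord[OF \<alpha>] G(1) by blast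
  have dom: "(\<Union>\<gamma>\<in>G. elts \<gamma>) = elts \<alpha>" using G Ord_trans[OF \<alpha>] by blast
  note U = seqs_Union[of G w "\<lambda>\<gamma>. \<gamma>", OF seq chain dom]
  show el: "elts (vset (\<Union>\<gamma>\<in>G. elts (w \<gamma>))) = (\<Union>\<gamma>\<in>G. elts (w \<gamma>))"
    and sq: "vset (\<Union>\<gamma>\<in>G. elts (w \<gamma>)) \<in> seqs \<alpha> (elts \<kappa>)" using U by blast+
  fix \<beta> assume "\<beta> \<in> elts \<alpha>"
  then obtain \<gamma> where \<gamma>: "\<gamma> \<in> G" "\<beta> \<in> elts \<gamma>" using G(2) by blast
  have "vrestrict (vset (\<Union>\<gamma>\<in>G. elts (w \<gamma>))) (elts \<beta>) = vrestrict (w \<gamma>) (elts \<beta>)"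
    by (rule vrestrict_of_subset[OF seq[OF \<gamma>(1)] sq])
      (use el \<gamma> Ord_mem_subset[OF Ord_in_Ord[OF \<alpha>]] G(1) in blast)+
  then show "vrestrict (vset (\<Union>\<gamma>\<in>G. elts (w \<gamma>))) (elts \<beta>) \<in> Lev \<beta>"
    using good_levelD(3)[OF good w[OF \<gamma>(1)] \<gamma>(2)] \<gamma>(1) G(1) by auto
qed

text \<open>A single suitable node \<open>t\<close> on level \<beta> makes the set \<open>Y\<close>
  nonempty, and then the chosen node is suitable too. Otherwise the choice falls back on
  \<open>X\<close>, which is nonempty by upward extension.\<close>

lemma tstep_above:
  assumes good: "good_level \<beta>" "good_level \<epsilon>" and u: "u \<in> Lev \<epsilon>" "\<epsilon> \<in> elts \<beta>"
  shows "tstep B0 Lev c \<beta> u \<in> Lev \<beta>" "elts u \<subseteq> elts (tstep B0 Lev c \<beta> u)"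
    and "\<beta> \<in> B0 \<Longrightarrow> t \<in> Lev \<beta> \<Longrightarrow> elts u \<subseteq> elts t \<Longrightarrow> s \<in> elts c \<Longrightarrow> elts s \<subseteq> elts t \<Longrightarrow>
      \<exists>s\<in>elts c. elts s \<subseteq> elts (tstep B0 Lev c \<beta> u)"
    and "\<beta> \<notin> B0 \<Longrightarrow> t \<in> Lev \<beta> \<Longrightarrow> elts u \<subseteq> elts t \<Longrightarrow>
      (\<And>s. s \<in> elts c \<Longrightarrow> vdom s = elts (osucc \<epsilon>) \<Longrightarrow> \<not> elts s \<subseteq> elts t) \<Longrightarrow>
      s \<in> elts c \<Longrightarrow> vdom s = elts (osucc \<epsilon>) \<Longrightarrow> \<not> elts s \<subseteq> elts (tstep B0 Lev c \<beta> u)"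
proof -
  have dom: "vdom u = elts \<epsilon>" by (rule good_levelD(2)[OF good(2) u(1)])
  have ne: "vdom u \<noteq> elts \<beta>" using dom u(2) mem_irrefl by metis
  define X where "X = {t \<in> Lev \<beta>. elts u \<subseteq> elts t}"
  define Y where "Y = {t \<in> X. if \<beta> \<in> B0 then \<exists>s\<in>elts c. elts s \<subseteq> elts t
          else \<forall>s\<in>elts c. vdom s = elts (osucc \<epsilon>) \<longrightarrow> \<not> elts s \<subseteq> elts t}"
  define r where "r = tstep B0 Lev c \<beta> u"
  have r: "r = (SOME t. t \<in> (if Y = {} then X else Y))"
    unfolding r_def tstep_def X_def Y_def Let_def by (simp only: ne[unfolded dom] dom vset_elts elts_osucc if_False)
  have X: "X \<noteq> {}" using good_levelD(4)[OF good(1) u(2,1)] unfolding X_def by blast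
  have rin: "r \<in> (if Y = {} then X else Y)" unfolding r
    by (rule someI_ex) (use X in auto)
  then have rX: "r \<in> X" unfolding Y_def by (auto split: if_splits)
  then show "tstep B0 Lev c \<beta> u \<in> Lev \<beta>" "elts u \<subseteq> elts (tstep B0 Lev c \<beta> u)"
    unfolding r_def[symmetric] X_def by auto
  show "\<exists>s\<in>elts c. elts s \<subseteq> elts (tstep B0 Lev c \<beta> u)"
    if "\<beta> \<in> B0" "t \<in> Lev \<beta>" "elts u \<subseteq> elts t" "s \<in> elts c" "elts s \<subseteq> elts t"
  proof -
    have "t \<in> Y" using that unfolding X_def Y_def by auto
    then have "r \<in> Y" using rin by (auto split: if_splits)
    then show ?thesis using that(1) unfolding Y_def r_def[symmetric] by auto
  qed
  show "\<not> elts s \<subseteq> elts (tstep B0 Lev c \<beta> u)"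
    if "\<beta> \<notin> B0" "t \<in> Lev \<beta>" "elts u \<subseteq> elts t"
      "\<And>s. s \<in> elts c \<Longrightarrow> vdom s = elts (osucc \<epsilon>) \<Longrightarrow> \<not> elts s \<subseteq> elts t"
      "s \<in> elts c" "vdom s = elts (osucc \<epsilon>)"
  proof -
    have "t \<in> Y" using that unfolding X_def Y_def by auto
    then have "r \<in> Y" using rin by (auto split: if_splits)
    then show ?thesis using that(1,5,6) unfolding Y_def r_def[symmetric] by auto
  qed
qed

lemma tstep_same: "vdom u = elts \<beta> \<Longrightarrow> tstep B0 L c \<beta> u = u"
  unfolding tstep_def by simp


text \<open>Induction on \<beta>. The critical case is an accumulation point of cofinality at least
  \<chi>: the earlier positions form a branch, but not every branch is a node there.\<close>

lemma walk_main:
  assumes \<alpha>: "\<alpha> \<in> elts \<kappa>" "limit_ord \<alpha>" and levels: "\<forall>\<beta>\<in>elts \<alpha>. good_level \<beta>"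
    and C: "C \<in> \<C> \<alpha>" and x: "\<delta> \<in> elts \<alpha>" "x \<in> Lev \<delta>"
  shows "\<beta> \<in> vdom C \<Longrightarrow> elts \<delta> \<subseteq> elts \<beta> \<Longrightarrow>
    wlk C x \<beta> \<in> Lev \<beta> \<and> elts (trk C x \<beta>) \<subseteq> elts (wlk C x \<beta>) \<and> elts x \<subseteq> elts (wlk C x \<beta>) \<and>
    (\<forall>\<gamma>\<in>vdom C \<inter> elts \<beta>. elts \<delta> \<subseteq> elts \<gamma> \<longrightarrow> elts (wlk C x \<gamma>) \<subseteq> elts (wlk C x \<beta>))"
proof (induction \<beta> rule: eps_induct)
  case (1 \<beta>)
  note good = bspec[OF levels]
  note Ca = ladder_props[OF \<alpha> C]
  have Oa: "Ord \<alpha>" by (rule Ord_below[OF \<alpha>(1)])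
  have \<beta>: "\<beta> \<in> elts \<alpha>" using 1(2) Ca(1) by blast
  have Ob: "Ord \<beta>" by (rule Ord_in_Ord[OF Oa \<beta>])
  have Od: "Ord \<delta>" by (rule Ord_in_Ord[OF Oa x(1)])
  have domx: "vdom x = elts \<delta>" by (rule good_levelD(2)[OF good[OF x(1)] x(2)])
  define G where "G = {\<gamma> \<in> vdom C \<inter> elts \<beta>. elts \<delta> \<subseteq> elts \<gamma>}"
  have trk: "trk C x \<beta> = vset (elts x \<union> (\<Union>\<gamma>\<in>G. elts (wlk C x \<gamma>)))"
    unfolding trunk_def G_def domx ..
  have G: "\<gamma> \<in> elts \<beta>" "\<gamma> \<in> vdom C" "\<gamma> \<in> elts \<alpha>" "Ord \<gamma>" "wlk C x \<gamma> \<in> Lev \<gamma>"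
    "elts x \<subseteq> elts (wlk C x \<gamma>)" "elts \<delta> \<subseteq> elts \<gamma>" if "\<gamma> \<in> G" for \<gamma>
    using that 1(1)[of \<gamma>] Ca(1) Ord_in_Ord[OF Oa] unfolding G_def by blast+
  have mono: "elts (wlk C x \<gamma>) \<subseteq> elts (wlk C x \<gamma>')" if "\<gamma> \<in> G" "\<gamma>' \<in> G" "\<gamma> \<in> elts \<gamma>'" for \<gamma> \<gamma>'
    using 1(1)[of \<gamma>'] that unfolding G_def by blast
  \<comment> \<open>\<epsilon> is the largest element of \<open>G\<close> if there is one, the
    starting level \<delta> if \<open>G\<close> is empty, and \<beta> itself if \<open>G\<close> is
    cofinal in \<beta>.\<close>
  have key: "\<exists>\<epsilon>. (\<epsilon> \<in> elts \<beta> \<or> \<epsilon> = \<beta>) \<and> trk C x \<beta> \<in> Lev \<epsilon> \<and>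
    elts (trk C x \<beta>) = elts x \<union> (\<Union>\<gamma>\<in>G. elts (wlk C x \<gamma>))"
  proof (cases "\<exists>\<gamma>\<in>G. \<forall>\<eta>\<in>G. \<gamma> \<notin> elts \<eta>")
    case True
    then obtain \<gamma> where \<gamma>: "\<gamma> \<in> G" "\<And>\<eta>. \<eta> \<in> G \<Longrightarrow> \<gamma> \<notin> elts \<eta>" by blast
    have "elts (wlk C x \<eta>) \<subseteq> elts (wlk C x \<gamma>)" if "\<eta> \<in> G" for \<eta>
      using mono[OF that \<gamma>(1)] \<gamma>(2)[OF that] Ord_linear[OF G(4)[OF that] G(4)[OF \<gamma>(1)]] by blast
    then have eq: "elts x \<union> (\<Union>\<gamma>\<in>G. elts (wlk C x \<gamma>)) = elts (wlk C x \<gamma>)"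
      using G(6)[OF \<gamma>(1)] \<gamma>(1) by blast
    have "trk C x \<beta> = wlk C x \<gamma>" unfolding trk eq by simp
    then show ?thesis using eq G(1,5)[OF \<gamma>(1)] by auto
  next
    case nomax: False
    show ?thesis
    proof (cases "G = {}")
      case True
      then have "trk C x \<beta> = x" unfolding trk by simp
      moreover have "\<delta> \<in> elts \<beta> \<or> \<delta> = \<beta>" using ole_iff_subset[OF Od Ob] 1(3) unfolding ole_def by blast
      ultimately show ?thesis using x(2) True by auto
    next
      case nonempty: False
      have unb: "\<exists>\<gamma>\<in>G. \<xi> \<in> elts \<gamma>" if \<xi>: "\<xi> \<in> elts \<beta>" for \<xi>
      proof (rule ccontr)
        assume "\<not> ?thesis"
        then have ub: "\<forall>\<gamma>\<in>G. elts \<gamma> \<subseteq> elts \<xi>"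
          using not_mem_iff_subset Ord_in_Ord[OF Ob \<xi>] G(4) by blast
        \<comment> \<open>The supremum of \<open>G\<close>. By closedness of the ladder it would
          belong to \<open>G\<close>, which has no largest element.\<close>
        define s where "s = least_ord (\<lambda>\<xi>. \<forall>\<gamma>\<in>G. elts \<gamma> \<subseteq> elts \<xi>)"
        have s: "Ord s" "\<forall>\<gamma>\<in>G. elts \<gamma> \<subseteq> elts s" "\<And>\<zeta>. \<zeta> \<in> elts s \<Longrightarrow> \<not> (\<forall>\<gamma>\<in>G. elts \<gamma> \<subseteq> elts \<zeta>)"
          "elts s \<subseteq> elts \<xi>"
          using least_ord_props[of \<xi> "\<lambda>\<xi>. \<forall>\<gamma>\<in>G. elts \<gamma> \<subseteq> elts \<xi>", OF Ord_in_Ord[OF Ob \<xi>] ub]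
            least_ord_subset[of \<xi> "\<lambda>\<xi>. \<forall>\<gamma>\<in>G. elts \<gamma> \<subseteq> elts \<xi>", OF Ord_in_Ord[OF Ob \<xi>] ub]
          unfolding s_def by blast+
        have s\<beta>: "s \<in> elts \<beta>" by (rule subset_mem_trans[OF s(1) Ob s(4) \<xi>])
        have Gs: "\<gamma> \<in> elts s" if "\<gamma> \<in> G" for \<gamma> using nomax s(2) that by blast
        have "s \<in> vdom C"
        proof (rule Ca(3))
          show "s \<in> elts \<alpha>" by (rule Ord_trans[OF Oa \<beta> s\<beta>])
          show "s \<noteq> ozero" using Gs nonempty by auto
          fix \<zeta> assume \<zeta>: "\<zeta> \<in> elts s"
          then obtain \<gamma> where "\<gamma> \<in> G" "\<not> elts \<gamma> \<subseteq> elts \<zeta>" using s(3) by blast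
          then show "\<exists>\<gamma>\<in>vdom C \<inter> elts s. \<zeta> \<in> elts \<gamma>"
            using not_mem_iff_subset[OF G(4) Ord_in_Ord[OF s(1) \<zeta>]] G(2) Gs by blast
        qed
        moreover have "elts \<delta> \<subseteq> elts s" using nonempty s(2) G(7) by blast
        ultimately have "s \<in> G" using s\<beta> unfolding G_def by blast
        then show False using Gs mem_irrefl by blast
      qed
      have \<beta>0: "\<beta> \<noteq> ozero" using nonempty G(1) by auto
      have limb: "limit_ord \<beta>" unfolding limit_ord_def using Ob \<beta>0 unb G(1) by blast
      have U: "elts x \<union> (\<Union>\<gamma>\<in>G. elts (wlk C x \<gamma>)) = (\<Union>\<gamma>\<in>G. elts (wlk C x \<gamma>))"
        using nonempty G(6) by blast
      note lu = limit_union[of \<beta> G "wlk C x", OF Ob good[OF Ord_trans[OF Oa \<beta>]] _ unb G(5) mono]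
      have el: "elts (trk C x \<beta>) = (\<Union>\<gamma>\<in>G. elts (wlk C x \<gamma>))" and sq: "trk C x \<beta> \<in> seqs \<beta> (elts \<kappa>)"
        and br: "\<forall>\<eta>\<in>elts \<beta>. vrestrict (trk C x \<beta>) (elts \<eta>) \<in> Lev \<eta>"
        using lu G(1) unfolding trk U by blast+
      have "trk C x \<beta> \<in> Lev \<beta>"
      proof (cases "cf \<beta> \<in> elts \<chi>")
        case True
        then show ?thesis unfolding Lev_limit[OF limb] using sq br by simp
      next
        case False
        have "\<And>\<zeta>. \<zeta> \<in> elts \<beta> \<Longrightarrow> \<exists>\<gamma>\<in>vdom C \<inter> elts \<beta>. \<zeta> \<in> elts \<gamma>"
          using unb unfolding G_def by blast
        from ladder_coherence[OF \<alpha> C 1(2) limb this False]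
        obtain D \<gamma>0 where D: "D \<in> \<C> \<beta>" and \<gamma>0: "\<gamma>0 \<in> elts \<beta>"
          and agree: "\<And>\<eta>. \<eta> \<in> elts \<beta> \<Longrightarrow> \<eta> \<notin> elts \<gamma>0 \<Longrightarrow> (\<eta> \<in> vdom D \<longleftrightarrow> \<eta> \<in> vdom C) \<and> vapp D \<eta> = vapp C \<eta>"
          by blast
        \<comment> \<open>A position past \<gamma>0, where \<open>C\<close> and \<open>D\<close>
          already agree, is the new starting node. The trunk along \<open>C\<close> thereby becomes
          a trunk along a ladder of \<beta>, hence a node.\<close>
        obtain \<gamma> where \<gamma>: "\<gamma> \<in> G" "\<gamma>0 \<in> elts \<gamma>" using unb[OF \<gamma>0] by blast
        define y where "y = wlk C x \<gamma>"
        have "trk D y \<beta> = trk C x \<beta>"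
        proof (rule trunk_coherent[OF Ob G(2,1)[OF \<gamma>(1)] y_def])
          show "vdom y = elts \<gamma>"
            unfolding y_def by (rule good_levelD(2)[OF good[OF G(3)[OF \<gamma>(1)]] G(5)[OF \<gamma>(1)]])
          show "vdom x \<subseteq> elts \<gamma>" unfolding domx by (rule G(7)[OF \<gamma>(1)])
          show "elts x \<subseteq> elts y" unfolding y_def by (rule G(6)[OF \<gamma>(1)])
          show "(\<eta> \<in> vdom D \<longleftrightarrow> \<eta> \<in> vdom C) \<and> vapp D \<eta> = vapp C \<eta>"
            if "\<eta> \<in> elts \<beta>" "\<eta> \<notin> elts \<gamma>" for \<eta>
            using agree[OF that(1)] Ord_trans[OF G(4)[OF \<gamma>(1)] \<gamma>(2)] that(2) by blast
          show "elts (wlk C x \<zeta>) \<subseteq> elts y" if "\<zeta> \<in> vdom C" "\<zeta> \<in> elts \<gamma>" "vdom x \<subseteq> elts \<zeta>" for \<zeta>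
            unfolding y_def
            by (rule mono[OF _ \<gamma>(1) that(2)])
              (use that domx Ord_trans[OF Ob G(1)[OF \<gamma>(1)]] in \<open>auto simp: G_def\<close>)
        qed
        moreover have "y \<in> (\<Union>\<delta>\<in>elts \<beta>. Lev \<delta>)" unfolding y_def using G(1,5)[OF \<gamma>(1)] by blast
        ultimately show ?thesis
          unfolding Lev_limit[OF limb] using D False by (simp, metis)
      qed
      then show ?thesis using el U by auto
    qed
  qed
  then obtain \<epsilon> where \<epsilon>: "\<epsilon> \<in> elts \<beta> \<or> \<epsilon> = \<beta>" "trk C x \<beta> \<in> Lev \<epsilon>"
    "elts (trk C x \<beta>) = elts x \<union> (\<Union>\<gamma>\<in>G. elts (wlk C x \<gamma>))" by blast
  have "wlk C x \<beta> \<in> Lev \<beta> \<and> elts (trk C x \<beta>) \<subseteq> elts (wlk C x \<beta>)"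
  proof (cases "\<epsilon> = \<beta>")
    case True
    then show ?thesis
      unfolding walk_trunk[of _ _ _ _ \<beta>]
      using tstep_same[OF good_levelD(2)[OF good[OF \<beta>], of "trk C x \<beta>"]] \<epsilon>(2) by simp
  next
    case False
    then have "\<epsilon> \<in> elts \<beta>" using \<epsilon>(1) by blast
    then show ?thesis
      unfolding walk_trunk[of _ _ _ _ \<beta>]
      using tstep_above(1,2)[OF good[OF \<beta>] good[OF Ord_trans[OF Oa \<beta>]] \<epsilon>(2)] by blast
  qed
  then show ?case using \<epsilon>(3) unfolding G_def by blast
qed

lemma trunk_limit:
  assumes \<alpha>: "\<alpha> \<in> elts \<kappa>" "limit_ord \<alpha>" and levels: "\<forall>\<beta>\<in>elts \<alpha>. good_level \<beta>"
    and C: "C \<in> \<C> \<alpha>" and x: "\<delta> \<in> elts \<alpha>" "x \<in> Lev \<delta>"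
  shows "trk C x \<alpha> \<in> seqs \<alpha> (elts \<kappa>)"
    "\<And>\<beta>. \<beta> \<in> elts \<alpha> \<Longrightarrow> vrestrict (trk C x \<alpha>) (elts \<beta>) \<in> Lev \<beta>"
    "elts x \<subseteq> elts (trk C x \<alpha>)"
    "\<And>\<beta>. \<beta> \<in> vdom C \<Longrightarrow> elts \<delta> \<subseteq> elts \<beta> \<Longrightarrow> elts (wlk C x \<beta>) \<subseteq> elts (trk C x \<alpha>)"
proof -
  note good = bspec[OF levels]
  note Ca = ladder_props[OF \<alpha> C]
  note wm = walk_main[OF assms]
  have Oa: "Ord \<alpha>" by (rule Ord_below[OF \<alpha>(1)])
  have domx: "vdom x = elts \<delta>" by (rule good_levelD(2)[OF good[OF x(1)] x(2)])
  define G where "G = {\<gamma> \<in> vdom C \<inter> elts \<alpha>. elts \<delta> \<subseteq> elts \<gamma>}"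
  have unb: "\<exists>\<gamma>\<in>G. \<xi> \<in> elts \<gamma>" if "\<xi> \<in> elts \<alpha>" for \<xi>
  proof -
    \<comment> \<open>The maximum of \<delta> and \<xi>, so that any ladder point above it lies in
      \<open>G\<close> and exceeds \<xi>.\<close>
    define \<zeta> where "\<zeta> = (if \<xi> \<in> elts \<delta> then \<delta> else \<xi>)"
    have \<zeta>: "\<zeta> \<in> elts \<alpha>" "elts \<delta> \<subseteq> elts \<zeta>" "\<xi> = \<zeta> \<or> \<xi> \<in> elts \<zeta>"
      using not_mem_iff_subset[OF Ord_in_Ord[OF Oa x(1)] Ord_in_Ord[OF Oa that]] that x(1)
      unfolding \<zeta>_def by auto
    then obtain \<gamma> where \<gamma>: "\<gamma> \<in> vdom C" "\<zeta> \<in> elts \<gamma>" using Ca(2) by blast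
    have "elts \<zeta> \<subseteq> elts \<gamma>" using Ord_mem_subset Ord_in_Ord[OF Oa] \<gamma> Ca(1) by blast
    then have "\<gamma> \<in> G" "\<xi> \<in> elts \<gamma>" using \<zeta> \<gamma> Ca(1) unfolding G_def by auto
    then show ?thesis by blast
  qed
  then have "G \<noteq> {}" using x(1) by blast
  then have U: "elts x \<union> (\<Union>\<gamma>\<in>G. elts (wlk C x \<gamma>)) = (\<Union>\<gamma>\<in>G. elts (wlk C x \<gamma>))"
    using wm unfolding G_def by blast
  have trk: "trk C x \<alpha> = vset (\<Union>\<gamma>\<in>G. elts (wlk C x \<gamma>))"
    unfolding trunk_def domx G_def[symmetric] U ..
  have G: "G \<subseteq> elts \<alpha>" unfolding G_def by blast
  have w: "wlk C x \<gamma> \<in> Lev \<gamma>" if "\<gamma> \<in> G" for \<gamma>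
    using wm[of \<gamma>] that unfolding G_def by blast
  have mono: "elts (wlk C x \<gamma>) \<subseteq> elts (wlk C x \<gamma>')" if "\<gamma> \<in> G" "\<gamma>' \<in> G" "\<gamma> \<in> elts \<gamma>'" for \<gamma> \<gamma>'
    using wm[of \<gamma>'] that unfolding G_def by blast
  note lu = limit_union[of \<alpha> G "wlk C x", OF Oa good G unb w mono]
  show "trk C x \<alpha> \<in> seqs \<alpha> (elts \<kappa>)"
    "\<And>\<beta>. \<beta> \<in> elts \<alpha> \<Longrightarrow> vrestrict (trk C x \<alpha>) (elts \<beta>) \<in> Lev \<beta>"
    unfolding trk using lu(2,3) by blast+
  show "elts x \<subseteq> elts (trk C x \<alpha>)" unfolding trk using lu(1) U by blast
  show "elts (wlk C x \<beta>) \<subseteq> elts (trk C x \<alpha>)" if "\<beta> \<in> vdom C" "elts \<delta> \<subseteq> elts \<beta>" for \<beta>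
    unfolding trk using lu(1) that Ca(1) unfolding G_def by blast
qed

section \<open>Counting the nodes of a level\<close>

text \<open>A branch is determined by its restrictions along a cofinal sequence of length
  cf(\<alpha>) < \<chi>. Numbering the nodes below \<alpha> by ordinals in \<xi> turns it into a
  sequence in \<xi> of length below \<chi>, and \<open>lt_closed\<close> bounds the number of
  those.\<close>

lemma branches_lesspoll:
  assumes \<alpha>: "\<alpha> \<in> elts \<kappa>" "limit_ord \<alpha>" and cf: "cf \<alpha> \<in> elts \<chi>"
    and L: "\<And>\<beta>. \<beta> \<in> elts \<alpha> \<Longrightarrow> L \<beta> \<prec> elts \<kappa>"
  shows "{t \<in> seqs \<alpha> (elts \<kappa>). \<forall>\<beta>\<in>elts \<alpha>. vrestrict t (elts \<beta>) \<in> L \<beta>} \<prec> elts \<kappa>" (is "?Z \<prec> _")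
proof -
  have Oa: "Ord \<alpha>" by (rule Ord_below[OF \<alpha>(1)])
  obtain \<xi> where \<xi>: "\<xi> \<in> elts \<kappa>" "(\<Union>\<beta>\<in>elts \<alpha>. L \<beta>) \<lesssim> elts \<xi>"
    using lesspoll_kappa_below[OF UN_lesspoll_kappa[of "elts \<alpha>" L]] below_kappa_lesspoll[OF \<alpha>(1)] L by blast
  obtain h where h: "inj_on h (\<Union>\<beta>\<in>elts \<alpha>. L \<beta>)" "h ` (\<Union>\<beta>\<in>elts \<alpha>. L \<beta>) \<subseteq> elts \<xi>"
    using \<xi>(2) unfolding lepoll_def by blast
  obtain f where f: "f ` elts (cf \<alpha>) \<subseteq> elts \<alpha>" "\<forall>\<beta>\<in>elts \<alpha>. \<exists>i\<in>elts (cf \<alpha>). ole \<beta> (f i)"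
    using cf_props(2)[OF Oa] unfolding is_cofinal_def by (elim exE conjE)
  define \<Phi> where "\<Phi> t = vset ((\<lambda>i. vpair i (h (vrestrict t (elts (f i))))) ` elts (cf \<alpha>))" for t
  have e\<Phi>: "elts (\<Phi> t) = (\<lambda>i. vpair i (h (vrestrict t (elts (f i))))) ` elts (cf \<alpha>)" for t
    unfolding \<Phi>_def by (rule elts_vset_lepoll[OF image_lepoll])
  have rin: "vrestrict t (elts (f i)) \<in> (\<Union>\<beta>\<in>elts \<alpha>. L \<beta>)" if "t \<in> ?Z" "i \<in> elts (cf \<alpha>)" for t i
    using that f(1) by blast
  have "\<Phi> ` ?Z \<subseteq> (\<Union>\<delta>\<in>elts \<chi>. seqs \<delta> (elts \<xi>))"
  proof
    fix z assume "z \<in> \<Phi> ` ?Z"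
    then obtain t where t: "t \<in> ?Z" "z = \<Phi> t" by blast
    have "(\<lambda>i. h (vrestrict t (elts (f i)))) ` elts (cf \<alpha>) \<subseteq> elts \<xi>"
      using rin[OF t(1)] h(2) by blast
    then have "z \<in> seqs (cf \<alpha>) (elts \<xi>)" unfolding t(2) seqs_iff e\<Phi>
      by (intro exI[of _ "\<lambda>i. h (vrestrict t (elts (f i)))"] conjI) simp_all
    then show "z \<in> (\<Union>\<delta>\<in>elts \<chi>. seqs \<delta> (elts \<xi>))" using cf by blast
  qed
  moreover have "inj_on \<Phi> ?Z"
  proof (rule inj_onI)
    fix t t' assume t: "t \<in> ?Z" and t': "t' \<in> ?Z" and eq: "\<Phi> t = \<Phi> t'"
    have same: "vrestrict t (elts (f i)) = vrestrict t' (elts (f i))" if "i \<in> elts (cf \<alpha>)" for i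
    proof -
      have "vpair i (h (vrestrict t (elts (f i)))) \<in> elts (\<Phi> t')" using that unfolding eq[symmetric] e\<Phi> by blast
      then have "h (vrestrict t (elts (f i))) = h (vrestrict t' (elts (f i)))" unfolding e\<Phi> by auto
      then show ?thesis using inj_onD[OF h(1)] rin[OF t that] rin[OF t' that] by blast
    qed
    have sub: "elts u \<subseteq> (\<Union>i\<in>elts (cf \<alpha>). elts (vrestrict u (elts (f i))))" if "u \<in> ?Z" for u
    proof
      fix q assume q: "q \<in> elts u"
      obtain g where "elts u = (\<lambda>\<xi>. vpair \<xi> (g \<xi>)) ` elts \<alpha>" using \<open>u \<in> ?Z\<close> seqs_iff by auto
      then obtain \<zeta> where \<zeta>: "\<zeta> \<in> elts \<alpha>" "q = vpair \<zeta> (g \<zeta>)" using q by blast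
      then obtain \<eta> where \<eta>: "\<eta> \<in> elts \<alpha>" "\<zeta> \<in> elts \<eta>" using \<alpha>(2) unfolding limit_ord_def by blast
      then obtain i where i: "i \<in> elts (cf \<alpha>)" "ole \<eta> (f i)" using f(2) by blast
      have "Ord (f i)" using f(1) i(1) Ord_in_Ord[OF Oa] by blast
      then have "\<zeta> \<in> elts (f i)" using i(2) \<eta>(2) Ord_trans unfolding ole_def by blast
      then show "q \<in> (\<Union>i\<in>elts (cf \<alpha>). elts (vrestrict u (elts (f i))))"
        using i(1) q \<zeta>(2) unfolding elts_vrestrict by blast
    qed
    have restr: "elts (vrestrict u Y) \<subseteq> elts u" for u :: 'v and Y unfolding elts_vrestrict by blast
    have "elts t \<subseteq> elts t'"
    proof
      fix q assume "q \<in> elts t"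
      then obtain i where "i \<in> elts (cf \<alpha>)" "q \<in> elts (vrestrict t (elts (f i)))" using sub[OF t] by blast
      then show "q \<in> elts t'" using same restr by auto
    qed
    moreover have "elts t' \<subseteq> elts t"
    proof
      fix q assume "q \<in> elts t'"
      then obtain i where "i \<in> elts (cf \<alpha>)" "q \<in> elts (vrestrict t' (elts (f i)))" using sub[OF t'] by blast
      then show "q \<in> elts t" using same[symmetric] restr by auto
    qed
    ultimately show "t = t'" by (intro extensionality) blast
  qed
  ultimately have "?Z \<lesssim> (\<Union>\<delta>\<in>elts \<chi>. seqs \<delta> (elts \<xi>))" unfolding lepoll_def by blast
  also have "(\<Union>\<delta>\<in>elts \<chi>. seqs \<delta> (elts \<xi>)) \<prec> elts \<kappa>" using chi(3) \<xi>(1) unfolding lt_closed_def by blast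
  finally show ?thesis .
qed

lemma ozero_lam: "ozero \<in> elts lam"
proof (rule ozero_mem_Ord)
  show "Ord lam" using lam(1) unfolding Card_def by blast
  show "lam \<noteq> ozero" using lam(2) by auto
qed

lemma splitting_width:
  assumes "\<delta> \<in> elts \<kappa>"
  shows "elts \<delta> \<union> elts \<sigma> \<union> elts lam \<prec> elts \<kappa>" "elts \<delta> \<union> elts \<sigma> \<union> elts lam \<subseteq> elts \<kappa>"
proof -
  show "elts \<delta> \<union> elts \<sigma> \<union> elts lam \<prec> elts \<kappa>"
    by (intro Un_lesspoll_kappa below_kappa_lesspoll assms sigma lam(3))
  show "elts \<delta> \<union> elts \<sigma> \<union> elts lam \<subseteq> elts \<kappa>"
    using Ord_mem_subset[OF Ord_kappa] assms sigma lam(3) by blast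
qed

lemma good_level_osucc:
  assumes \<delta>: "\<delta> \<in> elts \<kappa>" and good: "\<And>\<beta>. \<beta> \<in> elts (osucc \<delta>) \<Longrightarrow> good_level \<beta>"
  shows "good_level (osucc \<delta>)"
proof -
  define W where "W = elts \<delta> \<union> elts \<sigma> \<union> elts lam"
  have W: "W \<prec> elts \<kappa>" "W \<subseteq> elts \<kappa>" using splitting_width[OF \<delta>] unfolding W_def by auto
  have Od: "Ord \<delta>" by (rule Ord_below[OF \<delta>])
  have gd: "good_level \<delta>" using good by simp
  have Lev: "Lev (osucc \<delta>) = {vappend \<delta> t i | t i. t \<in> Lev \<delta> \<and> i \<in> W}"
    unfolding W_def by (rule Lev_osucc[OF Od])
  have app: "vappend \<delta> t i \<in> seqs (osucc \<delta>) (elts \<kappa>)" "vrestrict (vappend \<delta> t i) (elts \<delta>) = t"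
    if "t \<in> Lev \<delta>" "i \<in> W" for t i
    using vappend_seqs(1,2)[OF good_levelD(1)[OF gd that(1)]] that(2) W(2) by blast+
  have "vrestrict u (elts \<beta>) \<in> Lev \<beta>" if "u \<in> Lev (osucc \<delta>)" "\<beta> \<in> elts (osucc \<delta>)" for u \<beta>
  proof -
    obtain t i where ti: "t \<in> Lev \<delta>" "i \<in> W" "u = vappend \<delta> t i" using \<open>u \<in> _\<close> unfolding Lev by blast
    show ?thesis
    proof (cases "\<beta> = \<delta>")
      case True
      then show ?thesis using app(2) ti by simp
    next
      case False
      then have \<beta>: "\<beta> \<in> elts \<delta>" using that(2) by simp
      have "vrestrict u (elts \<beta>) = vrestrict t (elts \<beta>)"
        using vrestrict_vrestrict[OF Ord_mem_subset[OF Od \<beta>], of u] app(2)[OF ti(1,2)] ti(3) by simp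
      then show ?thesis using good_levelD(3)[OF gd ti(1) \<beta>] by simp
    qed
  qed
  moreover have "\<exists>t\<in>Lev (osucc \<delta>). elts s \<subseteq> elts t" if "\<beta> \<in> elts (osucc \<delta>)" "s \<in> Lev \<beta>" for \<beta> s
  proof -
    obtain t where t: "t \<in> Lev \<delta>" "elts s \<subseteq> elts t"
      using good_levelD(4)[OF gd _ \<open>s \<in> Lev \<beta>\<close>] \<open>s \<in> Lev \<beta>\<close> \<open>\<beta> \<in> _\<close> by auto
    have "vappend \<delta> t ozero \<in> Lev (osucc \<delta>)" unfolding Lev W_def using t(1) ozero_lam by blast
    then show ?thesis using t(2) elts_vappend[of \<delta> t ozero] by blast
  qed
  moreover have "Lev (osucc \<delta>) \<prec> elts \<kappa>"
  proof -
    have "Lev (osucc \<delta>) = (\<Union>t\<in>Lev \<delta>. vappend \<delta> t ` W)" unfolding Lev by blast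
    then show ?thesis
      using UN_lesspoll_kappa[OF good_levelD(5)[OF gd] image_lesspoll_kappa[OF W(1)]] by simp
  qed
  moreover have "Lev (osucc \<delta>) \<subseteq> seqs (osucc \<delta>) (elts \<kappa>)" unfolding Lev using app(1) by blast
  ultimately show ?thesis unfolding good_level_def by blast
qed

text \<open>For the size: if all branches are taken, \<open>branches_lesspoll\<close> applies.
  Otherwise a node is given by a ladder and a starting node, and there are fewer than \<kappa> of
  each.\<close>

lemma good_level_limit:
  assumes \<alpha>: "\<alpha> \<in> elts \<kappa>" "limit_ord \<alpha>" and levels: "\<forall>\<beta>\<in>elts \<alpha>. good_level \<beta>"
  shows "good_level \<alpha>"
proof -
  note good = bspec[OF levels]
  note tl = trunk_limit[OF assms]
  have "\<alpha> \<in> acc_pts (elts \<kappa>)" using acc_pts_elts[OF Ord_kappa] \<alpha> by blast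
  then have C\<alpha>: "\<C> \<alpha> \<noteq> {}" "\<C> \<alpha> \<prec> elts \<kappa>" using ladder by blast+
  have trk_in: "trk C x \<alpha> \<in> Lev \<alpha>" if "C \<in> \<C> \<alpha>" "\<delta> \<in> elts \<alpha>" "x \<in> Lev \<delta>" for C x \<delta>
    unfolding Lev_limit[OF \<alpha>(2)] using tl(1,2)[OF that] that by (simp, blast)
  have "t \<in> seqs \<alpha> (elts \<kappa>) \<and> (\<forall>\<beta>\<in>elts \<alpha>. vrestrict t (elts \<beta>) \<in> Lev \<beta>)" if "t \<in> Lev \<alpha>" for t
    using that tl(1,2) unfolding Lev_limit[OF \<alpha>(2)] by (auto split: if_splits)
  moreover have "\<exists>t\<in>Lev \<alpha>. elts s \<subseteq> elts t" if "\<beta> \<in> elts \<alpha>" "s \<in> Lev \<beta>" for \<beta> s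
    using C\<alpha>(1) trk_in[OF _ that] tl(3)[OF _ that] by blast
  moreover have "Lev \<alpha> \<prec> elts \<kappa>"
  proof (cases "cf \<alpha> \<in> elts \<chi>")
    case True
    then show ?thesis
      unfolding Lev_limit[OF \<alpha>(2)] using branches_lesspoll[OF \<alpha> True good_levelD(5)[OF good]] by simp
  next
    case False
    then have "Lev \<alpha> = (\<Union>C\<in>\<C> \<alpha>. (\<lambda>x. trk C x \<alpha>) ` (\<Union>\<delta>\<in>elts \<alpha>. Lev \<delta>))"
      unfolding Lev_limit[OF \<alpha>(2)] by auto
    moreover have "(\<Union>\<delta>\<in>elts \<alpha>. Lev \<delta>) \<prec> elts \<kappa>"
      by (rule UN_lesspoll_kappa[OF below_kappa_lesspoll[OF \<alpha>(1)] good_levelD(5)[OF good]])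
    ultimately show ?thesis
      using UN_lesspoll_kappa[OF C\<alpha>(2) image_lesspoll_kappa] by simp
  qed
  ultimately show ?thesis unfolding good_level_def by blast
qed

lemma good_level: "\<alpha> \<in> elts \<kappa> \<Longrightarrow> good_level \<alpha>"
proof (induction \<alpha> rule: eps_induct)
  case (1 \<alpha>)
  then have good: "\<forall>\<beta>\<in>elts \<alpha>. good_level \<beta>" using Ord_trans[OF Ord_kappa] by blast
  from Ord_below[OF 1(2)] show ?case
  proof (cases \<alpha> rule: Ord_cases)
    case 1
    have "ozero \<in> seqs ozero (elts \<kappa>)" unfolding seqs_iff by simp
    then show ?thesis unfolding good_level_def 1 Lev_ozero by (simp add: finite_lesspoll_kappa)
  next
    case (2 \<delta>)
    then show ?thesis
      using good_level_osucc[of \<delta>] good Ord_trans[OF Ord_kappa \<open>\<alpha> \<in> elts \<kappa>\<close>] by blast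
  next
    case 3
    then show ?thesis using good_level_limit \<open>\<alpha> \<in> elts \<kappa>\<close> good by blast
  qed
qed

end

section \<open>The tree\<close>

context bullet_sequence
begin

definition Tree :: "'v set" where
  "Tree = (\<Union>\<alpha>\<in>elts \<kappa>. Lev \<alpha>)"

definition rk :: "'v \<Rightarrow> 'v" where
  "rk t = vset (vdom t)"

lemma Lev_Tree: "\<alpha> \<in> elts \<kappa> \<Longrightarrow> t \<in> Lev \<alpha> \<Longrightarrow> t \<in> Tree"
  unfolding Tree_def by blast

lemma rk_Lev: "\<alpha> \<in> elts \<kappa> \<Longrightarrow> t \<in> Lev \<alpha> \<Longrightarrow> rk t = \<alpha>"
  unfolding rk_def using good_levelD(2)[OF good_level] by simp

lemma Tree_rk:
  assumes "t \<in> Tree"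
  shows "rk t \<in> elts \<kappa>" "t \<in> Lev (rk t)" "t \<in> seqs (rk t) (elts \<kappa>)" "vdom t = elts (rk t)"
proof -
  obtain \<alpha> where \<alpha>: "\<alpha> \<in> elts \<kappa>" "t \<in> Lev \<alpha>" using assms unfolding Tree_def by blast
  note good_levelD[OF good_level[OF \<alpha>(1)]]
  then show "rk t \<in> elts \<kappa>" "t \<in> Lev (rk t)" "t \<in> seqs (rk t) (elts \<kappa>)" "vdom t = elts (rk t)"
    unfolding rk_Lev[OF \<alpha>] using \<alpha> by blast+
qed

lemma level_Tree: "\<alpha> \<in> elts \<kappa> \<Longrightarrow> level Tree \<alpha> = Lev \<alpha>"
proof (intro equalityI subsetI)
  fix t assume "\<alpha> \<in> elts \<kappa>" "t \<in> level Tree \<alpha>"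
  then have t: "t \<in> Tree" "vdom t = elts \<alpha>" unfolding level_def by auto
  then have "rk t = \<alpha>" unfolding rk_def by simp
  then show "t \<in> Lev \<alpha>" using Tree_rk(2)[OF t(1)] by simp
next
  fix t assume "\<alpha> \<in> elts \<kappa>" "t \<in> Lev \<alpha>"
  then show "t \<in> level Tree \<alpha>"
    unfolding level_def using good_levelD(2)[OF good_level] Lev_Tree by blast
qed

lemma Tree_subset_rk:
  assumes "s \<in> Tree" "t \<in> Tree" "elts s \<subseteq> elts t"
  shows "elts (rk s) \<subseteq> elts (rk t)" "s = vrestrict t (elts (rk s))"
  using vdom_mono[OF assms(3)] Tree_rk(4) assms(1,2)
    seqs_subset_eq_vrestrict[OF Tree_rk(3)[OF assms(1)] Tree_rk(3)[OF assms(2)] assms(3)] by auto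

lemma Tree_comparable:
  assumes "s \<in> Tree" "s' \<in> Tree" "t \<in> Tree" "elts s \<subseteq> elts t" "elts s' \<subseteq> elts t"
    "elts (rk s) \<subseteq> elts (rk s')"
  shows "elts s \<subseteq> elts s'"
  by (rule seqs_comparable[OF Tree_rk(3)[OF assms(1)] Tree_rk(3)[OF assms(2)] Tree_rk(3)[OF assms(3)] assms(4-6)])

lemma tlessI:
  assumes "s \<in> Tree" "t \<in> Tree" "elts s \<subseteq> elts t" "rk s \<in> elts (rk t)"
  shows "tless s t"
  unfolding tless_def using assms mem_irrefl by (metis extensionality psubsetI)

lemma vrestrict_Lev:
  assumes "t \<in> Tree" "elts \<beta> \<subseteq> elts (rk t)" "\<beta> \<in> elts \<kappa>"
  shows "vrestrict t (elts \<beta>) \<in> Lev \<beta>" "elts (vrestrict t (elts \<beta>)) \<subseteq> elts t"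
proof -
  show "elts (vrestrict t (elts \<beta>)) \<subseteq> elts t" unfolding elts_vrestrict by blast
  show "vrestrict t (elts \<beta>) \<in> Lev \<beta>"
  proof (cases "\<beta> = rk t")
    case True
    then show ?thesis using vrestrict_self[OF Tree_rk(3)[OF assms(1)]] Tree_rk(2)[OF assms(1)] by simp
  next
    case False
    then have "\<beta> \<in> elts (rk t)"
      using ole_iff_subset[OF Ord_below Ord_below] Tree_rk(1)[OF assms(1)] assms(2,3) unfolding ole_def by blast
    then show ?thesis
      using good_levelD(3)[OF good_level[OF Tree_rk(1)[OF assms(1)]] Tree_rk(2)[OF assms(1)]] by blast
  qed
qed

lemma Tree_vappend:
  assumes "\<alpha> \<in> elts \<kappa>" "t \<in> Lev \<alpha>" "i \<in> elts \<alpha> \<union> elts \<sigma> \<union> elts lam"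
  shows "vappend \<alpha> t i \<in> Lev (osucc \<alpha>)"
  unfolding Lev_osucc[OF Ord_below[OF assms(1)]] using assms by blast

lemma Lev_nonempty: "\<alpha> \<in> elts \<kappa> \<Longrightarrow> Lev \<alpha> \<noteq> {}"
  using good_levelD(4)[OF good_level, of \<alpha> ozero ozero] Lev_ozero ozero_mem_Ord[OF Ord_below]
  by (cases "\<alpha> = ozero") blast+

lemma streamlined_Tree: "streamlined_tree \<kappa> Tree"
  unfolding streamlined_tree_def
proof (intro conjI ballI)
  have "seqs \<alpha> (elts \<kappa>) \<subseteq> seqs \<alpha> (Hset \<kappa>)" for \<alpha>
    using below_Hset unfolding seqs_def by blast
  then show "Tree \<subseteq> (\<Union>\<alpha>\<in>elts \<kappa>. seqs \<alpha> (Hset \<kappa>))" using Tree_rk(1,3) by blast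
  fix t \<beta> assume t: "t \<in> Tree" and "\<beta> \<in> vdom t"
  then have "\<beta> \<in> elts (rk t)" using Tree_rk(4) by blast
  moreover have "\<beta> \<in> elts \<kappa>" using Ord_trans[OF Ord_kappa Tree_rk(1)[OF t]] calculation by blast
  ultimately show "vrestrict t (elts \<beta>) \<in> Tree"
    using vrestrict_Lev[OF t Ord_mem_subset[OF Ord_below[OF Tree_rk(1)[OF t]]]] Lev_Tree by blast
qed

lemma height_Tree: "height Tree = \<kappa>"
  unfolding height_def
proof (rule least_ord_eqI[OF Ord_kappa])
  show "level Tree \<kappa> = {}"
  proof (rule ccontr)
    assume "level Tree \<kappa> \<noteq> {}"
    then obtain t where "t \<in> Tree" "vdom t = elts \<kappa>" unfolding level_def by blast
    then have "\<kappa> \<in> elts \<kappa>" using Tree_rk(1)[of t] by (simp add: rk_def)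
    then show False by simp
  qed
  show "level Tree \<beta> \<noteq> {}" if "\<beta> \<in> elts \<kappa>" for \<beta>
    using Lev_nonempty level_Tree that by simp
qed

lemma normal_Tree: "normal_tree \<kappa> Tree"
  unfolding normal_tree_def
proof (intro ballI impI)
  fix \<beta> \<alpha> s assume \<beta>: "\<beta> \<in> elts \<kappa>" and \<alpha>: "\<alpha> \<in> elts \<beta>" and s: "s \<in> level Tree \<alpha>"
  have \<alpha>\<kappa>: "\<alpha> \<in> elts \<kappa>" by (rule Ord_trans[OF Ord_kappa \<beta> \<alpha>])
  have s': "s \<in> Lev \<alpha>" using s level_Tree[OF \<alpha>\<kappa>] by simp
  obtain t where t: "t \<in> Lev \<beta>" "elts s \<subseteq> elts t" using good_levelD(4)[OF good_level[OF \<beta>] \<alpha> s'] by blast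
  have "tless s t"
    by (rule tlessI) (use t s' \<alpha> \<beta> \<alpha>\<kappa> Lev_Tree rk_Lev in auto)
  then show "\<exists>t\<in>level Tree \<beta>. tless s t" using t(1) level_Tree[OF \<beta>] by blast
qed

lemma omega_subset_lam: "elts omega \<subseteq> elts lam"
  unfolding omega_def using lam(1,2) least_ord_subset[of lam "\<lambda>\<alpha>. infinite (elts \<alpha>)"]
  unfolding Card_def by blast

lemma prolific_Tree: "prolific_tree \<kappa> Tree"
  unfolding prolific_tree_def
proof (intro ballI)
  fix \<alpha> t i assume \<alpha>: "\<alpha> \<in> elts \<kappa>" and t: "t \<in> level Tree \<alpha>" and i: "i \<in> elts omega \<union> elts \<alpha>"
  have "vappend \<alpha> t i \<in> Lev (osucc \<alpha>)"
    using Tree_vappend[OF \<alpha>] t level_Tree[OF \<alpha>] i omega_subset_lam by blast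
  then show "vset (insert (vpair \<alpha> i) (elts t)) \<in> level Tree (osucc \<alpha>)"
    using level_Tree[OF osucc_below[OF \<alpha>]] unfolding vappend_def by simp
qed

lemma splitting_Tree: "splitting_tree \<sigma> Tree"
  unfolding splitting_tree_def
proof
  fix t assume t: "t \<in> Tree"
  define \<alpha> where "\<alpha> = rk t"
  have \<alpha>: "\<alpha> \<in> elts \<kappa>" "t \<in> Lev \<alpha>" "t \<in> seqs \<alpha> (elts \<kappa>)" using Tree_rk[OF t] unfolding \<alpha>_def by auto
  have "vappend \<alpha> t i \<in> imm_succs Tree t" if "i \<in> elts \<sigma>" for i
  proof -
    have "vappend \<alpha> t i \<in> Tree"
      using Tree_vappend[OF \<alpha>(1,2)] that Lev_Tree[OF osucc_below[OF \<alpha>(1)]] by blast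
    moreover have "vpair \<alpha> i \<notin> elts t"
      using vappend_seqs(3)[OF \<alpha>(3) ozero_below] by blast
    ultimately show ?thesis
      unfolding imm_succs_def tless_def mem_Collect_eq elts_vappend by blast
  qed
  moreover have "inj_on (vappend \<alpha> t) (elts \<sigma>)" using vappend_inject[OF \<alpha>(3)] by (intro inj_onI)
  ultimately show "elts \<sigma> \<lesssim> imm_succs Tree t" unfolding lepoll_def by blast
qed

text \<open>An increasing sequence of length \<delta> < \<chi> without a last node has lengths
  cofinal in some limit \<alpha>, so cf(\<alpha>) < \<chi>, and at such \<alpha> every branch is a
  node.\<close>

lemma complete_Tree: "complete_tree \<chi> Tree"
  unfolding complete_tree_def
proof (intro ballI allI impI, elim conjE)
  fix \<delta> and t :: "'v \<Rightarrow> 'v"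
  assume \<delta>: "\<delta> \<in> elts \<chi>" and tT: "\<forall>i\<in>elts \<delta>. t i \<in> Tree"
    and incr: "\<forall>j\<in>elts \<delta>. \<forall>i\<in>elts j. tless (t i) (t j)"
  have \<delta>\<kappa>: "\<delta> \<in> elts \<kappa>" by (rule Ord_trans[OF Ord_kappa chi(2) \<delta>])
  have Od: "Ord \<delta>" by (rule Ord_below[OF \<delta>\<kappa>])
  show "vset (\<Union>i\<in>elts \<delta>. elts (t i)) \<in> Tree"
  proof (cases "\<exists>i\<in>elts \<delta>. \<forall>j\<in>elts \<delta>. elts (t j) \<subseteq> elts (t i)")
    case True
    then obtain i where i: "i \<in> elts \<delta>" "\<forall>j\<in>elts \<delta>. elts (t j) \<subseteq> elts (t i)" by blast
    then have "(\<Union>i\<in>elts \<delta>. elts (t i)) = elts (t i)" by blast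
    then show ?thesis using i tT by simp
  next
    case nomax: False
    show ?thesis
    proof (cases "\<delta> = ozero")
      case True
      then have "vset (\<Union>i\<in>elts \<delta>. elts (t i)) = ozero" by (simp add: ozero_def[symmetric])
      then show ?thesis using Lev_Tree[OF ozero_below] Lev_ozero by simp
    next
      case \<delta>0: False
      define r where "r i = rk (t i)" for i
      have r: "r i \<in> elts \<kappa>" "t i \<in> Lev (r i)" "vdom (t i) = elts (r i)" "Ord (r i)" if "i \<in> elts \<delta>" for i
        using Tree_rk[of "t i"] tT that Ord_below unfolding r_def by blast+
      have mono: "elts (t i) \<subseteq> elts (t j) \<and> r i \<in> elts (r j)" if "i \<in> elts j" "j \<in> elts \<delta>" for i j
      proof -
        have i: "i \<in> elts \<delta>" by (rule Ord_trans[OF Od that(2,1)])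
        have less: "elts (t i) \<subset> elts (t j)" using incr that unfolding tless_def by blast
        then have "elts (r i) \<subseteq> elts (r j)" using vdom_mono r(3) i that(2) by blast
        moreover have "r i \<noteq> r j"
        proof
          assume "r i = r j"
          then have "t i = t j"
            using Tree_subset_rk(2)[of "t i" "t j"] less tT i that(2) vrestrict_self[OF Tree_rk(3)[of "t j"]]
            unfolding r_def by auto
          then show False using less by simp
        qed
        ultimately show ?thesis
          using ole_iff_subset[OF r(4)[OF i] r(4)[OF that(2)]] less unfolding ole_def by blast
      qed
      have next_ex: "\<exists>j\<in>elts \<delta>. i \<in> elts j" if i: "i \<in> elts \<delta>" for i
      proof -
        obtain j where j: "j \<in> elts \<delta>" "\<not> elts (t j) \<subseteq> elts (t i)" using nomax i by blast
        then show ?thesis using Ord_linear[of i j] Ord_in_Ord[OF Od] mono[of j i] i by blast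
      qed
      obtain \<zeta> where \<zeta>: "\<zeta> \<in> elts \<kappa>" "\<forall>i\<in>elts \<delta>. r i \<in> elts \<zeta>"
        using lesspoll_kappa_bounded[OF below_kappa_lesspoll[OF \<delta>\<kappa>], of r] r(1) by blast
      \<comment> \<open>The least strict upper bound of the lengths; the lengths are cofinal in it
        because every index has a later one.\<close>
      define \<alpha> where "\<alpha> = least_ord (\<lambda>\<alpha>. \<forall>i\<in>elts \<delta>. r i \<in> elts \<alpha>)"
      have \<alpha>: "Ord \<alpha>" "\<forall>i\<in>elts \<delta>. r i \<in> elts \<alpha>" "\<And>\<xi>. \<xi> \<in> elts \<alpha> \<Longrightarrow> \<not> (\<forall>i\<in>elts \<delta>. r i \<in> elts \<xi>)"
        "elts \<alpha> \<subseteq> elts \<zeta>"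
        using least_ord_props[of \<zeta> "\<lambda>\<alpha>. \<forall>i\<in>elts \<delta>. r i \<in> elts \<alpha>", OF Ord_below[OF \<zeta>(1)] \<zeta>(2)]
          least_ord_subset[of \<zeta> "\<lambda>\<alpha>. \<forall>i\<in>elts \<delta>. r i \<in> elts \<alpha>", OF Ord_below[OF \<zeta>(1)] \<zeta>(2)]
        unfolding \<alpha>_def by blast+
      have \<alpha>\<kappa>: "\<alpha> \<in> elts \<kappa>" by (rule subset_mem_trans[OF \<alpha>(1) Ord_kappa \<alpha>(4) \<zeta>(1)])
      have unb: "\<exists>i\<in>elts \<delta>. \<xi> \<in> elts (r i)" if \<xi>: "\<xi> \<in> elts \<alpha>" for \<xi>
      proof -
        have Ox: "Ord \<xi>" by (rule Ord_in_Ord[OF \<alpha>(1) \<xi>])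
        obtain i where i: "i \<in> elts \<delta>" "r i \<notin> elts \<xi>" using \<alpha>(3)[OF \<xi>] by blast
        obtain j where j: "j \<in> elts \<delta>" "i \<in> elts j" using next_ex[OF i(1)] by blast
        have "elts \<xi> \<subseteq> elts (r i)" using not_mem_iff_subset[OF Ox r(4)[OF i(1)]] i(2) by blast
        then have "\<xi> \<in> elts (r j)"
          using subset_mem_trans[OF Ox r(4)[OF j(1)]] mono[OF j(2,1)] by blast
        then show ?thesis using j(1) by blast
      qed
      have \<alpha>0: "\<alpha> \<noteq> ozero" using \<alpha>(2) ozero_mem_Ord[OF Od \<delta>0] by auto
      have lim: "limit_ord \<alpha>" unfolding limit_ord_def using \<alpha>(1,2) \<alpha>0 unb by blast
      have "is_cofinal \<alpha> \<delta>"
        unfolding is_cofinal_def using \<alpha>(2) unb by (intro exI[of _ r]) (auto simp: ole_def)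
      then have "cf \<alpha> \<in> elts \<chi>"
        using subset_mem_trans[OF cf_props(1)[OF \<alpha>(1)] Ord_chi cf_subset[OF \<alpha>(1) Od] \<delta>] by blast
      \<comment> \<open>\<open>limit_union\<close> expects nodes indexed by their own levels, so the
        sequence is reindexed by length.\<close>
      define w where "w \<gamma> = t (inv_into (elts \<delta>) r \<gamma>)" for \<gamma>
      have "inj_on r (elts \<delta>)"
        by (rule inj_onI) (metis Od Ord_in_Ord Ord_linear mem_irrefl mono)
      then have w: "w (r i) = t i" if "i \<in> elts \<delta>" for i using that unfolding w_def by simp
      have U: "(\<Union>\<gamma>\<in>r ` elts \<delta>. elts (w \<gamma>)) = (\<Union>i\<in>elts \<delta>. elts (t i))" using w by simp
      have "vset (\<Union>i\<in>elts \<delta>. elts (t i)) \<in> seqs \<alpha> (elts \<kappa>)"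
        "\<forall>\<beta>\<in>elts \<alpha>. vrestrict (vset (\<Union>i\<in>elts \<delta>. elts (t i))) (elts \<beta>) \<in> Lev \<beta>"
      proof -
        have f1: "\<beta> \<in> elts \<alpha> \<Longrightarrow> good_level \<beta>" for \<beta> using good_level Ord_trans[OF Ord_kappa \<alpha>\<kappa>] by blast
        have f2: "r ` elts \<delta> \<subseteq> elts \<alpha>" using \<alpha>(2) by blast
        have f3: "\<xi> \<in> elts \<alpha> \<Longrightarrow> \<exists>\<gamma>\<in>r ` elts \<delta>. \<xi> \<in> elts \<gamma>" for \<xi> using unb by blast
        have f4: "\<gamma> \<in> r ` elts \<delta> \<Longrightarrow> w \<gamma> \<in> Lev \<gamma>" for \<gamma> using w r(2) by auto
        have f5: "\<gamma> \<in> r ` elts \<delta> \<Longrightarrow> \<gamma>' \<in> r ` elts \<delta> \<Longrightarrow> \<gamma> \<in> elts \<gamma>' \<Longrightarrow> elts (w \<gamma>) \<subseteq> elts (w \<gamma>')" for \<gamma> \<gamma>'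
        proof -
          assume "\<gamma> \<in> r ` elts \<delta>" "\<gamma>' \<in> r ` elts \<delta>" and less: "\<gamma> \<in> elts \<gamma>'"
          then obtain i j where ij: "i \<in> elts \<delta>" "j \<in> elts \<delta>" "\<gamma> = r i" "\<gamma>' = r j" by blast
          have "i \<in> elts j"
            using Ord_linear[of i j] Ord_in_Ord[OF Od] ij less mono[of j i] mem_asym mem_irrefl by blast
          then show "elts (w \<gamma>) \<subseteq> elts (w \<gamma>')" using mono ij w by simp
        qed
        note lu = limit_union[of \<alpha> "r ` elts \<delta>" w, OF \<alpha>(1) f1 f2 f3 f4 f5]
        show "vset (\<Union>i\<in>elts \<delta>. elts (t i)) \<in> seqs \<alpha> (elts \<kappa>)"
          using lu(2) unfolding U .
        show "\<forall>\<beta>\<in>elts \<alpha>. vrestrict (vset (\<Union>i\<in>elts \<delta>. elts (t i))) (elts \<beta>) \<in> Lev \<beta>"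
          using lu(3) unfolding U by blast
      qed
      then have "vset (\<Union>i\<in>elts \<delta>. elts (t i)) \<in> Lev \<alpha>"
        unfolding Lev_limit[OF lim] using \<open>cf \<alpha> \<in> elts \<chi>\<close> by simp
      then show ?thesis by (rule Lev_Tree[OF \<alpha>\<kappa>])
    qed
  qed
qed

end

section \<open>Antichains and ascending paths\<close>

context bullet_sequence
begin

section \<open>Guessing sets of nodes between consecutive ladder points\<close>

text \<open>The outcome of \<open>guess\<close> in the form used below. The clause on \<eta> says
  that \<gamma> is the ladder point just before \<beta>, and \<delta> < \<gamma> that such pairs
  occur arbitrarily high in \<alpha>.\<close>

definition guessed :: "'v \<Rightarrow> 'v \<Rightarrow> ('v \<Rightarrow> 'v set \<Rightarrow> bool) \<Rightarrow> bool" where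
  "guessed \<iota> \<Lambda> P \<longleftrightarrow> (\<exists>\<alpha> C. \<alpha> \<in> elts \<kappa> \<and> limit_ord \<alpha> \<and> cf \<alpha> \<notin> elts \<chi> \<and> \<Lambda> \<in> elts (cf \<alpha>) \<and> \<C> \<alpha> = {C} \<and>
    (\<forall>\<delta>\<in>elts \<alpha>. \<exists>\<gamma>\<in>vdom C. \<exists>\<beta>\<in>vdom C. \<delta> \<in> elts \<gamma> \<and> \<gamma> \<in> elts \<beta> \<and>
      (\<forall>\<eta>\<in>vdom C \<inter> elts \<beta>. elts \<eta> \<subseteq> elts \<gamma>) \<and> \<beta> \<in> B \<iota> \<and> \<beta> \<in> elts \<kappa> \<and> P \<beta> (elts (vapp C \<beta>))))"

lemma guessed_mono:
  assumes "guessed \<iota> \<Lambda> P" "\<And>\<beta> c. \<beta> \<in> elts \<kappa> \<Longrightarrow> P \<beta> c \<Longrightarrow> Q \<beta> c"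
  shows "guessed \<iota> \<Lambda> Q"
proof -
  obtain \<alpha> C where \<alpha>: "\<alpha> \<in> elts \<kappa>" "limit_ord \<alpha>" "cf \<alpha> \<notin> elts \<chi>" "\<Lambda> \<in> elts (cf \<alpha>)" "\<C> \<alpha> = {C}"
    and P: "\<forall>\<delta>\<in>elts \<alpha>. \<exists>\<gamma>\<in>vdom C. \<exists>\<beta>\<in>vdom C. \<delta> \<in> elts \<gamma> \<and> \<gamma> \<in> elts \<beta> \<and>
      (\<forall>\<eta>\<in>vdom C \<inter> elts \<beta>. elts \<eta> \<subseteq> elts \<gamma>) \<and> \<beta> \<in> B \<iota> \<and> \<beta> \<in> elts \<kappa> \<and> P \<beta> (elts (vapp C \<beta>))"
    using assms(1) unfolding guessed_def by (elim exE conjE)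
  have "\<forall>\<delta>\<in>elts \<alpha>. \<exists>\<gamma>\<in>vdom C. \<exists>\<beta>\<in>vdom C. \<delta> \<in> elts \<gamma> \<and> \<gamma> \<in> elts \<beta> \<and>
      (\<forall>\<eta>\<in>vdom C \<inter> elts \<beta>. elts \<eta> \<subseteq> elts \<gamma>) \<and> \<beta> \<in> B \<iota> \<and> \<beta> \<in> elts \<kappa> \<and> Q \<beta> (elts (vapp C \<beta>))"
  proof
    fix \<delta> assume "\<delta> \<in> elts \<alpha>"
    from bspec[OF P this] obtain \<gamma> \<beta> where "\<gamma> \<in> vdom C" "\<beta> \<in> vdom C" "\<delta> \<in> elts \<gamma>" "\<gamma> \<in> elts \<beta>"
      "\<forall>\<eta>\<in>vdom C \<inter> elts \<beta>. elts \<eta> \<subseteq> elts \<gamma>" "\<beta> \<in> B \<iota>" "\<beta> \<in> elts \<kappa>" "P \<beta> (elts (vapp C \<beta>))"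
      by (elim bexE conjE)
    then show "\<exists>\<gamma>\<in>vdom C. \<exists>\<beta>\<in>vdom C. \<delta> \<in> elts \<gamma> \<and> \<gamma> \<in> elts \<beta> \<and>
      (\<forall>\<eta>\<in>vdom C \<inter> elts \<beta>. elts \<eta> \<subseteq> elts \<gamma>) \<and> \<beta> \<in> B \<iota> \<and> \<beta> \<in> elts \<kappa> \<and> Q \<beta> (elts (vapp C \<beta>))"
      using assms(2) by (intro bexI conjI)
  qed
  with \<alpha> show ?thesis unfolding guessed_def by (intro exI conjI)
qed

text \<open>The parameter \<open>triples F e\<close> codes both functions. The guessing model meets
  \<kappa> in \<beta>, so its closure under \<open>F\<close>, \<open>e\<close> and the inverse of
  \<open>e\<close> makes \<beta> closed under \<open>F\<close> and identifies its trace on \<Omega>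
  with the elements enumerated below \<beta>.\<close>

lemma guess_point:
  assumes \<Omega>: "\<Omega> \<subseteq> e ` elts \<kappa>" and \<iota>: "\<iota> \<in> elts \<kappa>" and \<Lambda>: "\<Lambda> \<in> elts lam"
    and F: "\<And>\<xi>. \<xi> \<in> elts \<kappa> \<Longrightarrow> F \<xi> \<in> elts \<kappa> \<and> \<xi> \<in> elts (F \<xi>)"
    and e: "\<And>\<xi>. \<xi> \<in> elts \<kappa> \<Longrightarrow> e \<xi> \<in> Hset \<kappa>" "\<And>\<xi>. \<xi> \<in> elts \<kappa> \<Longrightarrow> \<not> Ord (e \<xi>)"
      "\<And>\<xi> x. \<xi> \<in> elts \<kappa> \<Longrightarrow> x \<in> elts (e \<xi>) \<Longrightarrow> \<not> Ord x"
  shows "guessed \<iota> \<Lambda> (\<lambda>\<beta> c. (\<forall>\<xi>\<in>elts \<beta>. F \<xi> \<in> elts \<beta>) \<and> c = \<Omega> \<inter> e ` elts \<beta>)"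
proof -
  define p where "p = triples F e"
  have \<Omega>H: "\<Omega> \<subseteq> Hset \<kappa>" using \<Omega> e(1) by blast
  have p: "p \<in> Hset_plus \<kappa>" unfolding p_def by (rule triples_Hset_plus) (use F e(1) in auto)
  obtain \<alpha> where E: "\<alpha> \<in> E_ge \<kappa> \<chi>" "\<alpha> \<in> E_gt \<kappa> \<Lambda>" and small: "\<C> \<alpha> \<prec> elts (osucc (osucc (ozero::'v)))"
    and sup: "\<forall>C\<in>\<C> \<alpha>. \<forall>i\<in>elts \<alpha> \<inter> elts (osucc ozero).
          osup {\<gamma> \<in> vdom C. succ_n (osucc ozero) (vdom C - elts \<gamma>) \<subseteq> guess_set \<kappa> (B \<iota>) \<Omega> p C} = \<alpha>"
    using guess[OF \<Omega>H p \<iota> \<Lambda>] club_in_kappa unfolding stationary_in_def by blast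
  have \<alpha>: "\<alpha> \<in> elts \<kappa>" "\<Lambda> \<in> elts (cf \<alpha>)" "ole \<chi> (cf \<alpha>)"
    using E unfolding E_ge_def E_gt_def by auto
  have Oa: "Ord \<alpha>" by (rule Ord_below[OF \<alpha>(1)])
  have Ocf: "Ord (cf \<alpha>)" by (rule cf_props(1)[OF Oa])
  have cf: "cf \<alpha> \<notin> elts \<chi>" using not_ole_iff[OF Ord_chi Ocf] \<alpha>(3) by blast
  have "elts \<chi> \<subseteq> elts (cf \<alpha>)" using ole_iff_subset[OF Ord_chi Ocf] \<alpha>(3) by blast
  then have "infinite (elts (cf \<alpha>))" using infinite_chi finite_subset by blast
  then have lim: "limit_ord \<alpha>" by (rule limit_ord_if_infinite_cf[OF Oa])
  then have \<alpha>0: "\<alpha> \<noteq> ozero" unfolding limit_ord_def by blast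
  have ne: "\<C> \<alpha> \<noteq> {}" using ladder acc_pts_elts[OF Ord_kappa] \<alpha>(1) lim by blast
  have "osucc (ozero::'v) \<noteq> ozero" using elts_osucc[of ozero] by (metis elts_ozero insert_not_empty)
  then have "elts (osucc (osucc (ozero::'v))) \<approx> {..<2::nat}"
    unfolding eqpoll_iff_finite_card by simp
  then have "finite (\<C> \<alpha>)" "card (\<C> \<alpha>) < 2"
    using lesspoll_eq_trans[OF small] lesspoll_iff_finite_card by blast+
  then have "card (\<C> \<alpha>) = 1" using ne by (metis One_nat_def Suc_1 card_eq_0_iff less_2_cases)
  then obtain C where C: "\<C> \<alpha> = {C}" by (rule card_1_singletonE)
  then have Cin: "C \<in> \<C> \<alpha>" by simp
  note Ca = ladder_props[OF \<alpha>(1) lim Cin]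
  define X where "X = {\<gamma> \<in> vdom C. succ_n (osucc ozero) (vdom C - elts \<gamma>) \<subseteq> guess_set \<kappa> (B \<iota>) \<Omega> p C}"
  \<comment> \<open>Index 0 lies in \<alpha> because \<alpha> is nonzero, so the clause over i <
    min(\<alpha>, \<theta>) is not vacuous.\<close>
  have "osup X = \<alpha>" using sup Cin ozero_mem_Ord[OF Oa \<alpha>0] unfolding X_def by auto
  then have X: "\<exists>\<gamma>\<in>X. \<delta> \<in> elts \<gamma>" if "\<delta> \<in> elts \<alpha>" for \<delta>
    using osup_eq_iff[OF Oa, of X] Ca(1) that unfolding X_def by blast
  have "\<exists>\<gamma>\<in>vdom C. \<exists>\<beta>\<in>vdom C. \<delta> \<in> elts \<gamma> \<and> \<gamma> \<in> elts \<beta> \<and>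
      (\<forall>\<eta>\<in>vdom C \<inter> elts \<beta>. elts \<eta> \<subseteq> elts \<gamma>) \<and> \<beta> \<in> B \<iota> \<and> \<beta> \<in> elts \<kappa> \<and> (\<forall>\<xi>\<in>elts \<beta>. F \<xi> \<in> elts \<beta>) \<and>
      elts (vapp C \<beta>) = \<Omega> \<inter> e ` elts \<beta>" if \<delta>: "\<delta> \<in> elts \<alpha>" for \<delta>
  proof -
    obtain \<gamma> where \<gamma>: "\<gamma> \<in> vdom C" "\<delta> \<in> elts \<gamma>"
      and sub: "succ_n (osucc ozero) (vdom C - elts \<gamma>) \<subseteq> guess_set \<kappa> (B \<iota>) \<Omega> p C"
      using X[OF \<delta>] unfolding X_def by blast
    have \<gamma>\<alpha>: "\<gamma> \<in> elts \<alpha>" using \<gamma> Ca(1) by blast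
    have Og: "Ord \<gamma>" by (rule Ord_in_Ord[OF Oa \<gamma>\<alpha>])
    obtain \<eta> where \<eta>: "\<eta> \<in> vdom C \<and> \<gamma> \<in> elts \<eta>" using Ca(2)[OF \<gamma>\<alpha>] by blast
    have On: "Ord \<eta>" using \<eta> Ca(1) Ord_in_Ord[OF Oa] by blast
    define \<beta> where "\<beta> = least_ord (\<lambda>\<eta>. \<eta> \<in> vdom C \<and> \<gamma> \<in> elts \<eta>)"
    have \<beta>: "Ord \<beta>" "\<beta> \<in> vdom C" "\<gamma> \<in> elts \<beta>" "\<And>\<eta>. \<eta> \<in> elts \<beta> \<Longrightarrow> \<eta> \<in> vdom C \<Longrightarrow> \<gamma> \<notin> elts \<eta>"
      using least_ord_props[of \<eta> "\<lambda>\<eta>. \<eta> \<in> vdom C \<and> \<gamma> \<in> elts \<eta>", OF On \<eta>] unfolding \<beta>_def by blast+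
    have \<beta>\<kappa>: "\<beta> \<in> elts \<kappa>" using \<beta>(2) Ca(1) Ord_trans[OF Ord_kappa \<alpha>(1)] by blast
    have nxt: "\<forall>\<eta>\<in>vdom C \<inter> elts \<beta>. elts \<eta> \<subseteq> elts \<gamma>"
      using \<beta>(4) not_mem_iff_subset[OF Ord_in_Ord[OF \<beta>(1)] Og] by blast
    have "\<beta> \<in> succ_n (osucc ozero) (vdom C - elts \<gamma>)"
    proof (rule succ_one_mem[OF _ Oa])
      show "vdom C - elts \<gamma> \<subseteq> elts \<alpha>" using Ca(1) by blast
      show "\<gamma> \<in> vdom C - elts \<gamma>" using \<gamma> by simp
      show "\<beta> \<in> vdom C - elts \<gamma>" using \<beta>(2,3) mem_asym by blast
      show "\<gamma> \<in> elts \<beta>" by (rule \<beta>(3))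
      show "\<eta> = \<gamma>" if "\<eta> \<in> vdom C - elts \<gamma>" "\<eta> \<in> elts \<beta>" for \<eta>
        using that \<beta>(4)[of \<eta>] Ord_linear[OF Ord_in_Ord[OF \<beta>(1) that(2)] Og] by blast
    qed
    then have "\<beta> \<in> guess_set \<kappa> (B \<iota>) \<Omega> p C" using sub by blast
    then obtain M where B: "\<beta> \<in> B \<iota>" and M: "elementary_submodel M (Hset_plus \<kappa>)" "triples F e \<in> M"
      "M \<inter> elts \<kappa> = elts \<beta>" "M \<inter> \<Omega> = elts (vapp C \<beta>)"
      unfolding guess_set_def p_def by blast
    have closed1: "F \<xi> \<in> M \<and> e \<xi> \<in> M" if "\<xi> \<in> M" "\<xi> \<in> elts \<kappa>" for \<xi>
      by (rule elementary_submodel_triples(1)[OF M(1,2) F e(2,3) that])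
    have closed2: "\<exists>\<eta>\<in>M \<inter> elts \<kappa>. t = e \<eta>" if "t \<in> M" "t \<in> e ` elts \<kappa>" for t
      by (rule elementary_submodel_triples(2)[OF M(1,2) F e(2,3) that])
    have "F \<xi> \<in> elts \<beta>" if "\<xi> \<in> elts \<beta>" for \<xi>
    proof -
      have "\<xi> \<in> M" "\<xi> \<in> elts \<kappa>" using that M(3) by auto
      then have "F \<xi> \<in> M \<inter> elts \<kappa>" using closed1 F by blast
      then show ?thesis using M(3) by simp
    qed
    then have "\<forall>\<xi>\<in>elts \<beta>. F \<xi> \<in> elts \<beta>" by blast
    moreover have "elts (vapp C \<beta>) = \<Omega> \<inter> e ` elts \<beta>"
    proof (intro equalityI subsetI)
      fix t assume "t \<in> elts (vapp C \<beta>)"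
      then have t: "t \<in> M" "t \<in> \<Omega>" using M(4) by auto
      then obtain \<eta> where "\<eta> \<in> M \<inter> elts \<kappa>" "t = e \<eta>" using closed2[of t] \<Omega> by blast
      then show "t \<in> \<Omega> \<inter> e ` elts \<beta>" using t(2) M(3) by blast
    next
      fix t assume "t \<in> \<Omega> \<inter> e ` elts \<beta>"
      then obtain \<xi> where \<xi>: "t \<in> \<Omega>" "\<xi> \<in> elts \<beta>" "t = e \<xi>" by blast
      have "\<xi> \<in> M" "\<xi> \<in> elts \<kappa>" using \<xi>(2) M(3) by auto
      then have "t \<in> M" using closed1 \<xi>(3) by blast
      then show "t \<in> elts (vapp C \<beta>)" using \<xi>(1) M(4) by blast
    qed
    ultimately show ?thesis using \<gamma> \<beta>(2,3) \<beta>\<kappa> nxt B by blast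
  qed
  then show ?thesis unfolding guessed_def using \<alpha>(1,2) lim cf C by blast
qed

lemma Tree_lepoll: "Tree \<lesssim> elts \<kappa>"
  unfolding Tree_def
  by (rule UN_lepoll_infinite[OF infinite_kappa lepoll_refl])
    (rule lesspoll_imp_lepoll[OF good_levelD(5)[OF good_level]])

lemma vappend_neq_ozero: "vappend \<alpha> t i \<noteq> ozero"
  using elts_vappend[of \<alpha> t i] by auto

lemma Tree_enumeration: "\<exists>e. e ` elts \<kappa> = Tree - {ozero}"
proof -
  have "vappend ozero ozero ozero \<in> Tree"
    using Lev_Tree[OF osucc_below[OF ozero_below] Tree_vappend[OF ozero_below]] Lev_ozero ozero_lam by blast
  then have t0: "vappend ozero ozero ozero \<in> Tree - {ozero}" using vappend_neq_ozero by blast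
  have "Tree - {ozero} \<lesssim> elts \<kappa>"
    using lepoll_trans[OF subset_imp_lepoll Tree_lepoll] by blast
  then obtain g where g: "Tree - {ozero} \<subseteq> g ` elts \<kappa>" unfolding lepoll_iff by blast
  define e where "e \<xi> = (if g \<xi> \<in> Tree - {ozero} then g \<xi> else vappend ozero ozero ozero)" for \<xi>
  have "e ` elts \<kappa> = Tree - {ozero}"
  proof (intro equalityI subsetI)
    fix t assume "t \<in> e ` elts \<kappa>"
    then show "t \<in> Tree - {ozero}" using t0 unfolding e_def by (auto split: if_splits)
  next
    fix t assume t: "t \<in> Tree - {ozero}"
    then obtain \<xi> where "\<xi> \<in> elts \<kappa>" "t = g \<xi>" using g by blast
    then show "t \<in> e ` elts \<kappa>" using t unfolding e_def by (intro image_eqI[of _ _ \<xi>]) auto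
  qed
  then show ?thesis by blast
qed

definition below :: "'v \<Rightarrow> 'v set" where
  "below \<beta> = (\<Union>\<delta>\<in>elts \<beta>. Lev \<delta>)"

text \<open>Closing \<beta> under a suitable \<open>F\<close> makes "enumerated before \<beta>" and
  "of length below \<beta>" the same for nodes other than the root, so the guess becomes independent
  of the enumeration.\<close>

lemma tree_guess_point:
  assumes \<Omega>: "\<Omega> \<subseteq> Tree - {ozero}" and \<iota>: "\<iota> \<in> elts \<kappa>" and \<Lambda>: "\<Lambda> \<in> elts lam"
    and g: "\<And>t. t \<in> Tree \<Longrightarrow> g t \<in> Tree"
  shows "guessed \<iota> \<Lambda> (\<lambda>\<beta> c. (\<forall>\<xi>\<in>elts \<beta>. osucc \<xi> \<in> elts \<beta>) \<and>
    (\<forall>t\<in>below \<beta>. g t \<in> below \<beta>) \<and> c = \<Omega> \<inter> below \<beta>)"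
proof -
  obtain e where e: "e ` elts \<kappa> = Tree - {ozero}" using Tree_enumeration by blast
  have "\<exists>\<xi>\<in>elts \<kappa>. e \<xi> = t" if "t \<in> Tree - {ozero}" for t using that[folded e] by auto
  then obtain idx where idx: "\<And>t. t \<in> Tree - {ozero} \<Longrightarrow> idx t \<in> elts \<kappa> \<and> e (idx t) = t" by metis
  have eT: "e \<xi> \<in> Tree" "e \<xi> \<noteq> ozero" if "\<xi> \<in> elts \<kappa>" for \<xi> using imageI[OF that, of e] unfolding e by auto
  \<comment> \<open>What must stay below a closed \<beta>: the indices of nodes of level \<gamma>,
    the lengths of their images under \<open>g\<close>, the length of the node with index \<gamma>,
    and the successor of \<gamma>. Including \<gamma> itself gives the condition \<gamma> <
    F(\<gamma>) of \<open>triples\<close>.\<close>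
  define Bd where "Bd \<gamma> = idx ` (Lev \<gamma> - {ozero}) \<union> (\<lambda>t. rk (g t)) ` Lev \<gamma> \<union> {rk (e \<gamma>), \<gamma>, osucc \<gamma>}" for \<gamma>
  have "\<exists>\<delta>\<in>elts \<kappa>. \<forall>\<xi>\<in>Bd \<gamma>. \<xi> \<in> elts \<delta>" if \<gamma>: "\<gamma> \<in> elts \<kappa>" for \<gamma>
  proof -
    have small: "Lev \<gamma> \<prec> elts \<kappa>" by (rule good_levelD(5)[OF good_level[OF \<gamma>]])
    have "Lev \<gamma> - {ozero} \<prec> elts \<kappa>" by (rule subset_lesspoll_kappa[OF small]) blast
    then have "Bd \<gamma> \<prec> elts \<kappa>" unfolding Bd_def
      by (intro Un_lesspoll_kappa image_lesspoll_kappa) (simp_all add: small finite_lesspoll_kappa)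
    moreover have "(\<lambda>\<xi>. \<xi>) ` Bd \<gamma> \<subseteq> elts \<kappa>"
      unfolding Bd_def using \<gamma> idx Lev_Tree[OF \<gamma>] Tree_rk(1) g eT(1) osucc_below by auto
    ultimately show ?thesis using lesspoll_kappa_bounded[of "Bd \<gamma>" "\<lambda>\<xi>. \<xi>"] by blast
  qed
  then obtain F where F: "\<And>\<gamma>. \<gamma> \<in> elts \<kappa> \<Longrightarrow> F \<gamma> \<in> elts \<kappa> \<and> (\<forall>\<xi>\<in>Bd \<gamma>. \<xi> \<in> elts (F \<gamma>))" by metis
  have F1: "F \<xi> \<in> elts \<kappa> \<and> \<xi> \<in> elts (F \<xi>)" if "\<xi> \<in> elts \<kappa>" for \<xi>
    using F[OF that] unfolding Bd_def by blast
  have e1: "e \<xi> \<in> Hset \<kappa>" "\<not> Ord (e \<xi>)" if "\<xi> \<in> elts \<kappa>" for \<xi>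
    using seqs_below_Hset seqs_not_Ord eT[OF that] Tree_rk(1,3)[OF eT(1)[OF that]] by blast+
  have e2: "\<not> Ord x" if "\<xi> \<in> elts \<kappa>" "x \<in> elts (e \<xi>)" for \<xi> x
    using seqs_elts_not_Ord[OF Tree_rk(3)[OF eT(1)[OF that(1)]] that(2)] .
  have "guessed \<iota> \<Lambda> (\<lambda>\<beta> c. (\<forall>\<xi>\<in>elts \<beta>. F \<xi> \<in> elts \<beta>) \<and> c = \<Omega> \<inter> e ` elts \<beta>)"
    by (rule guess_point[OF \<Omega>[folded e] \<iota> \<Lambda> F1 e1 e2])
  then show ?thesis
  proof (rule guessed_mono, elim conjE, intro conjI)
    fix \<beta> c assume \<beta>\<kappa>: "\<beta> \<in> elts \<kappa>" and clo: "\<forall>\<xi>\<in>elts \<beta>. F \<xi> \<in> elts \<beta>" and val: "c = \<Omega> \<inter> e ` elts \<beta>"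
    have Ob: "Ord \<beta>" by (rule Ord_below[OF \<beta>\<kappa>])
    have in\<kappa>: "\<xi> \<in> elts \<kappa>" if "\<xi> \<in> elts \<beta>" for \<xi> by (rule Ord_trans[OF Ord_kappa \<beta>\<kappa> that])
    have Bd: "\<zeta> \<in> elts \<beta>" if "\<zeta> \<in> Bd \<xi>" "\<xi> \<in> elts \<beta>" for \<zeta> \<xi>
      using F[OF in\<kappa>[OF that(2)]] that clo Ord_trans[OF Ob] by blast
    show "\<forall>\<xi>\<in>elts \<beta>. osucc \<xi> \<in> elts \<beta>" using Bd unfolding Bd_def by blast
    show "\<forall>t\<in>below \<beta>. g t \<in> below \<beta>"
    proof
      fix t assume t: "t \<in> below \<beta>"
      obtain \<xi> where \<xi>: "\<xi> \<in> elts \<beta>" "t \<in> Lev \<xi>" using t unfolding below_def by blast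
      have "rk (g t) \<in> elts \<beta>" using Bd[OF _ \<xi>(1)] \<xi>(2) unfolding Bd_def by blast
      then show "g t \<in> below \<beta>" using Tree_rk(2)[OF g[OF Lev_Tree[OF in\<kappa>[OF \<xi>(1)] \<xi>(2)]]] unfolding below_def by blast
    qed
    show "c = \<Omega> \<inter> below \<beta>" unfolding val
    proof (intro equalityI subsetI)
      fix t assume "t \<in> \<Omega> \<inter> e ` elts \<beta>"
      then obtain \<xi> where \<xi>: "t \<in> \<Omega>" "\<xi> \<in> elts \<beta>" "t = e \<xi>" by blast
      have "rk (e \<xi>) \<in> elts \<beta>" using Bd[OF _ \<xi>(2)] unfolding Bd_def by blast
      then show "t \<in> \<Omega> \<inter> below \<beta>"
        using Tree_rk(2)[OF eT(1)[OF in\<kappa>[OF \<xi>(2)]]] \<xi> unfolding below_def by blast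
    next
      fix t assume t: "t \<in> \<Omega> \<inter> below \<beta>"
      then obtain \<xi> where \<xi>: "\<xi> \<in> elts \<beta>" "t \<in> Lev \<xi>" unfolding below_def by blast
      have tT: "t \<in> Tree - {ozero}" using t \<Omega> by blast
      have "idx t \<in> elts \<beta>" using Bd[OF _ \<xi>(1)] \<xi>(2) tT unfolding Bd_def by blast
      then show "t \<in> \<Omega> \<inter> e ` elts \<beta>" using idx[OF tT] t by (metis IntD1 IntI image_eqI)
    qed
  qed
qed

text \<open>All positions before \<beta> are contained in the one at \<gamma>, so the trunk at
  \<beta> is that position and the walk makes a single step from \<gamma> to \<beta>.\<close>

lemma trunk_successor:
  assumes \<alpha>: "\<alpha> \<in> elts \<kappa>" "limit_ord \<alpha>" and C: "C \<in> \<C> \<alpha>" and x: "\<delta> \<in> elts \<alpha>" "x \<in> Lev \<delta>"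
    and \<gamma>: "\<gamma> \<in> vdom C" "\<beta> \<in> vdom C" "\<gamma> \<in> elts \<beta>" "\<forall>\<eta>\<in>vdom C \<inter> elts \<beta>. elts \<eta> \<subseteq> elts \<gamma>"
    and \<delta>\<gamma>: "elts \<delta> \<subseteq> elts \<gamma>"
  shows "wlk C x \<gamma> \<in> Lev \<gamma>" "wlk C x \<beta> = tstep (B ozero) Lev (vapp C \<beta>) \<beta> (wlk C x \<gamma>)"
    "elts (wlk C x \<beta>) \<subseteq> elts (trk C x \<alpha>)" "\<beta> \<in> elts \<alpha>"
proof -
  have good: "\<forall>\<beta>\<in>elts \<alpha>. good_level \<beta>" using good_level Ord_trans[OF Ord_kappa \<alpha>(1)] by blast
  note wm = walk_main[OF \<alpha> good C x]
  have domx: "vdom x = elts \<delta>" using good_levelD(2)[of \<delta> x] good x by blast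
  have Oa: "Ord \<alpha>" by (rule Ord_below[OF \<alpha>(1)])
  have dC: "vdom C \<subseteq> elts \<alpha>" by (rule ladder_props(1)[OF \<alpha> C])
  show "\<beta> \<in> elts \<alpha>" using dC \<gamma>(2) by blast
  show "wlk C x \<gamma> \<in> Lev \<gamma>" using wm[OF \<gamma>(1) \<delta>\<gamma>] by blast
  have "elts x \<union> (\<Union>\<eta>\<in>{\<eta> \<in> vdom C \<inter> elts \<beta>. elts \<delta> \<subseteq> elts \<eta>}. elts (wlk C x \<eta>)) = elts (wlk C x \<gamma>)"
  proof (intro equalityI Un_least UN_least)
    show "elts x \<subseteq> elts (wlk C x \<gamma>)" using wm[OF \<gamma>(1) \<delta>\<gamma>] by blast
    fix \<eta> assume \<eta>: "\<eta> \<in> {\<eta> \<in> vdom C \<inter> elts \<beta>. elts \<delta> \<subseteq> elts \<eta>}"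
    have "Ord \<eta>" "Ord \<gamma>" using \<eta> \<gamma>(1) dC Ord_in_Ord[OF Oa] by blast+
    then have "\<eta> \<in> elts \<gamma> \<or> \<eta> = \<gamma>" using ole_iff_subset[of \<eta> \<gamma>] \<gamma>(4) \<eta> unfolding ole_def by blast
    then show "elts (wlk C x \<eta>) \<subseteq> elts (wlk C x \<gamma>)" using wm[OF \<gamma>(1) \<delta>\<gamma>] \<eta> by blast
  qed (use \<gamma> \<delta>\<gamma> in blast)
  then have "trk C x \<beta> = wlk C x \<gamma>" unfolding trunk_def domx by simp
  then show "wlk C x \<beta> = tstep (B ozero) Lev (vapp C \<beta>) \<beta> (wlk C x \<gamma>)"
    using walk_trunk[of "B ozero" Lev C x \<beta>] by simp
  have "elts \<delta> \<subseteq> elts \<beta>"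
    using \<delta>\<gamma> \<gamma>(2,3) dC Ord_in_Ord[OF Oa] Ord_mem_subset by blast
  then show "elts (wlk C x \<beta>) \<subseteq> elts (trk C x \<alpha>)"
    by (rule trunk_limit(4)[OF \<alpha> good C x \<gamma>(2)])
qed


lemma below_lesspoll: "\<alpha> \<in> elts \<kappa> \<Longrightarrow> below \<alpha> \<prec> elts \<kappa>"
  unfolding below_def
  by (rule UN_lesspoll_kappa[OF below_kappa_lesspoll good_levelD(5)[OF good_level]])
    (auto intro: Ord_trans[OF Ord_kappa])

lemma not_below_rk:
  assumes "t \<in> Tree" "t \<notin> below \<alpha>" "\<alpha> \<in> elts \<kappa>"
  shows "elts \<alpha> \<subseteq> elts (rk t)"
  using not_mem_iff_subset[OF Ord_below Ord_below, OF assms(3) Tree_rk(1)[OF assms(1)]]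
    Tree_rk(2)[OF assms(1)] assms(2) unfolding below_def by blast

lemma Lev_thick:
  assumes "\<alpha> \<in> elts \<kappa>" "limit_ord \<alpha>" "cf \<alpha> \<notin> elts \<chi>" "\<C> \<alpha> = {C}" "t \<in> Lev \<alpha>"
  shows "\<exists>\<delta>\<in>elts \<alpha>. \<exists>x\<in>Lev \<delta>. t = trk C x \<alpha>"
  using assms(5) unfolding Lev_limit[OF assms(2)] using assms(3,4) by auto

section \<open>Antichains\<close>

lemma no_large_antichain:
  assumes A: "tantichain Tree A"
  shows "\<not> A \<approx> elts \<kappa>"
proof -
  have AT: "A \<subseteq> Tree" and anti: "\<And>s t. s \<in> A \<Longrightarrow> t \<in> A \<Longrightarrow> \<not> tless s t"
    using A unfolding tantichain_def by blast+
  \<comment> \<open>This dense set plays the role of a maximal antichain extending \<open>A\<close>.\<close>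
  define D where "D = {t \<in> Tree - {ozero}. (\<exists>a\<in>A. elts a \<subseteq> elts t) \<or>
    (\<forall>a\<in>A. \<not> elts a \<subseteq> elts t \<and> \<not> elts t \<subseteq> elts a)}"
  have "\<exists>d\<in>D. elts t \<subseteq> elts d" if t: "t \<in> Tree" for t
  proof -
    \<comment> \<open>A proper extension of \<open>t\<close>, so that the element of
      \<open>D\<close> found above it is not the root.\<close>
    define t1 where "t1 = vappend (rk t) t ozero"
    have t1: "t1 \<in> Tree" "elts t \<subseteq> elts t1" "elts t1 \<noteq> {}"
      using Lev_Tree[OF osucc_below Tree_vappend] Tree_rk(1,2)[OF t] ozero_lam elts_vappend[of "rk t" t ozero]
      unfolding t1_def by blast+
    show ?thesis
    proof (cases "\<exists>a\<in>A. elts t1 \<subseteq> elts a")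
      case True
      then obtain a where a: "a \<in> A" "elts t1 \<subseteq> elts a" by blast
      then have "a \<noteq> ozero" using t1(3) by auto
      then have "a \<in> D" using a AT unfolding D_def by blast
      then show ?thesis using a(2) t1(2) by blast
    next
      case False
      have "t1 \<noteq> ozero" using t1(3) by auto
      then have "t1 \<in> D" using False t1(1) unfolding D_def by blast
      then show ?thesis using t1(2) by blast
    qed
  qed
  then obtain g where g: "\<And>t. t \<in> Tree \<Longrightarrow> g t \<in> D \<and> elts t \<subseteq> elts (g t)" by metis
  have DT: "D \<subseteq> Tree - {ozero}" unfolding D_def by blast
  have gT: "\<And>t. t \<in> Tree \<Longrightarrow> g t \<in> Tree" using g DT by blast
  have "guessed ozero ozero (\<lambda>\<beta> c. (\<forall>\<xi>\<in>elts \<beta>. osucc \<xi> \<in> elts \<beta>) \<and>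
    (\<forall>t\<in>below \<beta>. g t \<in> below \<beta>) \<and> c = D \<inter> below \<beta>)"
    by (rule tree_guess_point[OF DT ozero_below ozero_lam gT])
  then obtain \<alpha> C where \<alpha>: "\<alpha> \<in> elts \<kappa>" "limit_ord \<alpha>" "cf \<alpha> \<notin> elts \<chi>" "\<C> \<alpha> = {C}"
    and pt: "\<forall>\<delta>\<in>elts \<alpha>. \<exists>\<gamma>\<in>vdom C. \<exists>\<beta>\<in>vdom C. \<delta> \<in> elts \<gamma> \<and> \<gamma> \<in> elts \<beta> \<and>
      (\<forall>\<eta>\<in>vdom C \<inter> elts \<beta>. elts \<eta> \<subseteq> elts \<gamma>) \<and> \<beta> \<in> B ozero \<and> \<beta> \<in> elts \<kappa> \<and>
      (\<forall>\<xi>\<in>elts \<beta>. osucc \<xi> \<in> elts \<beta>) \<and> (\<forall>t\<in>below \<beta>. g t \<in> below \<beta>) \<and> elts (vapp C \<beta>) = D \<inter> below \<beta>"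
    unfolding guessed_def by blast
  have C: "C \<in> \<C> \<alpha>" using \<alpha>(4) by simp
  have Oa: "Ord \<alpha>" by (rule Ord_below[OF \<alpha>(1)])
  have sealed: "\<exists>s\<in>D \<inter> below \<alpha>. elts s \<subseteq> elts t" if t: "t \<in> Lev \<alpha>" for t
  proof -
    obtain \<delta> x where x: "\<delta> \<in> elts \<alpha>" "x \<in> Lev \<delta>" "t = trk C x \<alpha>"
      using Lev_thick[OF \<alpha> t] by blast
    obtain \<gamma> \<beta> where \<gamma>\<beta>: "\<gamma> \<in> vdom C" "\<beta> \<in> vdom C" "\<delta> \<in> elts \<gamma>" "\<gamma> \<in> elts \<beta>"
      "\<forall>\<eta>\<in>vdom C \<inter> elts \<beta>. elts \<eta> \<subseteq> elts \<gamma>" and \<beta>: "\<beta> \<in> B ozero" "\<beta> \<in> elts \<kappa>"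
      and clo: "\<forall>t\<in>below \<beta>. g t \<in> below \<beta>" and val: "elts (vapp C \<beta>) = D \<inter> below \<beta>"
      using bspec[OF pt x(1)] by blast
    have \<gamma>\<kappa>: "\<gamma> \<in> elts \<kappa>" by (rule Ord_trans[OF Ord_kappa \<beta>(2) \<gamma>\<beta>(4)])
    note ts = trunk_successor[OF \<alpha>(1,2) C x(1,2) \<gamma>\<beta>(1,2,4,5) Ord_mem_subset[OF Ord_below[OF \<gamma>\<kappa>] \<gamma>\<beta>(3)]]
    define u where "u = wlk C x \<gamma>"
    have u: "u \<in> Lev \<gamma>" "u \<in> Tree" using ts(1) Lev_Tree[OF \<gamma>\<kappa>] unfolding u_def by blast+
    have "u \<in> below \<beta>" using u(1) \<gamma>\<beta>(4) unfolding below_def by blast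
    then have gu: "g u \<in> D \<inter> below \<beta>" "elts u \<subseteq> elts (g u)" using clo g[OF u(2)] by blast+
    obtain \<epsilon> where \<epsilon>: "\<epsilon> \<in> elts \<beta>" "g u \<in> Lev \<epsilon>" using gu(1) unfolding below_def by blast
    \<comment> \<open>Closure of \<beta> under \<open>g\<close> puts a member of C(\<beta>) above
      \<open>u\<close> and below level \<beta>; any extension of it to level \<beta> shows that the
      walk can meet C(\<beta>).\<close>
    obtain t' where t': "t' \<in> Lev \<beta>" "elts (g u) \<subseteq> elts t'"
      using good_levelD(4)[OF good_level[OF \<beta>(2)] \<epsilon>] by blast
    have "\<exists>s\<in>elts (vapp C \<beta>). elts s \<subseteq> elts (tstep (B ozero) Lev (vapp C \<beta>) \<beta> u)"
      by (rule tstep_above(3)[OF good_level[OF \<beta>(2)] good_level[OF \<gamma>\<kappa>] u(1) \<gamma>\<beta>(4) \<beta>(1) t'(1) _ _ t'(2)])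
        (use gu t'(2) val in blast)+
    then obtain s where s: "s \<in> D \<inter> below \<beta>" "elts s \<subseteq> elts (wlk C x \<beta>)"
      using ts(2) val unfolding u_def by auto
    have "s \<in> below \<alpha>" using s(1) Ord_trans[OF Oa ts(4)] unfolding below_def by blast
    then show ?thesis using s ts(3) unfolding x(3) by blast
  qed
  have "A \<subseteq> below \<alpha>"
  proof (rule ccontr)
    assume "\<not> A \<subseteq> below \<alpha>"
    then obtain a where a: "a \<in> A" "a \<notin> below \<alpha>" by blast
    have aT: "a \<in> Tree" using a(1) AT by blast
    note r = vrestrict_Lev[OF aT not_below_rk[OF aT a(2) \<alpha>(1)] \<alpha>(1)]
    obtain s where s: "s \<in> D" "s \<in> below \<alpha>" "elts s \<subseteq> elts a"
      using sealed[OF r(1)] r(2) by blast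
    \<comment> \<open>As \<open>s\<close> lies below \<open>a\<close>, it is comparable with a
      member of \<open>A\<close>, which leaves only the first alternative in
      \<open>D\<close>.\<close>
    then obtain a0 where a0: "a0 \<in> A" "elts a0 \<subseteq> elts s" using a(1) unfolding D_def by blast
    have "elts s \<noteq> elts a" using s(2) a(2) extensionality by blast
    then have "tless a0 a" unfolding tless_def using a0(2) s(3) by blast
    then show False using anti a0(1) a(1) by blast
  qed
  then have "A \<prec> elts \<kappa>" using subset_lesspoll_kappa[OF below_lesspoll[OF \<alpha>(1)]] by blast
  then show ?thesis unfolding lesspoll_def by blast
qed

section \<open>Ascending paths and branches\<close>

lemma lam_not_covered:
  assumes "\<Lambda> \<in> elts lam" "inj_on h (elts lam)"
  shows "\<exists>k\<in>elts lam. h k \<notin> f ` elts \<Lambda>"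
proof (rule ccontr)
  assume "\<not> ?thesis"
  then have "h ` elts lam \<subseteq> f ` elts \<Lambda>" by blast
  then have "h ` elts lam \<lesssim> elts \<Lambda>" by (rule subset_image_lepoll)
  then have "elts lam \<lesssim> elts \<Lambda>" using assms(2) by simp
  moreover have "elts \<Lambda> \<prec> elts lam" using lam(1) assms(1) unfolding Card_def by blast
  ultimately show False using lesspoll_trans1 lesspoll_not_refl by blast
qed

lemma one_below: "osucc ozero \<in> elts \<kappa>"
  by (rule osucc_below[OF ozero_below])

lemma no_ascending_path:
  assumes \<Lambda>: "\<Lambda> \<in> elts lam"
  shows "\<not> ascending_path \<kappa> \<Lambda> Tree f"
proof
  assume path: "ascending_path \<kappa> \<Lambda> Tree f"
  have fL: "f \<xi> i \<in> Lev \<xi>" if "\<xi> \<in> elts \<kappa>" "i \<in> elts \<Lambda>" for \<xi> i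
    using path that level_Tree unfolding ascending_path_def by blast
  define \<Omega> where "\<Omega> = {f \<xi> i | \<xi> i. \<xi> \<in> elts \<kappa> \<and> i \<in> elts \<Lambda>} - {ozero}"
  have \<Omega>T: "\<Omega> \<subseteq> Tree - {ozero}" unfolding \<Omega>_def using fL Lev_Tree by blast
  have "guessed (osucc ozero) \<Lambda> (\<lambda>\<beta> c. (\<forall>\<xi>\<in>elts \<beta>. osucc \<xi> \<in> elts \<beta>) \<and>
    (\<forall>t\<in>below \<beta>. t \<in> below \<beta>) \<and> c = \<Omega> \<inter> below \<beta>)"
    by (rule tree_guess_point[OF \<Omega>T one_below \<Lambda>])
  then obtain \<alpha> C where \<alpha>: "\<alpha> \<in> elts \<kappa>" "limit_ord \<alpha>" "cf \<alpha> \<notin> elts \<chi>" "\<C> \<alpha> = {C}"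
    and cf: "\<Lambda> \<in> elts (cf \<alpha>)"
    and pt: "\<forall>\<delta>\<in>elts \<alpha>. \<exists>\<gamma>\<in>vdom C. \<exists>\<beta>\<in>vdom C. \<delta> \<in> elts \<gamma> \<and> \<gamma> \<in> elts \<beta> \<and>
      (\<forall>\<eta>\<in>vdom C \<inter> elts \<beta>. elts \<eta> \<subseteq> elts \<gamma>) \<and> \<beta> \<in> B (osucc ozero) \<and> \<beta> \<in> elts \<kappa> \<and>
      (\<forall>\<xi>\<in>elts \<beta>. osucc \<xi> \<in> elts \<beta>) \<and> (\<forall>t\<in>below \<beta>. t \<in> below \<beta>) \<and> elts (vapp C \<beta>) = \<Omega> \<inter> below \<beta>"
    unfolding guessed_def by blast
  have C: "C \<in> \<C> \<alpha>" using \<alpha>(4) by simp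
  have Oa: "Ord \<alpha>" by (rule Ord_below[OF \<alpha>(1)])
  have "\<forall>j\<in>elts \<Lambda>. \<exists>\<delta> x. \<delta> \<in> elts \<alpha> \<and> x \<in> Lev \<delta> \<and> f \<alpha> j = trk C x \<alpha>"
    using Lev_thick[OF \<alpha> fL[OF \<alpha>(1)]] by blast
  then obtain d x where dx: "\<And>j. j \<in> elts \<Lambda> \<Longrightarrow> d j \<in> elts \<alpha> \<and> x j \<in> Lev (d j) \<and> f \<alpha> j = trk C (x j) \<alpha>"
    by metis
  \<comment> \<open>Here cf(\<alpha>) > \<Lambda> is used: one \<delta> lies above the starting
    levels of all \<Lambda> branches, so a single pair \<gamma>, \<beta> above it serves every
    \<open>j\<close>.\<close>
  obtain \<delta> where \<delta>: "\<delta> \<in> elts \<alpha>" "\<forall>j\<in>elts \<Lambda>. d j \<in> elts \<delta>"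
    using below_cf_bounded[OF Oa cf, of d] dx by blast
  obtain \<gamma> \<beta> where \<gamma>\<beta>: "\<gamma> \<in> vdom C" "\<beta> \<in> vdom C" "\<delta> \<in> elts \<gamma>" "\<gamma> \<in> elts \<beta>"
    "\<forall>\<eta>\<in>vdom C \<inter> elts \<beta>. elts \<eta> \<subseteq> elts \<gamma>" and \<beta>: "\<beta> \<in> B (osucc ozero)" "\<beta> \<in> elts \<kappa>"
    and clo: "\<forall>\<xi>\<in>elts \<beta>. osucc \<xi> \<in> elts \<beta>" and val: "elts (vapp C \<beta>) = \<Omega> \<inter> below \<beta>"
    using bspec[OF pt \<delta>(1)] by blast
  have \<gamma>\<kappa>: "\<gamma> \<in> elts \<kappa>" by (rule Ord_trans[OF Ord_kappa \<beta>(2) \<gamma>\<beta>(4)])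
  \<comment> \<open>Closure of \<beta> under successors puts the nodes of the path on level
    \<gamma>+1 into C(\<beta>).\<close>
  have s\<gamma>\<beta>: "osucc \<gamma> \<in> elts \<beta>" using clo \<gamma>\<beta>(4) by blast
  have s\<gamma>\<kappa>: "osucc \<gamma> \<in> elts \<kappa>" by (rule osucc_below[OF \<gamma>\<kappa>])
  have \<beta>\<alpha>: "\<beta> \<in> elts \<alpha>" using ladder_props(1)[OF \<alpha>(1,2) C] \<gamma>\<beta>(2) by blast
  have "osucc (ozero::'v) \<noteq> ozero" using elts_osucc[of ozero] by (metis elts_ozero insert_not_empty)
  then have \<beta>0: "\<beta> \<notin> B ozero"
    using cells_disjoint \<beta>(1) one_below ozero_below unfolding disjoint_family_on_def by blast
  \<comment> \<open>The path property is applied to the levels \<gamma>+1 and \<alpha>; the walk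
    belonging to this \<open>j\<close> will be shown to avoid the node with index
    \<open>i\<close>.\<close>
  obtain i j where ij: "i \<in> elts \<Lambda>" "j \<in> elts \<Lambda>" "tless (f (osucc \<gamma>) i) (f \<alpha> j)"
    using path \<alpha>(1) Ord_trans[OF Oa \<beta>\<alpha> s\<gamma>\<beta>] unfolding ascending_path_def by blast
  have djx: "d j \<in> elts \<alpha>" "x j \<in> Lev (d j)" and fx: "f \<alpha> j = trk C (x j) \<alpha>" using dx[OF ij(2)] by auto
  have "d j \<in> elts \<gamma>" using Ord_trans[OF Ord_below[OF \<gamma>\<kappa>] \<gamma>\<beta>(3)] \<delta>(2) ij(2) by blast
  then have dj: "elts (d j) \<subseteq> elts \<gamma>" by (rule Ord_mem_subset[OF Ord_below[OF \<gamma>\<kappa>]])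
  note ts = trunk_successor[OF \<alpha>(1,2) C djx \<gamma>\<beta>(1,2,4,5) dj]
  define u where "u = wlk C (x j) \<gamma>"
  have u: "u \<in> Lev \<gamma>" "u \<in> seqs \<gamma> (elts \<kappa>)"
    using ts(1) good_levelD(1)[OF good_level[OF \<gamma>\<kappa>]] unfolding u_def by blast+
  have "inj_on (vappend \<gamma> u) (elts lam)" using vappend_inject[OF u(2)] by (intro inj_onI)
  \<comment> \<open>Among the successors of \<open>u\<close> labelled by \<open>lam\<close>, one is
    missed by the path, whose nodes on level \<gamma>+1 are at most \<Lambda> many. Every extension
    of it to level \<beta> is suitable for \<open>tstep\<close>.\<close>
  from lam_not_covered[OF \<Lambda> this, of "f (osucc \<gamma>)"]
  obtain k where k: "k \<in> elts lam" "vappend \<gamma> u k \<notin> f (osucc \<gamma>) ` elts \<Lambda>" by blast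
  have v: "vappend \<gamma> u k \<in> Lev (osucc \<gamma>)" using Tree_vappend[OF \<gamma>\<kappa> u(1)] k(1) by blast
  obtain t' where t': "t' \<in> Lev \<beta>" "elts (vappend \<gamma> u k) \<subseteq> elts t'"
    using good_levelD(4)[OF good_level[OF \<beta>(2)] s\<gamma>\<beta> v] by blast
  have t'T: "t' \<in> Tree" by (rule Lev_Tree[OF \<beta>(2) t'(1)])
  have vT: "vappend \<gamma> u k \<in> Tree" by (rule Lev_Tree[OF s\<gamma>\<kappa> v])
  have avoid: "\<not> elts s \<subseteq> elts t'" if s: "s \<in> elts (vapp C \<beta>)" "vdom s = elts (osucc \<gamma>)" for s
  proof
    assume sub: "elts s \<subseteq> elts t'"
    obtain \<xi> i where \<xi>: "\<xi> \<in> elts \<kappa>" "i \<in> elts \<Lambda>" "s = f \<xi> i" using s(1) unfolding val \<Omega>_def by blast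
    have "vdom s = elts \<xi>" using good_levelD(2)[OF good_level[OF \<xi>(1)] fL[OF \<xi>(1,2)]] \<xi>(3) by simp
    then have "\<xi> = osucc \<gamma>" using s(2) extensionality by metis
    have sT: "s \<in> Tree" using \<xi>(3) fL[OF \<xi>(1,2)] Lev_Tree[OF \<xi>(1)] by simp
    have "rk s = osucc \<gamma>" unfolding rk_def s(2) by (rule vset_elts)
    then have "s = vrestrict t' (elts (osucc \<gamma>))" using Tree_subset_rk(2)[OF sT t'T sub] by simp
    moreover have "vappend \<gamma> u k = vrestrict t' (elts (osucc \<gamma>))"
      using Tree_subset_rk(2)[OF vT t'T t'(2)] rk_Lev[OF s\<gamma>\<kappa> v] by simp
    ultimately have "vappend \<gamma> u k = f (osucc \<gamma>) i" using \<xi>(3) \<open>\<xi> = osucc \<gamma>\<close> by simp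
    then show False using k(2) \<xi>(2) by blast
  qed
  define s where "s = f (osucc \<gamma>) i"
  have sL: "s \<in> Lev (osucc \<gamma>)" unfolding s_def by (rule fL[OF s\<gamma>\<kappa> ij(1)])
  have doms: "vdom s = elts (osucc \<gamma>)" by (rule good_levelD(2)[OF good_level[OF s\<gamma>\<kappa>] sL])
  have sT: "s \<in> Tree" by (rule Lev_Tree[OF s\<gamma>\<kappa> sL])
  have "s \<noteq> ozero" using doms unfolding vdom_def by auto
  then have s: "s \<in> elts (vapp C \<beta>)"
    unfolding val \<Omega>_def below_def using s\<gamma>\<kappa> s\<gamma>\<beta> ij(1) sL unfolding s_def by blast
  have "\<not> elts s \<subseteq> elts (tstep (B ozero) Lev (vapp C \<beta>) \<beta> u)"
    by (rule tstep_above(4)[OF good_level[OF \<beta>(2)] good_level[OF \<gamma>\<kappa>] u(1) \<gamma>\<beta>(4) \<beta>0 t'(1) _ avoid s doms])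
      (use t'(2) elts_vappend in blast)
  then have not_sub: "\<not> elts s \<subseteq> elts (wlk C (x j) \<beta>)" using ts(2) unfolding u_def by simp
  have wL: "wlk C (x j) \<beta> \<in> Lev \<beta>"
    using ts(2) tstep_above(1)[OF good_level[OF \<beta>(2)] good_level[OF \<gamma>\<kappa>] u(1) \<gamma>\<beta>(4)] unfolding u_def by simp
  \<comment> \<open>Both nodes lie below \<open>f \<alpha> j\<close> and \<open>s\<close> is the
    shorter one, so it lies below the walk, contrary to \<open>not_sub\<close>.\<close>
  have "elts s \<subseteq> elts (wlk C (x j) \<beta>)"
  proof (rule Tree_comparable)
    show "f \<alpha> j \<in> Tree" by (rule Lev_Tree[OF \<alpha>(1) fL[OF \<alpha>(1) ij(2)]])
    show "wlk C (x j) \<beta> \<in> Tree" by (rule Lev_Tree[OF \<beta>(2) wL])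
    show "elts s \<subseteq> elts (f \<alpha> j)" using ij(3) unfolding tless_def s_def by blast
    show "elts (wlk C (x j) \<beta>) \<subseteq> elts (f \<alpha> j)" unfolding fx by (rule ts(3))
    show "elts (rk s) \<subseteq> elts (rk (wlk C (x j) \<beta>))"
      unfolding rk_Lev[OF s\<gamma>\<kappa> sL] rk_Lev[OF \<beta>(2) wL] by (rule Ord_mem_subset[OF Ord_below[OF \<beta>(2)] s\<gamma>\<beta>])
  qed (rule sT)
  then show False using not_sub by blast
qed

text \<open>Fewer than \<kappa> nodes lie below any level, so a chain of size \<kappa> reaches every
  height. Cutting its members down to each level gives the path of width 1, a width below
  \<open>lam\<close> since \<open>lam\<close> is infinite.\<close>

lemma no_large_branch:
  assumes A: "tchain Tree A"
  shows "\<not> A \<approx> elts \<kappa>"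
proof
  assume big: "A \<approx> elts \<kappa>"
  have AT: "A \<subseteq> Tree" using A unfolding tchain_def by blast
  have chain: "elts s \<subseteq> elts t \<or> elts t \<subseteq> elts s" if "s \<in> A" "t \<in> A" for s t
  proof -
    have "s = t \<or> tless s t \<or> tless t s" using A that unfolding tchain_def by blast
    then show ?thesis unfolding tless_def by auto
  qed
  have "\<exists>a\<in>A. elts \<xi> \<subseteq> elts (rk a)" if \<xi>: "\<xi> \<in> elts \<kappa>" for \<xi>
  proof (rule ccontr)
    assume "\<not> ?thesis"
    then have "A \<subseteq> below \<xi>" using not_below_rk[OF _ _ \<xi>] AT by blast
    then have "A \<prec> elts \<kappa>" using subset_lesspoll_kappa[OF below_lesspoll[OF \<xi>]] by blast
    then show False using big unfolding lesspoll_def by blast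
  qed
  then obtain a where a: "\<And>\<xi>. \<xi> \<in> elts \<kappa> \<Longrightarrow> a \<xi> \<in> A \<and> elts \<xi> \<subseteq> elts (rk (a \<xi>))" by metis
  define b where "b \<xi> = vrestrict (a \<xi>) (elts \<xi>)" for \<xi>
  have b: "b \<xi> \<in> Lev \<xi>" "elts (b \<xi>) \<subseteq> elts (a \<xi>)" if "\<xi> \<in> elts \<kappa>" for \<xi>
    using vrestrict_Lev[of "a \<xi>" \<xi>] a[OF that] AT that unfolding b_def by blast+
  have "tless (b \<xi>) (b \<eta>)" if \<eta>: "\<eta> \<in> elts \<kappa>" and \<xi>\<eta>: "\<xi> \<in> elts \<eta>" for \<xi> \<eta>
  proof -
    have \<xi>: "\<xi> \<in> elts \<kappa>" by (rule Ord_trans[OF Ord_kappa \<eta> \<xi>\<eta>])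
    \<comment> \<open>The longer of the two chain members lies above both restrictions, which makes
      them comparable.\<close>
    obtain t where t: "t \<in> A" "elts (a \<xi>) \<subseteq> elts t" "elts (a \<eta>) \<subseteq> elts t"
      using chain[of "a \<xi>" "a \<eta>"] a[OF \<xi>] a[OF \<eta>] by blast
    have T: "b \<xi> \<in> Tree" "b \<eta> \<in> Tree" "t \<in> Tree"
      using b(1) Lev_Tree \<xi> \<eta> t(1) AT by blast+
    have rk: "rk (b \<xi>) = \<xi>" "rk (b \<eta>) = \<eta>" using rk_Lev b(1) \<xi> \<eta> by blast+
    have "elts (b \<xi>) \<subseteq> elts (b \<eta>)"
      by (rule Tree_comparable[OF T])
        (use b(2)[OF \<xi>] b(2)[OF \<eta>] t rk Ord_mem_subset[OF Ord_below[OF \<eta>] \<xi>\<eta>] in auto)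
    then show ?thesis using tlessI[OF T(1,2)] rk \<xi>\<eta> by simp
  qed
  then have "ascending_path \<kappa> (osucc ozero) Tree (\<lambda>\<xi> _. b \<xi>)"
    unfolding ascending_path_def using b(1) level_Tree by auto
  moreover have "osucc ozero \<in> elts lam"
    using finite_Ord_mem[of "osucc ozero" lam] lam(1,2) unfolding Card_def by simp
  ultimately show False using no_ascending_path by blast
qed

lemma Tree_Souslin: "streamlined_Souslin_tree \<kappa> Tree"
  unfolding streamlined_Souslin_tree_def
  using streamlined_Tree height_Tree level_Tree good_levelD(5)[OF good_level]
    no_large_branch no_large_antichain unfolding tbranch_def by auto

end

theorem theorem6p14:
  fixes \<kappa> \<chi> \<sigma> lam :: "'v::set_universe"
  assumes "regular_card \<kappa>" and "uncountable (elts \<kappa>)"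
    and "regular_card \<chi>" and "\<chi> \<in> elts \<kappa>" and "lt_closed \<chi> \<kappa>"
    and "\<sigma> \<in> elts \<kappa>"
    and "Card lam" and "infinite (elts lam)" and "lam \<in> elts \<kappa>"
    and "P_bullet \<kappa> \<kappa> (sq_star_chi \<chi>) (osucc ozero)
      {E_ge \<kappa> \<chi> \<inter> E_gt \<kappa> \<Lambda> | \<Lambda>. \<Lambda> \<in> elts lam} (osucc (osucc ozero))"
  shows "\<exists>T. streamlined_Souslin_tree \<kappa> T \<and> normal_tree \<kappa> T \<and> prolific_tree \<kappa> T \<and>
    splitting_tree \<sigma> T \<and> complete_tree \<chi> T \<and>
    (\<forall>\<Lambda>\<in>elts lam. Card \<Lambda> \<longrightarrow> \<not> (\<exists>f. ascending_path \<kappa> \<Lambda> T f))"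
proof -
  interpret R: regular_cardinal \<kappa> using assms(1) by unfold_locales
  have one: "osucc ozero \<in> elts (omega::'v)"
    using R.finite_Ord_mem[of "osucc ozero" omega] R.omega_props by simp
  obtain \<C> B where B: "disjoint_family_on B (elts \<kappa>)"
    and ladder: "\<forall>\<alpha>\<in>acc_pts (elts \<kappa>).
      \<C> \<alpha> \<subseteq> {C \<in> FF \<kappa>. sup_dom C = \<alpha>} \<and> \<C> \<alpha> \<noteq> {} \<and> \<C> \<alpha> \<prec> elts \<kappa> \<and>
      (\<forall>C\<in>\<C> \<alpha>. \<forall>\<alpha>'\<in>acc_pts (vdom C). \<exists>D\<in>\<C> \<alpha>'. sq_star_chi \<chi> D C)"
    and guess: "\<forall>(\<Omega> :: 'v \<Rightarrow> 'v set) (p :: 'v \<Rightarrow> 'v) (\<iota> :: 'v \<Rightarrow> 'v).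
      (\<forall>i\<in>elts (osucc ozero). \<Omega> i \<subseteq> Hset \<kappa> \<and> p i \<in> Hset_plus \<kappa> \<and> \<iota> i \<in> elts \<kappa>) \<longrightarrow>
      (\<forall>S\<in>{E_ge \<kappa> \<chi> \<inter> E_gt \<kappa> \<Lambda> | \<Lambda>. \<Lambda> \<in> elts lam}. \<forall>n\<in>elts omega.
        stationary_in \<kappa> {\<alpha> \<in> S. \<C> \<alpha> \<prec> elts (osucc (osucc (ozero::'v))) \<and>
          (\<forall>C\<in>\<C> \<alpha>. \<forall>i\<in>elts \<alpha> \<inter> elts (osucc ozero).
            osup {\<gamma> \<in> vdom C. succ_n n (vdom C - elts \<gamma>) \<subseteq> guess_set \<kappa> (B (\<iota> i)) (\<Omega> i) (p i) C}
              = \<alpha>)})"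
    using assms(10) unfolding P_bullet_def by (elim exE conjE)
  interpret bullet_sequence \<kappa> \<chi> \<sigma> lam \<C> B
  proof
    fix \<alpha> assume "\<alpha> \<in> acc_pts (elts \<kappa>)"
    then show "\<C> \<alpha> \<subseteq> {C \<in> FF \<kappa>. sup_dom C = \<alpha>} \<and> \<C> \<alpha> \<noteq> {} \<and> \<C> \<alpha> \<prec> elts \<kappa> \<and>
      (\<forall>C\<in>\<C> \<alpha>. \<forall>\<alpha>'\<in>acc_pts (vdom C). \<exists>D\<in>\<C> \<alpha>'. sq_star_chi \<chi> D C)"
      using ladder by blast
  next
    fix \<Omega> p \<iota> \<Lambda>
    assume "\<Omega> \<subseteq> Hset \<kappa>" "p \<in> Hset_plus \<kappa>" "\<iota> \<in> elts \<kappa>" and \<Lambda>: "\<Lambda> \<in> elts lam"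
    then have pre: "\<forall>i\<in>elts (osucc ozero). \<Omega> \<subseteq> Hset \<kappa> \<and> p \<in> Hset_plus \<kappa> \<and> \<iota> \<in> elts \<kappa>" by blast
    have S: "E_ge \<kappa> \<chi> \<inter> E_gt \<kappa> \<Lambda> \<in> {E_ge \<kappa> \<chi> \<inter> E_gt \<kappa> \<Lambda> | \<Lambda>. \<Lambda> \<in> elts lam}" using \<Lambda> by blast
    show "stationary_in \<kappa> {\<alpha> \<in> E_ge \<kappa> \<chi> \<inter> E_gt \<kappa> \<Lambda>. \<C> \<alpha> \<prec> elts (osucc (osucc (ozero::'v))) \<and>
        (\<forall>C\<in>\<C> \<alpha>. \<forall>i\<in>elts \<alpha> \<inter> elts (osucc ozero).
          osup {\<gamma> \<in> vdom C. succ_n (osucc ozero) (vdom C - elts \<gamma>) \<subseteq> guess_set \<kappa> (B \<iota>) \<Omega> p C} = \<alpha>)}"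
      \<comment> \<open>Constant families turn a single triple into a sequence indexed by \<theta> =
        1, and \<open>one\<close> supplies n = 1.\<close>
      by (rule guess[rule_format, of "\<lambda>_. \<Omega>" "\<lambda>_. p" "\<lambda>_. \<iota>", OF _ S one]) (use pre in blast)
  qed (use assms B in auto)
  show ?thesis
    using Tree_Souslin normal_Tree prolific_Tree splitting_Tree complete_Tree no_ascending_path by blast
qed

end
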